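(* Under the setting in the context (in particular $(\mathrm{VD})$ and $(\mathrm{RVD})$ hold), assume that $(\mathrm{E}_\le)$ holds. Then $(\mathrm{wEH}_q^0)$ holds if and only if $(\mathrm{wEH}_q)$ holds, for all $q\in(0,1]$; and $(\mathrm{EHI}^0)$ holds if and only if $(\mathrm{EHI})$ holds.
   Context: Space. $(M,d)$ is a locally compact, complete, separable metric space, $\mu$ is a Radon measure on $M$ with full support; every metric ball $B(x,r)=\{y\in M:d(x,y)<r\}$ (understood with fixed center and radius) is precompact; $\overline{R}:=2\,\mathrm{diam}(M,d)\in[0,\infty]$. For $B=B(x,r)$ and $\lambda>0$, $\lambda B:=B(x,\lambda r)$, and $V(x,r):=\mu(B(x,r))$. $U\Subset\Omega$ means that $\overline{U}$ is compact and contained in $\Omega$; $C_0(\Omega)$ denotes continuous functions compactly supported in $\Omega$; $\fint_A f\,d\nu:=\nu(A)^{-1}\int_A f\,d\nu$; $\mathrm{esup},\mathrm{einf}$ are the $\mu$-essential supremum and infimum; $f_-=\max(-f,0)$. $(\mathrm{VD})$: there is $C\ge1$ with $V(x,2R)\le CV(x,R)$ for all $x\in M$, $R>0$. $(\mathrm{RVD})$: there is $C\ge1$ with $V(x,R)\ge2V(x,C^{-1}R)$ for all $x\in M$, $0<R<\overline{R}$. Both are assumed. Form. $(\mathcal{E},\mathcal{F})$ is a regular Dirichlet form on $L^2(M,\mu)$ whose Beurling-Deny decomposition has no killing part: $\mathcal{E}(u,v)=\mathcal{E}^{(L)}(u,v)+\int_{M\times M}(u(x)-u(y))(v(x)-v(y))\,dj(x,y)$,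 with $\mathcal{E}^{(L)}$ strongly local and $j$ a symmetric Radon measure, $j(\mathrm{diag})=0$, $j(dx,dy)=d\mu(x)J(x,dy)=d\mu(y)J(y,dx)$ for a Borel transition kernel $J$. For open $\Omega\subset M$, $\mathcal{F}(\Omega)$ is the closure of $\mathcal{F}\cap C_0(\Omega)$ in $\mathcal{F}$ under $\mathcal{E}_1=\mathcal{E}+(\cdot,\cdot)_{L^2(\mu)}$; $P_t^\Omega$ is the heat semigroup on $L^2(\Omega)$ of $(\mathcal{E},\mathcal{F}(\Omega))$, extended to all $L^p(\Omega)$; $G^\Omega f:=\int_0^\infty P_t^\Omega f\,dt$. Scale. $W:M\times\mathbb{R}_+\to\mathbb{R}_+$ is such that each $W(x,\cdot)$ is strictly increasing and continuous, and there are $C_W\ge1$, $0<\beta_1\le\beta_2<\infty$ with $C_W^{-1}(R/r)^{\beta_1}\le W(x,R)/W(y,r)\le C_W(R/r)^{\beta_2}$ for all $0<r\le R<\infty$ and $d(x,y)\le R$. $W(B):=W(x,r)$ for $B=B(x,r)$. Harmonicity. For open $\Omega$, $\mathcal{F}'(\Omega)$ is the set of $v\in L^1_{loc}(M)$ for which there are $w\in\mathcal{F}$ and a strict neighbourhood $\Omega'$ of $\Omega$ (open, with $K\cap\Omega\Subset\Omega'$ for all compact $K\subset M$) with $v=w$ on $\Omega'$ and $\int_\Omega\int_M(v(x)-v(y))^2J(x,dy)d\mu(x)<\infty$; for $\varphi\in\mathcal{F}(\Omega)$, $\tilde{\mathcal{E}}(v,\varphi):=\mathcal{E}^{(L)}(w,\varphi)+\int_{M\times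 M}(\varphi(x)-\varphi(y))(v(x)-v(y))\,dj(x,y)$. $f\in\mathcal{F}'(\Omega)$ is harmonic on $\Omega$ if $\tilde{\mathcal{E}}(f,\varphi)=0$ for all $\varphi\in\mathcal{F}(\Omega)$, and superharmonic on $\Omega$ if $\tilde{\mathcal{E}}(f,\varphi)\ge0$ for all $0\le\varphi\in\mathcal{F}(\Omega)$. For a ball $B$ and $0<\lambda<1$, $T_B^{(\lambda)}(f):=\mathrm{esup}_{z\in\lambda B}\int_{B^c}|f(y)|J(z,dy)$. Conditions. $(\mathrm{E}_\le)$: there exist $C>0$, $\sigma\in(0,1)$ such that for every ball $B=B(x_0,R)$ with $0<R<\sigma\overline{R}$, $G^B1_B\le CW(B)$ $\mu$-a.e. on $B$. $(\mathrm{wEH}_q)$: there exist $C>1$, $\lambda_0\in(0,1)$ such that for every ball $B=B(x_0,R)$ with $R\in(0,\overline{R})$, every $0<\lambda\le\lambda_0$ and all $f$ that is non-negative, bounded and superharmonic on $B$, $\big(\fint_{\lambda B}f^qd\mu\big)^{1/q}\le C\big(\mathrm{einf}_{\lambda B}f+W(\lambda B)T_B^{(2/3)}(f_-)\big)$. $(\mathrm{wEH}_q^0)$: the same, required only for those $f$ that are in addition non-negative on $M$. $(\mathrm{EHI})$: there exist $C>1$, $\lambda_0\in(0,1)$ such that for every ball $B=B(x_0,R)$ with $R\in(0,\overline{R})$ and all $f\in\mathcal{F}'(B)$ that is non-negative, bounded and harmonic on $B$, $\mathrm{esup}_{\lambda_0B}f\le C\big(\mathrm{einf}_{\lambda_0B}f+W(B)T_B^{(3/4)}(f_-)\big)$.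 $(\mathrm{EHI}^0)$: the same, required only for those $f$ that are in addition non-negative on $M$. *)

theory Defs
  imports "HOL-Analysis.Analysis" "HOL-Probability.Essential_Supremum"
begin

text \<open>
  Elements of function spaces over \<^term>\<open>\<mu>\<close> (\<open>L\<^sup>2\<close>, form domains, \<open>L\<^sup>1\<close>-loc) are represented by Borel
  functions \<open>'a \<Rightarrow> real\<close>; two of them denote the same element when they agree \<open>\<mu>\<close>-almost
  everywhere. A form is a function of two arguments of which only the values on its domain matter.
\<close>

section \<open>Space and measure\<close>

text \<open>Radon measure on the open set \<open>U\<close>. For a jump measure \<open>U\<close> is the complement of the diagonal:
  compact sets that meet the diagonal may have infinite jump measure.\<close>

definition radon_on :: "'a::topological_space set \<Rightarrow> 'a measure \<Rightarrow> bool" where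
  "radon_on U \<nu> \<longleftrightarrow>
     sets \<nu> = sets borel \<and>
     (\<forall>K. compact K \<and> K \<subseteq> U \<longrightarrow> emeasure \<nu> K < \<infinity>) \<and>
     (\<forall>A\<in>sets borel. A \<subseteq> U \<longrightarrow>
        emeasure \<nu> A = (SUP K\<in>{K. compact K \<and> K \<subseteq> A}. emeasure \<nu> K))"

definition full_support :: "'a::topological_space measure \<Rightarrow> bool" where
  "full_support \<mu> \<longleftrightarrow> (\<forall>U. open U \<and> U \<noteq> {} \<longrightarrow> emeasure \<mu> U > 0)"

definition Rbar :: "'a::metric_space set \<Rightarrow> ereal" where
  "Rbar M = 2 * (SUP x\<in>M. SUP y\<in>M. ereal (dist x y))"

definition vol :: "'a::metric_space measure \<Rightarrow> 'a \<Rightarrow> real \<Rightarrow> real" where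
  "vol \<mu> x r = measure \<mu> (ball x r)"

definition VD :: "'a::metric_space measure \<Rightarrow> bool" where
  "VD \<mu> \<longleftrightarrow> (\<exists>C\<ge>1. \<forall>x. \<forall>R>0. vol \<mu> x (2 * R) \<le> C * vol \<mu> x R)"

definition RVD :: "'a::metric_space measure \<Rightarrow> bool" where
  "RVD \<mu> \<longleftrightarrow> (\<exists>C\<ge>1. \<forall>x. \<forall>R. 0 < R \<and> ereal R < Rbar (UNIV :: 'a set) \<longrightarrow>
     vol \<mu> x R \<ge> 2 * vol \<mu> x (R / C))"

definition scale_function :: "('a::metric_space \<Rightarrow> real \<Rightarrow> real) \<Rightarrow> bool" where
  "scale_function W \<longleftrightarrow>
     (\<forall>x. \<forall>r>0. W x r > 0) \<and>
     (\<forall>x. strict_mono_on {0<..} (W x) \<and> continuous_on {0<..} (W x)) \<and>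
     (\<exists>C \<beta>1 \<beta>2. C \<ge> 1 \<and> 0 < \<beta>1 \<and> \<beta>1 \<le> \<beta>2 \<and>
        (\<forall>x y r R. 0 < r \<and> r \<le> R \<and> dist x y \<le> R \<longrightarrow>
           inverse C * (R / r) powr \<beta>1 \<le> W x R / W y r \<and>
           W x R / W y r \<le> C * (R / r) powr \<beta>2))"

section \<open>Dirichlet forms\<close>

text \<open>\<open>L2 \<mu> \<Omega>\<close> is \<open>L\<^sup>2(\<Omega>,\<mu>)\<close>, its elements being extended by zero outside \<open>\<Omega>\<close>.\<close>

definition L2 :: "'a measure \<Rightarrow> 'a set \<Rightarrow> ('a \<Rightarrow> real) set" where
  "L2 \<mu> \<Omega> = {f \<in> borel_measurable \<mu>. integrable \<mu> (\<lambda>x. (f x)\<^sup>2) \<and> (AE x in \<mu>. x \<notin> \<Omega> \<longrightarrow> f x = 0)}"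

definition L2_inner :: "'a measure \<Rightarrow> ('a \<Rightarrow> real) \<Rightarrow> ('a \<Rightarrow> real) \<Rightarrow> real" where
  "L2_inner \<mu> f g = (LINT x|\<mu>. f x * g x)"

definition L2_dist_sq :: "'a measure \<Rightarrow> ('a \<Rightarrow> real) \<Rightarrow> ('a \<Rightarrow> real) \<Rightarrow> real" where
  "L2_dist_sq \<mu> f g = (LINT x|\<mu>. (f x - g x)\<^sup>2)"

type_synonym 'a form = "('a \<Rightarrow> real) \<Rightarrow> ('a \<Rightarrow> real) \<Rightarrow> real"

definition nonneg_symmetric_form :: "'a measure \<Rightarrow> ('a \<Rightarrow> real) set \<Rightarrow> 'a form \<Rightarrow> bool" where
  "nonneg_symmetric_form \<mu> F E \<longleftrightarrow>
     F \<subseteq> L2 \<mu> UNIV \<and>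
     (\<lambda>x. 0) \<in> F \<and>
     (\<forall>u\<in>F. \<forall>v\<in>F. \<forall>a b. (\<lambda>x. a * u x + b * v x) \<in> F) \<and>
     (\<forall>u\<in>F. \<forall>u'\<in>borel_measurable \<mu>. (AE x in \<mu>. u x = u' x) \<longrightarrow>
        u' \<in> F \<and> (\<forall>v\<in>F. E u' v = E u v)) \<and>
     (\<forall>u\<in>F. \<forall>v\<in>F. E u v = E v u) \<and>
     (\<forall>u\<in>F. \<forall>v\<in>F. \<forall>w\<in>F. \<forall>a b. E (\<lambda>x. a * u x + b * v x) w = a * E u w + b * E v w) \<and>
     (\<forall>u\<in>F. E u u \<ge> 0)"

definition E1_dist_sq :: "'a measure \<Rightarrow> 'a form \<Rightarrow> ('a \<Rightarrow> real) \<Rightarrow> ('a \<Rightarrow> real) \<Rightarrow> real" where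
  "E1_dist_sq \<mu> E u v = E (\<lambda>x. u x - v x) (\<lambda>x. u x - v x) + L2_dist_sq \<mu> u v"

definition dirichlet_form :: "'a measure \<Rightarrow> ('a \<Rightarrow> real) set \<Rightarrow> 'a form \<Rightarrow> bool" where
  "dirichlet_form \<mu> F E \<longleftrightarrow>
     nonneg_symmetric_form \<mu> F E \<and>
     (\<forall>f\<in>L2 \<mu> UNIV. \<forall>\<epsilon>>0. \<exists>u\<in>F. L2_dist_sq \<mu> f u < \<epsilon>) \<and>
     (\<forall>u :: nat \<Rightarrow> 'a \<Rightarrow> real. (\<forall>n. u n \<in> F) \<and>
        (\<forall>\<epsilon>>0. \<exists>N. \<forall>m\<ge>N. \<forall>n\<ge>N. E1_dist_sq \<mu> E (u m) (u n) < \<epsilon>) \<longrightarrow>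
        (\<exists>v\<in>F. (\<lambda>n. E1_dist_sq \<mu> E (u n) v) \<longlonglongrightarrow> 0)) \<and>
     (\<forall>u\<in>F. (\<lambda>x. min (max (u x) 0) 1) \<in> F \<and>
        E (\<lambda>x. min (max (u x) 0) 1) (\<lambda>x. min (max (u x) 0) 1) \<le> E u u)"

definition C0 :: "'a::topological_space set \<Rightarrow> ('a \<Rightarrow> real) set" where
  "C0 \<Omega> = {f. continuous_on UNIV f \<and> compact (closure {x. f x \<noteq> 0}) \<and> closure {x. f x \<noteq> 0} \<subseteq> \<Omega>}"

definition regular_dirichlet_form ::
    "'a::topological_space measure \<Rightarrow> ('a \<Rightarrow> real) set \<Rightarrow> 'a form \<Rightarrow> bool" where
  "regular_dirichlet_form \<mu> F E \<longleftrightarrow>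
     dirichlet_form \<mu> F E \<and>
     (\<forall>u\<in>F. \<forall>\<epsilon>>0. \<exists>\<phi>\<in>F \<inter> C0 UNIV. E1_dist_sq \<mu> E u \<phi> < \<epsilon>) \<and>
     (\<forall>g\<in>C0 UNIV. \<forall>\<epsilon>>0. \<exists>\<phi>\<in>F \<inter> C0 UNIV. \<forall>x. \<bar>g x - \<phi> x\<bar> < \<epsilon>)"

definition form_domain_on ::
    "'a::topological_space measure \<Rightarrow> ('a \<Rightarrow> real) set \<Rightarrow> 'a form \<Rightarrow> 'a set \<Rightarrow> ('a \<Rightarrow> real) set" where
  "form_domain_on \<mu> F E \<Omega> = {u \<in> F. \<forall>\<epsilon>>0. \<exists>\<phi>\<in>F \<inter> C0 \<Omega>. E1_dist_sq \<mu> E u \<phi> < \<epsilon>}"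

text \<open>Support of the measure \<open>\<bar>u\<bar> d\<mu>\<close>.\<close>

definition supp :: "'a::topological_space measure \<Rightarrow> ('a \<Rightarrow> real) \<Rightarrow> 'a set" where
  "supp \<mu> u = - \<Union>{U. open U \<and> (AE x in \<mu>. x \<in> U \<longrightarrow> u x = 0)}"

definition strongly_local ::
    "'a::topological_space measure \<Rightarrow> ('a \<Rightarrow> real) set \<Rightarrow> 'a form \<Rightarrow> bool" where
  "strongly_local \<mu> F EL \<longleftrightarrow>
     (\<forall>u\<in>F. \<forall>v\<in>F. compact (supp \<mu> u) \<and> compact (supp \<mu> v) \<and>
        (\<exists>U c. open U \<and> supp \<mu> u \<subseteq> U \<and> (AE x in \<mu>. x \<in> U \<longrightarrow> v x = c)) \<longrightarrow>
        EL u v = 0)"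

definition transition_kernel :: "('a::topological_space \<Rightarrow> 'a measure) \<Rightarrow> bool" where
  "transition_kernel J \<longleftrightarrow>
     (\<forall>x. sets (J x) = sets borel) \<and>
     (\<forall>A\<in>sets borel. (\<lambda>x. emeasure (J x) A) \<in> borel_measurable borel)"

text \<open>\<open>j(dx,dy) = d\<mu>(x) J(x,dy) = d\<mu>(y) J(y,dx)\<close>, tested on all Borel sets of the product and not
  only on rectangles, since \<open>j\<close> is in general infinite near the diagonal.\<close>

definition jump_measure ::
    "'a::{second_countable_topology,t2_space} measure \<Rightarrow> ('a \<times> 'a) measure \<Rightarrow> ('a \<Rightarrow> 'a measure) \<Rightarrow> bool" where
  "jump_measure \<mu> j J \<longleftrightarrow>
     radon_on (- {(x, y). x = y}) j \<and>
     emeasure j {(x, y). x = y} = 0 \<and>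
     (\<forall>A\<in>sets borel. emeasure j {(x, y). (y, x) \<in> A} = emeasure j A) \<and>
     transition_kernel J \<and>
     (\<forall>A\<in>sets borel. emeasure j A = (\<integral>\<^sup>+x. emeasure (J x) {y. (x, y) \<in> A} \<partial>\<mu>) \<and>
                      emeasure j A = (\<integral>\<^sup>+y. emeasure (J y) {x. (x, y) \<in> A} \<partial>\<mu>))"

definition jump_form :: "('a \<times> 'a) measure \<Rightarrow> 'a form" where
  "jump_form j u v = (LINT p|j. (u (fst p) - u (snd p)) * (v (fst p) - v (snd p)))"

definition beurling_deny_no_killing ::
    "'a::{second_countable_topology,t2_space} measure \<Rightarrow> ('a \<Rightarrow> real) set \<Rightarrow> 'a form \<Rightarrow>
     'a form \<Rightarrow> ('a \<times> 'a) measure \<Rightarrow> ('a \<Rightarrow> 'a measure) \<Rightarrow> bool" where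
  "beurling_deny_no_killing \<mu> F E EL j J \<longleftrightarrow>
     nonneg_symmetric_form \<mu> F EL \<and> strongly_local \<mu> F EL \<and> jump_measure \<mu> j J \<and>
     (\<forall>u\<in>F. integrable j (\<lambda>p. (u (fst p) - u (snd p))\<^sup>2)) \<and>
     (\<forall>u\<in>F. \<forall>v\<in>F. E u v = EL u v + jump_form j u v)"

section \<open>Heat semigroup and Green operator\<close>

text \<open>\<open>P\<close> is the heat semigroup of the closed form \<open>(E,D)\<close> on \<open>L\<^sup>2(\<Omega>,\<mu>)\<close>: a strongly continuous
  contraction semigroup whose infinitesimal generator is the operator \<open>A\<close> associated with the form,
  i.e. \<open>A u = g\<close> iff \<open>u \<in> D\<close> and \<open>E(u,v) = -(g,v)\<close> for all \<open>v \<in> D\<close>. This determines every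
  \<open>P t f\<close> up to \<open>\<mu>\<close>-null sets.\<close>

definition heat_semigroup ::
    "'a measure \<Rightarrow> 'a form \<Rightarrow> ('a \<Rightarrow> real) set \<Rightarrow> 'a set \<Rightarrow> (real \<Rightarrow> ('a \<Rightarrow> real) \<Rightarrow> 'a \<Rightarrow> real) \<Rightarrow> bool" where
  "heat_semigroup \<mu> E D \<Omega> P \<longleftrightarrow>
     (\<forall>t>0. \<forall>f\<in>L2 \<mu> \<Omega>. P t f \<in> L2 \<mu> \<Omega> \<and> L2_inner \<mu> (P t f) (P t f) \<le> L2_inner \<mu> f f) \<and>
     (\<forall>t>0. \<forall>f\<in>L2 \<mu> \<Omega>. \<forall>g\<in>L2 \<mu> \<Omega>. \<forall>a b.
        AE x in \<mu>. P t (\<lambda>x. a * f x + b * g x) x = a * P t f x + b * P t g x) \<and>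
     (\<forall>s>0. \<forall>t>0. \<forall>f\<in>L2 \<mu> \<Omega>. AE x in \<mu>. P (s + t) f x = P s (P t f) x) \<and>
     (\<forall>f\<in>L2 \<mu> \<Omega>. ((\<lambda>t. L2_dist_sq \<mu> (P t f) f) \<longlongrightarrow> 0) (at_right 0)) \<and>
     (\<forall>u\<in>L2 \<mu> \<Omega>. \<forall>g\<in>L2 \<mu> \<Omega>.
        ((\<lambda>t. L2_dist_sq \<mu> (\<lambda>x. (P t u x - u x) / t) g) \<longlongrightarrow> 0) (at_right 0) \<longleftrightarrow>
        u \<in> D \<and> (\<forall>v\<in>D. E u v = - L2_inner \<mu> g v))"

text \<open>\<open>g = \<integral>\<^sub>0\<^sup>\<infinity> P t f dt\<close> for \<open>f \<ge> 0\<close>. As each \<open>P t f\<close> is only defined up to a null set, the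
  pointwise integral is taken of a version that is jointly measurable in \<open>(t,x)\<close>; the result
  does not depend on the version, up to a null set.\<close>

definition is_green_potential ::
    "'a measure \<Rightarrow> (real \<Rightarrow> ('a \<Rightarrow> real) \<Rightarrow> 'a \<Rightarrow> real) \<Rightarrow> ('a \<Rightarrow> real) \<Rightarrow> ('a \<Rightarrow> ennreal) \<Rightarrow> bool" where
  "is_green_potential \<mu> P f g \<longleftrightarrow>
     (\<exists>p :: real \<Rightarrow> 'a \<Rightarrow> real.
        (\<lambda>(t, x). p t x) \<in> borel_measurable (lborel \<Otimes>\<^sub>M \<mu>) \<and>
        (\<forall>t>0. AE x in \<mu>. p t x = P t f x) \<and>
        (AE x in \<mu>. g x = (\<integral>\<^sup>+t\<in>{0<..}. ennreal (p t x) \<partial>lborel)))"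

definition E_le ::
    "'a::metric_space measure \<Rightarrow> ('a \<Rightarrow> real \<Rightarrow> real) \<Rightarrow>
     ('a set \<Rightarrow> real \<Rightarrow> ('a \<Rightarrow> real) \<Rightarrow> 'a \<Rightarrow> real) \<Rightarrow> bool" where
  "E_le \<mu> W P \<longleftrightarrow>
     (\<exists>C \<sigma>. C > 0 \<and> 0 < \<sigma> \<and> \<sigma> < 1 \<and>
        (\<forall>x0 R. 0 < R \<and> ereal R < ereal \<sigma> * Rbar (UNIV :: 'a set) \<longrightarrow>
           (\<exists>g. is_green_potential \<mu> (P (ball x0 R)) (indicator (ball x0 R)) g \<and>
              (AE x in \<mu>. x \<in> ball x0 R \<longrightarrow> g x \<le> ennreal (C * W x0 R)))))"

section \<open>Harmonic functions\<close>

definition L1_loc :: "'a::topological_space measure \<Rightarrow> ('a \<Rightarrow> real) set" where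
  "L1_loc \<mu> = {v \<in> borel_measurable \<mu>. \<forall>K. compact K \<longrightarrow> set_integrable \<mu> K v}"

definition compactly_contained :: "'a::topological_space set \<Rightarrow> 'a set \<Rightarrow> bool" where
  "compactly_contained U \<Omega> \<longleftrightarrow> compact (closure U) \<and> closure U \<subseteq> \<Omega>"

definition strict_nbhd :: "'a::topological_space set \<Rightarrow> 'a set \<Rightarrow> bool" where
  "strict_nbhd \<Omega> \<Omega>' \<longleftrightarrow> open \<Omega>' \<and> (\<forall>K. compact K \<longrightarrow> compactly_contained (K \<inter> \<Omega>) \<Omega>')"

definition local_extension ::
    "'a::topological_space measure \<Rightarrow> ('a \<Rightarrow> real) set \<Rightarrow> 'a set \<Rightarrow> ('a \<Rightarrow> real) \<Rightarrow> ('a \<Rightarrow> real) \<Rightarrow> bool" where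
  "local_extension \<mu> F \<Omega> v w \<longleftrightarrow>
     w \<in> F \<and> (\<exists>\<Omega>'. strict_nbhd \<Omega> \<Omega>' \<and> (AE x in \<mu>. x \<in> \<Omega>' \<longrightarrow> v x = w x))"

definition F' ::
    "'a::topological_space measure \<Rightarrow> ('a \<Rightarrow> real) set \<Rightarrow> ('a \<Rightarrow> 'a measure) \<Rightarrow> 'a set \<Rightarrow> ('a \<Rightarrow> real) set" where
  "F' \<mu> F J \<Omega> =
     {v \<in> L1_loc \<mu>. (\<exists>w. local_extension \<mu> F \<Omega> v w) \<and>
        (\<integral>\<^sup>+x\<in>\<Omega>. (\<integral>\<^sup>+y. ennreal ((v x - v y)\<^sup>2) \<partial>J x) \<partial>\<mu>) < \<infinity>}"

text \<open>The extended form, computed through \<open>w\<close> with \<open>local_extension \<mu> F \<Omega> v w\<close>. For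
  \<open>\<phi> \<in> form_domain_on \<mu> F E \<Omega>\<close> its value does not depend on \<open>w\<close>, as \<open>EL\<close> is strongly local.\<close>

definition ext_form ::
    "'a form \<Rightarrow> ('a \<times> 'a) measure \<Rightarrow> ('a \<Rightarrow> real) \<Rightarrow> ('a \<Rightarrow> real) \<Rightarrow> ('a \<Rightarrow> real) \<Rightarrow> real" where
  "ext_form EL j w v \<phi> = EL w \<phi> + jump_form j \<phi> v"

definition harmonic ::
    "'a::topological_space measure \<Rightarrow> ('a \<Rightarrow> real) set \<Rightarrow> 'a form \<Rightarrow> 'a form \<Rightarrow> ('a \<times> 'a) measure \<Rightarrow>
     ('a \<Rightarrow> 'a measure) \<Rightarrow> 'a set \<Rightarrow> ('a \<Rightarrow> real) \<Rightarrow> bool" where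
  "harmonic \<mu> F E EL j J \<Omega> f \<longleftrightarrow>
     f \<in> F' \<mu> F J \<Omega> \<and>
     (\<exists>w. local_extension \<mu> F \<Omega> f w \<and>
        (\<forall>\<phi>\<in>form_domain_on \<mu> F E \<Omega>. ext_form EL j w f \<phi> = 0))"

definition superharmonic ::
    "'a::topological_space measure \<Rightarrow> ('a \<Rightarrow> real) set \<Rightarrow> 'a form \<Rightarrow> 'a form \<Rightarrow> ('a \<times> 'a) measure \<Rightarrow>
     ('a \<Rightarrow> 'a measure) \<Rightarrow> 'a set \<Rightarrow> ('a \<Rightarrow> real) \<Rightarrow> bool" where
  "superharmonic \<mu> F E EL j J \<Omega> f \<longleftrightarrow>
     f \<in> F' \<mu> F J \<Omega> \<and>
     (\<exists>w. local_extension \<mu> F \<Omega> f w \<and>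
        (\<forall>\<phi>\<in>form_domain_on \<mu> F E \<Omega>. (AE x in \<mu>. 0 \<le> \<phi> x) \<longrightarrow> ext_form EL j w f \<phi> \<ge> 0))"

section \<open>Harnack inequalities\<close>

definition esup_on :: "'a measure \<Rightarrow> 'a set \<Rightarrow> ('a \<Rightarrow> real) \<Rightarrow> ereal" where
  "esup_on \<mu> A f = esssup (restrict_space \<mu> A) (\<lambda>x. ereal (f x))"

definition einf_on :: "'a measure \<Rightarrow> 'a set \<Rightarrow> ('a \<Rightarrow> real) \<Rightarrow> ereal" where
  "einf_on \<mu> A f = - esssup (restrict_space \<mu> A) (\<lambda>x. - ereal (f x))"

definition neg_part :: "('a \<Rightarrow> real) \<Rightarrow> 'a \<Rightarrow> real" where
  "neg_part f x = max (- f x) 0"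

definition average :: "'a measure \<Rightarrow> 'a set \<Rightarrow> ('a \<Rightarrow> real) \<Rightarrow> real" where
  "average \<mu> A f = (LINT x:A|\<mu>. f x) / measure \<mu> A"

text \<open>\<open>tail \<mu> J x0 R s f\<close> is \<open>T\<^sub>B\<^sup>(\<^sup>s\<^sup>)(f)\<close> for \<open>B = B(x0,R)\<close>, with values in \<open>[0,\<infinity>]\<close>.\<close>

definition tail ::
    "'a::metric_space measure \<Rightarrow> ('a \<Rightarrow> 'a measure) \<Rightarrow> 'a \<Rightarrow> real \<Rightarrow> real \<Rightarrow> ('a \<Rightarrow> real) \<Rightarrow> ennreal" where
  "tail \<mu> J x0 R s f =
     esssup (restrict_space \<mu> (ball x0 (s * R)))
       (\<lambda>z. \<integral>\<^sup>+y\<in>- ball x0 R. ennreal \<bar>f y\<bar> \<partial>J z)"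

definition nonneg_on :: "'a measure \<Rightarrow> 'a set \<Rightarrow> ('a \<Rightarrow> real) \<Rightarrow> bool" where
  "nonneg_on \<mu> A f \<longleftrightarrow> (AE x in \<mu>. x \<in> A \<longrightarrow> f x \<ge> 0)"

definition bounded_on :: "'a measure \<Rightarrow> 'a set \<Rightarrow> ('a \<Rightarrow> real) \<Rightarrow> bool" where
  "bounded_on \<mu> A f \<longleftrightarrow> (\<exists>K. AE x in \<mu>. x \<in> A \<longrightarrow> \<bar>f x\<bar> \<le> K)"

definition wEH ::
    "'a::metric_space measure \<Rightarrow> ('a \<Rightarrow> real) set \<Rightarrow> 'a form \<Rightarrow> 'a form \<Rightarrow> ('a \<times> 'a) measure \<Rightarrow>
     ('a \<Rightarrow> 'a measure) \<Rightarrow> ('a \<Rightarrow> real \<Rightarrow> real) \<Rightarrow> real \<Rightarrow> bool" where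
  "wEH \<mu> F E EL j J W q \<longleftrightarrow>
     (\<exists>C s0. C > 1 \<and> 0 < s0 \<and> s0 < 1 \<and>
        (\<forall>x0 R s f. 0 < R \<and> ereal R < Rbar (UNIV :: 'a set) \<and> 0 < s \<and> s \<le> s0 \<and>
           nonneg_on \<mu> (ball x0 R) f \<and> bounded_on \<mu> (ball x0 R) f \<and>
           superharmonic \<mu> F E EL j J (ball x0 R) f \<longrightarrow>
           ereal (average \<mu> (ball x0 (s * R)) (\<lambda>x. f x powr q) powr (1 / q))
             \<le> ereal C * (einf_on \<mu> (ball x0 (s * R)) f +
                  ereal (W x0 (s * R)) * enn2ereal (tail \<mu> J x0 R (2/3) (neg_part f)))))"

definition wEH0 ::
    "'a::metric_space measure \<Rightarrow> ('a \<Rightarrow> real) set \<Rightarrow> 'a form \<Rightarrow> 'a form \<Rightarrow> ('a \<times> 'a) measure \<Rightarrow>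
     ('a \<Rightarrow> 'a measure) \<Rightarrow> ('a \<Rightarrow> real \<Rightarrow> real) \<Rightarrow> real \<Rightarrow> bool" where
  "wEH0 \<mu> F E EL j J W q \<longleftrightarrow>
     (\<exists>C s0. C > 1 \<and> 0 < s0 \<and> s0 < 1 \<and>
        (\<forall>x0 R s f. 0 < R \<and> ereal R < Rbar (UNIV :: 'a set) \<and> 0 < s \<and> s \<le> s0 \<and>
           nonneg_on \<mu> UNIV f \<and> bounded_on \<mu> (ball x0 R) f \<and>
           superharmonic \<mu> F E EL j J (ball x0 R) f \<longrightarrow>
           ereal (average \<mu> (ball x0 (s * R)) (\<lambda>x. f x powr q) powr (1 / q))
             \<le> ereal C * (einf_on \<mu> (ball x0 (s * R)) f +
                  ereal (W x0 (s * R)) * enn2ereal (tail \<mu> J x0 R (2/3) (neg_part f)))))"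

definition EHI ::
    "'a::metric_space measure \<Rightarrow> ('a \<Rightarrow> real) set \<Rightarrow> 'a form \<Rightarrow> 'a form \<Rightarrow> ('a \<times> 'a) measure \<Rightarrow>
     ('a \<Rightarrow> 'a measure) \<Rightarrow> ('a \<Rightarrow> real \<Rightarrow> real) \<Rightarrow> bool" where
  "EHI \<mu> F E EL j J W \<longleftrightarrow>
     (\<exists>C s0. C > 1 \<and> 0 < s0 \<and> s0 < 1 \<and>
        (\<forall>x0 R f. 0 < R \<and> ereal R < Rbar (UNIV :: 'a set) \<and>
           nonneg_on \<mu> (ball x0 R) f \<and> bounded_on \<mu> (ball x0 R) f \<and>
           harmonic \<mu> F E EL j J (ball x0 R) f \<longrightarrow>
           esup_on \<mu> (ball x0 (s0 * R)) f
             \<le> ereal C * (einf_on \<mu> (ball x0 (s0 * R)) f +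
                  ereal (W x0 R) * enn2ereal (tail \<mu> J x0 R (3/4) (neg_part f)))))"

definition EHI0 ::
    "'a::metric_space measure \<Rightarrow> ('a \<Rightarrow> real) set \<Rightarrow> 'a form \<Rightarrow> 'a form \<Rightarrow> ('a \<times> 'a) measure \<Rightarrow>
     ('a \<Rightarrow> 'a measure) \<Rightarrow> ('a \<Rightarrow> real \<Rightarrow> real) \<Rightarrow> bool" where
  "EHI0 \<mu> F E EL j J W \<longleftrightarrow>
     (\<exists>C s0. C > 1 \<and> 0 < s0 \<and> s0 < 1 \<and>
        (\<forall>x0 R f. 0 < R \<and> ereal R < Rbar (UNIV :: 'a set) \<and>
           nonneg_on \<mu> UNIV f \<and> bounded_on \<mu> (ball x0 R) f \<and>
           harmonic \<mu> F E EL j J (ball x0 R) f \<longrightarrow>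
           esup_on \<mu> (ball x0 (s0 * R)) f
             \<le> ereal C * (einf_on \<mu> (ball x0 (s0 * R)) f +
                  ereal (W x0 R) * enn2ereal (tail \<mu> J x0 R (3/4) (neg_part f)))))"

end

theory Submission
  imports Defs
begin

text \<open>
  Only the implications from the inequalities for globally nonnegative functions to the general ones have
  content. Let \<open>f\<close> be nonnegative and harmonic or superharmonic on \<open>B = B(x\<^sub>0,R)\<close>. The positive part of \<open>f\<close> is in general
  not harmonic any more, but the defect is explicit: since \<open>f\<^sub>-\<close> vanishes on \<open>B\<close>, it meets a test function \<open>\<phi>\<close> supported
  in a smaller ball \<open>B' = B(x\<^sub>0,R')\<close> only through jumps from \<open>B'\<close> to the complement of \<open>B\<close>, and
  \<open>\<E>(f\<^sub>-,\<phi>) = - 2 (h,\<phi>)\<close> with \<open>h(x) = \<integral> f\<^sub>-(y) J(x,dy)\<close>. Here \<open>0 \<le> h \<le> T\<close> on \<open>B'\<close>, where \<open>T\<close> is the tail of \<open>f\<^sub>-\<close>. If \<open>g = G\<^sup>B\<^sup>' h\<close> denotes the Green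
  potential, so that \<open>\<E>(g,\<phi>) = (h,\<phi>)\<close>, then \<open>u = f\<^sub>+ + 2 g\<close> has \<open>\<E>(u,\<phi>) = \<E>(f,\<phi>)\<close> for all test functions inside \<open>B'\<close>. Hence
  \<open>u\<close> is harmonic or superharmonic on \<open>B'\<close> along with \<open>f\<close>, it is nonnegative everywhere, and \<open>f \<le> u \<le> f + 2 g\<close> on \<open>B\<close>.
  By \<open>(E\<^sub>\<le>)\<close>, \<open>g \<le> T G\<^sup>B\<^sup>' 1 \<le> C T W(B')\<close>. The inequality for \<open>u\<close> on \<open>B'\<close> is therefore the inequality for \<open>f\<close>, with the tail
  term produced by \<open>2 g\<close>. This is \<open>nonneg_replacement\<close>, applied in \<open>wEH0_imp_wEH\<close> and \<open>EHI0_imp_EHI\<close>.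

  The Green potential has to be an element of the form domain on \<open>B'\<close> that solves \<open>\<E>(g,\<phi>) = (h,\<phi>)\<close>, whereas \<open>(E\<^sub>\<le>)\<close> speaks
  about a time integral of the heat semigroup applied to \<open>1\<close>. The two are linked through the resolvent
  \<open>G\<^sub>\<alpha> = \<integral> e\<^sup>-\<^sup>\<alpha>\<^sup>t P\<^sub>t dt\<close>. It is constructed by minimisation, which also yields the maximum principle
  (\<open>resolvent_exists\<close>); differentiating \<open>e\<^sup>-\<^sup>\<alpha>\<^sup>t (P\<^sub>t G\<^sub>\<alpha>1, f)\<close> in \<open>t\<close> shows \<open>G\<^sub>\<alpha>1 \<le> C W(B')\<close> (\<open>resolvent_of_1_le\<close>); and by the maximum
  principle \<open>G\<^sub>\<alpha>h\<close> increases, as \<open>\<alpha> \<down> 0\<close>, to a solution that is bounded by \<open>T C W(B')\<close> (\<open>green_function_exists\<close>).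
\<close>

section \<open>Nonnegative symmetric forms\<close>

lemma sq_add_le: "(a + b)\<^sup>2 \<le> 2 * a\<^sup>2 + 2 * (b :: real)\<^sup>2"
  using zero_le_power2[of "a - b"] by (simp add: power2_eq_square algebra_simps)

lemma form_lincomb:
  "nonneg_symmetric_form \<mu> F A \<Longrightarrow> u \<in> F \<Longrightarrow> v \<in> F \<Longrightarrow> (\<lambda>x. a * u x + b * v x) \<in> F"
  by (simp add: nonneg_symmetric_form_def)

lemma form_diff:
  assumes "nonneg_symmetric_form \<mu> F A" "u \<in> F" "v \<in> F"
  shows "(\<lambda>x. u x - v x) \<in> F"
  using form_lincomb[OF assms, of 1 "-1"] by simp

lemma form_zero: "nonneg_symmetric_form \<mu> F A \<Longrightarrow> (\<lambda>x. 0) \<in> F"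
  by (simp add: nonneg_symmetric_form_def)

lemma form_AE:
  assumes "nonneg_symmetric_form \<mu> F A" "u \<in> F" "u' \<in> borel_measurable \<mu>" "AE x in \<mu>. u x = u' x"
  shows "u' \<in> F"
  using assms unfolding nonneg_symmetric_form_def by blast

lemma form_L2: "nonneg_symmetric_form \<mu> F A \<Longrightarrow> u \<in> F \<Longrightarrow> u \<in> L2 \<mu> UNIV"
  by (auto simp add: nonneg_symmetric_form_def)

lemma form_sym: "nonneg_symmetric_form \<mu> F A \<Longrightarrow> u \<in> F \<Longrightarrow> v \<in> F \<Longrightarrow> A u v = A v u"
  by (simp add: nonneg_symmetric_form_def)

lemma form_nonneg: "nonneg_symmetric_form \<mu> F A \<Longrightarrow> u \<in> F \<Longrightarrow> 0 \<le> A u u"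
  by (simp add: nonneg_symmetric_form_def)

lemma form_lincomb_left:
  "nonneg_symmetric_form \<mu> F A \<Longrightarrow> u \<in> F \<Longrightarrow> v \<in> F \<Longrightarrow> w \<in> F \<Longrightarrow>
     A (\<lambda>x. a * u x + b * v x) w = a * A u w + b * A v w"
  unfolding nonneg_symmetric_form_def by blast

lemma form_lincomb_right:
  assumes "nonneg_symmetric_form \<mu> F A" "u \<in> F" "v \<in> F" "w \<in> F"
  shows "A w (\<lambda>x. a * u x + b * v x) = a * A w u + b * A w v"
  using form_lincomb_left[OF assms, of a b] form_sym[OF assms(1,4) form_lincomb[OF assms(1-3), of a b]]
    form_sym[OF assms(1,4,2)] form_sym[OF assms(1,4,3)] by simp

lemma form_diff_left:
  assumes "nonneg_symmetric_form \<mu> F A" "u \<in> F" "v \<in> F" "w \<in> F"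
  shows "A (\<lambda>x. u x - v x) w = A u w - A v w"
  using form_lincomb_left[OF assms, of 1 "-1"] by simp

lemma form_diff_right:
  assumes "nonneg_symmetric_form \<mu> F A" "u \<in> F" "v \<in> F" "w \<in> F"
  shows "A w (\<lambda>x. u x - v x) = A w u - A w v"
  using form_lincomb_right[OF assms, of 1 "-1"] by simp

lemma form_expand:
  assumes "nonneg_symmetric_form \<mu> F A" "u \<in> F" "v \<in> F"
  shows "A (\<lambda>x. a * u x + b * v x) (\<lambda>x. a * u x + b * v x)
           = a\<^sup>2 * A u u + 2 * a * b * A u v + b\<^sup>2 * A v v"
  using form_lincomb_left[OF assms form_lincomb[OF assms], of a b a b]
    form_lincomb_right[OF assms assms(2), of a b] form_lincomb_right[OF assms assms(3), of a b]
    form_sym[OF assms]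
  by (simp add: power2_eq_square algebra_simps)

lemma form_diff_sq:
  assumes "nonneg_symmetric_form \<mu> F A" "u \<in> F" "v \<in> F"
  shows "A (\<lambda>x. u x - v x) (\<lambda>x. u x - v x) = A u u - 2 * A u v + A v v"
  using form_expand[OF assms, of 1 "-1"] by simp

text \<open>A nonnegative quadratic polynomial with a root at \<open>t = 0\<close> has no linear term; this turns minimality
  into an Euler-Lagrange equation.\<close>

lemma linear_coeff_eq_0:
  fixes b c :: real
  assumes "\<And>t. 0 \<le> 2 * t * b + t\<^sup>2 * c"
  shows "b = 0"
proof (rule ccontr)
  assume "b \<noteq> 0"
  define k where "k = \<bar>c\<bar> + 1"
  define t where "t = - b / k"
  have k: "k > 0" "c \<le> k" by (auto simp: k_def)
  have tk: "t * k = - b" using k by (simp add: t_def)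
  have "0 \<le> 2 * t * b + t\<^sup>2 * c" by (rule assms)
  also have "\<dots> \<le> 2 * (t * b) + t\<^sup>2 * k" using k by (simp add: mult_left_mono)
  also have "t\<^sup>2 * k = - (t * b)" using tk by (simp add: power2_eq_square mult.assoc)
  finally have "0 \<le> t * b" by argo
  moreover have "t * b < 0" using \<open>b \<noteq> 0\<close> k by (simp add: t_def field_simps not_le zero_less_mult_iff) linarith
  ultimately show False by simp
qed

lemma form_Cauchy_Schwarz:
  assumes "nonneg_symmetric_form \<mu> F A" "u \<in> F" "v \<in> F"
  shows "(A u v)\<^sup>2 \<le> A u u * A v v"
proof -
  have quad: "0 \<le> a\<^sup>2 * A u u + 2 * a * b * A u v + b\<^sup>2 * A v v" for a b
    using form_nonneg[OF assms(1) form_lincomb[OF assms, of a b]] form_expand[OF assms, of a b] by simp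
  show ?thesis
  proof (cases "A v v = 0")
    case True
    have "A u v = 0"
    proof (rule ccontr)
      assume "A u v \<noteq> 0"
      have "0 \<le> A u u + 2 * t * A u v" for t using quad[of 1 t] True by simp
      from this[of "- (A u u + 1) / (2 * A u v)"] have "0 \<le> A u u - (A u u + 1)"
        using \<open>A u v \<noteq> 0\<close> by (simp add: field_simps)
      then show False by simp
    qed
    then show ?thesis using True by simp
  next
    case False
    then have pos: "A v v > 0" using form_nonneg[OF assms(1,3)] by linarith
    have "0 \<le> (A v v)\<^sup>2 * A u u - 2 * A v v * (A u v)\<^sup>2 + (A u v)\<^sup>2 * A v v"
      using quad[of "A v v" "- A u v"] by (simp add: power2_eq_square algebra_simps)
    also have "\<dots> = A v v * (A u u * A v v - (A u v)\<^sup>2)"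
      by (simp add: power2_eq_square algebra_simps)
    finally show ?thesis using pos by (simp add: zero_le_mult_iff)
  qed
qed

lemma form_abs_le:
  assumes "nonneg_symmetric_form \<mu> F A" "u \<in> F" "v \<in> F"
  shows "\<bar>A u v\<bar> \<le> sqrt (A u u) * sqrt (A v v)"
  using real_sqrt_le_mono[OF form_Cauchy_Schwarz[OF assms]] by (simp add: real_sqrt_mult)

lemma form_tendsto:
  assumes A: "nonneg_symmetric_form \<mu> F A" and u: "\<And>n. u n \<in> F" "w \<in> F" and v: "v \<in> F"
    and lim: "(\<lambda>n. A (\<lambda>x. u n x - w x) (\<lambda>x. u n x - w x)) \<longlonglongrightarrow> 0"
  shows "(\<lambda>n. A (u n) v) \<longlonglongrightarrow> A w v"
proof -
  have "(\<lambda>n. sqrt (A (\<lambda>x. u n x - w x) (\<lambda>x. u n x - w x)) * sqrt (A v v)) \<longlonglongrightarrow> sqrt 0 * sqrt (A v v)"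
    by (intro tendsto_intros lim)
  then have l: "(\<lambda>n. sqrt (A (\<lambda>x. u n x - w x) (\<lambda>x. u n x - w x)) * sqrt (A v v)) \<longlonglongrightarrow> 0" by simp
  have b: "norm (A (u n) v - A w v) \<le> sqrt (A (\<lambda>x. u n x - w x) (\<lambda>x. u n x - w x)) * sqrt (A v v)" for n
    using form_abs_le[OF A form_diff[OF A u(1)[of n] u(2)] v] form_diff_left[OF A u(1)[of n] u(2) v] by simp
  have "(\<lambda>n. A (u n) v - A w v) \<longlonglongrightarrow> 0"
    by (rule Lim_null_comparison[OF always_eventually[OF allI] l]) (rule b)
  then show ?thesis by (rule LIM_zero_cancel)
qed

subsection \<open>The inner product as a form\<close>

lemma L2_measurable [measurable_dest]: "u \<in> L2 \<mu> \<Omega> \<Longrightarrow> u \<in> borel_measurable \<mu>"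
  by (simp add: L2_def)

lemma L2_mono: "u \<in> L2 \<mu> \<Omega> \<Longrightarrow> \<Omega> \<subseteq> \<Omega>' \<Longrightarrow> u \<in> L2 \<mu> \<Omega>'"
  by (auto simp: L2_def elim: AE_mp)

lemma L2_mult_integrable:
  assumes "u \<in> L2 \<mu> \<Omega>" "v \<in> L2 \<mu> \<Omega>'"
  shows "integrable \<mu> (\<lambda>x. u x * v x)"
proof (rule Bochner_Integration.integrable_bound)
  show "integrable \<mu> (\<lambda>x. (u x)\<^sup>2 + (v x)\<^sup>2)" using assms by (simp add: L2_def)
  show "(\<lambda>x. u x * v x) \<in> borel_measurable \<mu>" using assms[THEN L2_measurable] by measurable
  have "\<bar>a * b\<bar> \<le> a\<^sup>2 + b\<^sup>2" for a b :: real
  proof -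
    have "2 * \<bar>a * b\<bar> \<le> a\<^sup>2 + b\<^sup>2"
      using sum_squares_bound[of "\<bar>a\<bar>" "\<bar>b\<bar>"] by (simp add: abs_mult)
    then show ?thesis by linarith
  qed
  then show "AE x in \<mu>. norm (u x * v x) \<le> norm ((u x)\<^sup>2 + (v x)\<^sup>2)" by (auto intro: AE_I2)
qed

lemma L2_lincomb:
  assumes "u \<in> L2 \<mu> \<Omega>" "v \<in> L2 \<mu> \<Omega>"
  shows "(\<lambda>x. a * u x + b * v x) \<in> L2 \<mu> \<Omega>"
proof -
  note [measurable] = assms[THEN L2_measurable]
  have "integrable \<mu> (\<lambda>x. a\<^sup>2 * (u x)\<^sup>2 + 2 * a * b * (u x * v x) + b\<^sup>2 * (v x)\<^sup>2)"
    using assms L2_mult_integrable[OF assms] by (simp add: L2_def)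
  then have "integrable \<mu> (\<lambda>x. (a * u x + b * v x)\<^sup>2)"
    by (rule Bochner_Integration.integrable_cong[THEN iffD1, rotated -1])
      (simp_all add: power2_eq_square algebra_simps)
  moreover have "AE x in \<mu>. x \<notin> \<Omega> \<longrightarrow> a * u x + b * v x = 0"
    using assms unfolding L2_def by auto
  ultimately show ?thesis using L2_measurable[OF assms(1)] L2_measurable[OF assms(2)] unfolding L2_def by simp
qed

lemma L2_AE:
  assumes "u \<in> L2 \<mu> \<Omega>" "u' \<in> borel_measurable \<mu>" "AE x in \<mu>. u x = u' x"
  shows "u' \<in> L2 \<mu> \<Omega>"
proof -
  have "integrable \<mu> (\<lambda>x. (u' x)\<^sup>2) \<longleftrightarrow> integrable \<mu> (\<lambda>x. (u x)\<^sup>2)"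
    using assms L2_measurable[OF assms(1)] by (intro integrable_cong_AE) auto
  moreover have "AE x in \<mu>. x \<notin> \<Omega> \<longrightarrow> u' x = 0" using assms unfolding L2_def by auto
  ultimately show ?thesis using assms unfolding L2_def by auto
qed

lemma L2_inner_cong_AE:
  assumes "u \<in> borel_measurable \<mu>" "u' \<in> borel_measurable \<mu>" "v \<in> borel_measurable \<mu>"
    and "AE x in \<mu>. u x = u' x"
  shows "L2_inner \<mu> u v = L2_inner \<mu> u' v"
  unfolding L2_inner_def using assms by (intro integral_cong_AE) auto

lemma nonneg_symmetric_form_L2_inner: "nonneg_symmetric_form \<mu> (L2 \<mu> \<Omega>) (L2_inner \<mu>)"
  unfolding nonneg_symmetric_form_def
proof (intro conjI ballI allI impI)
  show "L2 \<mu> \<Omega> \<subseteq> L2 \<mu> UNIV" by (auto intro: L2_mono)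
  show "(\<lambda>x. 0) \<in> L2 \<mu> \<Omega>" by (simp add: L2_def)
next
  fix u v a b assume uv: "u \<in> L2 \<mu> \<Omega>" "v \<in> L2 \<mu> \<Omega>"
  show "(\<lambda>x. a * u x + b * v x) \<in> L2 \<mu> \<Omega>" by (rule L2_lincomb[OF uv])
  show "L2_inner \<mu> u v = L2_inner \<mu> v u" by (simp add: L2_inner_def mult.commute)
  fix w assume w: "w \<in> L2 \<mu> \<Omega>"
  show "L2_inner \<mu> (\<lambda>x. a * u x + b * v x) w = a * L2_inner \<mu> u w + b * L2_inner \<mu> v w"
    unfolding L2_inner_def using L2_mult_integrable[OF uv(1) w] L2_mult_integrable[OF uv(2) w]
    by (simp add: distrib_right mult.assoc)
next
  fix u u' assume u: "u \<in> L2 \<mu> \<Omega>" "u' \<in> borel_measurable \<mu>" "AE x in \<mu>. u x = u' x"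
  then show "u' \<in> L2 \<mu> \<Omega>" by (rule L2_AE)
  fix v assume "v \<in> L2 \<mu> \<Omega>"
  then show "L2_inner \<mu> u' v = L2_inner \<mu> u v"
    using u L2_inner_cong_AE[of u \<mu> u' v] L2_measurable by metis
next
  fix u show "0 \<le> L2_inner \<mu> u u" unfolding L2_inner_def by (rule integral_nonneg_AE) simp
qed

lemma L2_inner_self_eq_0:
  assumes "u \<in> L2 \<mu> \<Omega>" "L2_inner \<mu> u u \<le> 0"
  shows "AE x in \<mu>. u x = 0"
proof -
  have "L2_inner \<mu> u u = 0"
    using assms(2) form_nonneg[OF nonneg_symmetric_form_L2_inner assms(1)] by simp
  then have "AE x in \<mu>. u x * u x = 0"
    unfolding L2_inner_def using L2_mult_integrable[OF assms(1,1)]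
    by (subst (asm) integral_nonneg_eq_0_iff_AE) auto
  then show ?thesis by simp
qed

lemma L2_dist_sq_eq: "L2_dist_sq \<mu> u v = L2_inner \<mu> (\<lambda>x. u x - v x) (\<lambda>x. u x - v x)"
  by (simp add: L2_dist_sq_def L2_inner_def power2_eq_square)

text \<open>\<open>\<E>\<^sub>\<alpha> = \<E> + \<alpha> (\<cdot>,\<cdot>)\<close>.\<close>

definition shifted_form :: "'a measure \<Rightarrow> 'a form \<Rightarrow> real \<Rightarrow> 'a form" where
  "shifted_form \<mu> E \<alpha> u v = E u v + \<alpha> * L2_inner \<mu> u v"

lemma nonneg_symmetric_form_shifted:
  assumes E: "nonneg_symmetric_form \<mu> F E" and "0 \<le> \<alpha>"
  shows "nonneg_symmetric_form \<mu> F (shifted_form \<mu> E \<alpha>)"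
proof -
  note I = nonneg_symmetric_form_L2_inner[of \<mu> UNIV]
  have F: "F \<subseteq> L2 \<mu> UNIV" using form_L2[OF E] by blast
  have AE: "u' \<in> F \<and> (\<forall>v\<in>F. shifted_form \<mu> E \<alpha> u' v = shifted_form \<mu> E \<alpha> u v)"
    if "u \<in> F" "u' \<in> borel_measurable \<mu>" "AE x in \<mu>. u x = u' x" for u u'
  proof -
    have "u' \<in> F \<and> (\<forall>v\<in>F. E u' v = E u v)"
      using E that unfolding nonneg_symmetric_form_def by blast
    moreover have "\<forall>v\<in>F. L2_inner \<mu> u' v = L2_inner \<mu> u v"
      using F that I unfolding nonneg_symmetric_form_def by blast
    ultimately show ?thesis by (simp add: shifted_form_def)
  qed
  have sym: "shifted_form \<mu> E \<alpha> u v = shifted_form \<mu> E \<alpha> v u" if "u \<in> F" "v \<in> F" for u v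
    using form_sym[OF E that] form_sym[OF I] that F by (auto simp: shifted_form_def)
  have lin: "shifted_form \<mu> E \<alpha> (\<lambda>x. a * u x + b * v x) w
      = a * shifted_form \<mu> E \<alpha> u w + b * shifted_form \<mu> E \<alpha> v w" if "u \<in> F" "v \<in> F" "w \<in> F" for u v w a b
    using form_lincomb_left[OF E that, of a b] form_lincomb_left[OF I, of u v w a b] that F
    by (auto simp: shifted_form_def distrib_left subset_iff mult_ac)
  have nonneg: "0 \<le> shifted_form \<mu> E \<alpha> u u" if "u \<in> F" for u
    using form_nonneg[OF E that] form_nonneg[OF I, of u] that F \<open>0 \<le> \<alpha>\<close> by (auto simp: shifted_form_def)
  show ?thesis
    unfolding nonneg_symmetric_form_def
  proof (intro conjI ballI allI impI)
    fix u u' assume "u \<in> F" "u' \<in> borel_measurable \<mu>" "AE x in \<mu>. u x = u' x"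
    note AE = AE[OF this]
    show "u' \<in> F" using AE by blast
    fix v assume "v \<in> F"
    then show "shifted_form \<mu> E \<alpha> u' v = shifted_form \<mu> E \<alpha> u v" using AE by blast
  qed (fact F form_zero[OF E] | erule (1) form_lincomb[OF E] sym | erule (2) lin | erule nonneg)+
qed

lemma E1_dist_sq_eq: "E1_dist_sq \<mu> E u v = shifted_form \<mu> E 1 (\<lambda>x. u x - v x) (\<lambda>x. u x - v x)"
  by (simp add: E1_dist_sq_def shifted_form_def L2_dist_sq_eq)

text \<open>The sign of a function is seen by its \<open>L\<^sup>2\<close> approximations, since
  \<open>(min w 0)\<^sup>2 \<le> (u - w)\<^sup>2\<close> whenever \<open>u \<ge> 0\<close>.\<close>

lemma AE_nonneg_L2_limit:
  assumes u: "\<And>n. u n \<in> L2 \<mu> UNIV" "\<And>n. AE x in \<mu>. 0 \<le> u n x" and w: "w \<in> L2 \<mu> UNIV"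
    and lim: "(\<lambda>n. L2_dist_sq \<mu> (u n) w) \<longlonglongrightarrow> 0"
  shows "AE x in \<mu>. 0 \<le> w x"
proof -
  let ?m = "\<lambda>x. min (w x) 0"
  note [measurable] = L2_measurable[OF w] u(1)[THEN L2_measurable]
  have m: "?m \<in> L2 \<mu> UNIV"
  proof -
    have "integrable \<mu> (\<lambda>x. (w x)\<^sup>2)" using w by (simp add: L2_def)
    then have "integrable \<mu> (\<lambda>x. (?m x)\<^sup>2)"
      by (rule Bochner_Integration.integrable_bound) (auto simp: min_def)
    then show ?thesis unfolding L2_def by simp
  qed
  have "L2_inner \<mu> ?m ?m \<le> L2_dist_sq \<mu> (u n) w" for n
    unfolding L2_inner_def L2_dist_sq_eq
  proof (rule integral_mono_AE)
    show "integrable \<mu> (\<lambda>x. ?m x * ?m x)" by (rule L2_mult_integrable[OF m m])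
    show "integrable \<mu> (\<lambda>x. (u n x - w x) * (u n x - w x))"
      using form_diff[OF nonneg_symmetric_form_L2_inner u(1) w] by (intro L2_mult_integrable)
    show "AE x in \<mu>. ?m x * ?m x \<le> (u n x - w x) * (u n x - w x)"
      using u(2)[of n] 
    proof eventually_elim
      case (elim x)
      then have "(?m x)\<^sup>2 \<le> (u n x - w x)\<^sup>2" by (intro abs_le_square_iff[THEN iffD1]) auto
      then show ?case by (simp only: power2_eq_square)
    qed
  qed
  then have "L2_inner \<mu> ?m ?m \<le> 0" by (intro LIMSEQ_le_const[OF lim]) auto
  from L2_inner_self_eq_0[OF m this] show ?thesis by eventually_elim (auto simp: min_def split: if_splits)
qed

section \<open>Part of a Dirichlet form and its resolvent\<close>

lemma form_add_le:
  assumes A: "nonneg_symmetric_form \<mu> F A" and "u \<in> F" "v \<in> F"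
  shows "A (\<lambda>x. a * u x + b * v x) (\<lambda>x. a * u x + b * v x) \<le> 2 * a\<^sup>2 * A u u + 2 * b\<^sup>2 * A v v"
  using form_expand[OF assms, of a b] form_expand[OF assms, of a "- b"]
    form_nonneg[OF A form_lincomb[OF assms, of a "- b"]]
  by (simp add: algebra_simps)

lemma form_cong_AE:
  assumes A: "nonneg_symmetric_form \<mu> F A" and u: "u \<in> F" "u' \<in> borel_measurable \<mu>" "AE x in \<mu>. u x = u' x"
  shows "v \<in> F \<Longrightarrow> A u' v = A u v" and "A u' u' = A u u"
proof -
  have eq: "A u' v = A u v" if "v \<in> F" for v
    using A u that unfolding nonneg_symmetric_form_def by blast
  then show "v \<in> F \<Longrightarrow> A u' v = A u v" .
  have u': "u' \<in> F" by (rule form_AE[OF A u])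
  then show "A u' u' = A u u" using eq[of u'] eq[of u] form_sym[OF A u' u(1)] u(1) by simp
qed

lemma C0_lincomb:
  assumes "\<phi> \<in> C0 \<Omega>" "\<psi> \<in> C0 \<Omega>"
  shows "(\<lambda>x. a * \<phi> x + b * \<psi> x) \<in> C0 \<Omega>"
proof -
  have "closure {x. a * \<phi> x + b * \<psi> x \<noteq> 0} \<subseteq> closure ({x. \<phi> x \<noteq> 0} \<union> {x. \<psi> x \<noteq> 0})"
    by (rule closure_mono) auto
  then have sub: "closure {x. a * \<phi> x + b * \<psi> x \<noteq> 0} \<subseteq> closure {x. \<phi> x \<noteq> 0} \<union> closure {x. \<psi> x \<noteq> 0}"
    by simp
  moreover have "compact (closure {x. \<phi> x \<noteq> 0} \<union> closure {x. \<psi> x \<noteq> 0})"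
    using assms by (simp add: C0_def compact_Un)
  ultimately have "compact (closure {x. a * \<phi> x + b * \<psi> x \<noteq> 0})"
    using compact_Int_closed[of "closure {x. \<phi> x \<noteq> 0} \<union> closure {x. \<psi> x \<noteq> 0}"
      "closure {x. a * \<phi> x + b * \<psi> x \<noteq> 0}"] by (simp add: inf.absorb2)
  then show ?thesis using sub assms by (auto simp: C0_def intro!: continuous_intros)
qed

lemma C0_comp:
  assumes \<phi>: "\<phi> \<in> C0 \<Omega>" and "continuous_on UNIV f" "f 0 = (0 :: real)"
  shows "(\<lambda>x. f (\<phi> x)) \<in> C0 \<Omega>"
proof -
  have sub: "closure {x. f (\<phi> x) \<noteq> 0} \<subseteq> closure {x. \<phi> x \<noteq> 0}"
    using assms(3) by (intro closure_mono) auto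
  then have "compact (closure {x. f (\<phi> x) \<noteq> 0})"
    using compact_Int_closed[of "closure {x. \<phi> x \<noteq> 0}" "closure {x. f (\<phi> x) \<noteq> 0}"] \<phi>
    by (simp add: C0_def inf.absorb2)
  moreover have "continuous_on UNIV (\<lambda>x. f (\<phi> x))"
    using \<phi> assms(2) by (intro continuous_on_compose2[of UNIV f UNIV \<phi>]) (auto simp: C0_def)
  ultimately show ?thesis using sub \<phi> by (auto simp: C0_def)
qed

lemma C0_bounded:
  assumes "\<phi> \<in> C0 \<Omega>"
  obtains c where "c > 0" "\<And>x. \<phi> x \<le> c"
proof -
  let ?K = "closure {x. \<phi> x \<noteq> 0}"
  have "compact (\<phi> ` ?K)" using assms
    by (intro compact_continuous_image) (auto simp: C0_def intro: continuous_on_subset)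
  then have "bounded (\<phi> ` ?K)" by (rule compact_imp_bounded)
  then obtain b where b: "\<And>x. x \<in> ?K \<Longrightarrow> \<bar>\<phi> x\<bar> \<le> b" by (auto simp: bounded_iff)
  have "\<phi> x \<le> \<bar>b\<bar> + 1" for x
  proof (cases "x \<in> ?K")
    case False
    then have "\<phi> x = 0" using closure_subset[of "{x. \<phi> x \<noteq> 0}"] by auto
    then show ?thesis by simp
  next
    case True
    from b[OF this] show ?thesis by linarith
  qed
  then show ?thesis by (intro that[of "\<bar>b\<bar> + 1"]) auto
qed

locale dirichlet_space =
  fixes \<mu> :: "'a::topological_space measure" and F :: "('a \<Rightarrow> real) set" and E :: "'a form"
  assumes sets_mu [measurable_cong]: "sets \<mu> = sets borel"
    and dirichlet: "dirichlet_form \<mu> F E"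
begin

abbreviation "E1 \<equiv> shifted_form \<mu> E 1"
abbreviation "D \<equiv> form_domain_on \<mu> F E"

lemma form_E: "nonneg_symmetric_form \<mu> F E"
  using dirichlet by (simp add: dirichlet_form_def)

lemmas form_shifted = nonneg_symmetric_form_shifted[OF form_E]

lemma form_inner: "nonneg_symmetric_form \<mu> F (L2_inner \<mu>)"
proof -
  note I = nonneg_symmetric_form_L2_inner[of \<mu> UNIV] and L = form_L2[OF form_E]
  show ?thesis
    unfolding nonneg_symmetric_form_def
  proof (intro conjI ballI allI impI)
    show "F \<subseteq> L2 \<mu> UNIV" using L by blast
    show "(\<lambda>x. 0) \<in> F" by (rule form_zero[OF form_E])
  next
    fix u v a b assume uv: "u \<in> F" "v \<in> F"
    show "(\<lambda>x. a * u x + b * v x) \<in> F" by (rule form_lincomb[OF form_E uv])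
    show "L2_inner \<mu> u v = L2_inner \<mu> v u" by (rule form_sym[OF I uv[THEN L]])
    fix w assume "w \<in> F"
    then show "L2_inner \<mu> (\<lambda>x. a * u x + b * v x) w = a * L2_inner \<mu> u w + b * L2_inner \<mu> v w"
      by (intro form_lincomb_left[OF I] L uv)
  next
    fix u u' assume u: "u \<in> F" "u' \<in> borel_measurable \<mu>" "AE x in \<mu>. u x = u' x"
    show "u' \<in> F" by (rule form_AE[OF form_E u])
    fix v assume "v \<in> F"
    then have "v \<in> borel_measurable \<mu>" by (intro L2_measurable[OF L])
    then show "L2_inner \<mu> u' v = L2_inner \<mu> u v"
      using L2_inner_cong_AE[OF L2_measurable[OF L[OF u(1)]] u(2) _ u(3)] by simp
  next
    fix u assume "u \<in> F" then show "0 \<le> L2_inner \<mu> u u" by (intro form_nonneg[OF I] L)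
  qed
qed

lemma F_measurable: "u \<in> F \<Longrightarrow> u \<in> borel_measurable \<mu>"
  using form_L2[OF form_E] L2_measurable by blast

lemma complete:
  assumes "\<And>n. u n \<in> F" "\<And>\<epsilon>. 0 < \<epsilon> \<Longrightarrow> \<exists>N. \<forall>m\<ge>N. \<forall>n\<ge>N. E1_dist_sq \<mu> E (u m) (u n) < \<epsilon>"
  obtains w where "w \<in> F" "(\<lambda>n. E1_dist_sq \<mu> E (u n) w) \<longlonglongrightarrow> 0"
proof -
  have "\<forall>u :: nat \<Rightarrow> 'a \<Rightarrow> real. (\<forall>n. u n \<in> F) \<and>
      (\<forall>\<epsilon>>0. \<exists>N. \<forall>m\<ge>N. \<forall>n\<ge>N. E1_dist_sq \<mu> E (u m) (u n) < \<epsilon>) \<longrightarrow>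
      (\<exists>v\<in>F. (\<lambda>n. E1_dist_sq \<mu> E (u n) v) \<longlonglongrightarrow> 0)"
    using dirichlet unfolding dirichlet_form_def by (elim conjE)
  from this[rule_format, of u] assms that show ?thesis by blast
qed

lemma E1_dist_sq_triangle:
  assumes "u \<in> F" "v \<in> F" "w \<in> F"
  shows "E1_dist_sq \<mu> E u w \<le> 2 * E1_dist_sq \<mu> E u v + 2 * E1_dist_sq \<mu> E v w"
  unfolding E1_dist_sq_eq
  using form_add_le[OF form_shifted form_diff[OF form_E assms(1,2)] form_diff[OF form_E assms(2,3)], of 1 1 1]
  by simp

lemma E1_dist_sq_commute: "u \<in> F \<Longrightarrow> v \<in> F \<Longrightarrow> E1_dist_sq \<mu> E u v = E1_dist_sq \<mu> E v u"
  using form_diff_sq[OF form_shifted, of 1 u v] form_diff_sq[OF form_shifted, of 1 v u]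
    form_sym[OF form_shifted, of 1 u v] by (simp add: E1_dist_sq_eq)

lemma E_diff_le_E1_dist_sq:
  assumes "u \<in> F" "v \<in> F"
  shows "E (\<lambda>x. u x - v x) (\<lambda>x. u x - v x) \<le> E1_dist_sq \<mu> E u v"
    and "L2_dist_sq \<mu> u v \<le> E1_dist_sq \<mu> E u v"
    and "0 \<le> E (\<lambda>x. u x - v x) (\<lambda>x. u x - v x)" "0 \<le> L2_dist_sq \<mu> u v"
  using form_nonneg[OF form_E form_diff[OF form_E assms]]
    form_nonneg[OF form_inner form_diff[OF form_E assms]]
  unfolding E1_dist_sq_def L2_dist_sq_eq by auto

lemma E1_limits:
  assumes "\<And>n. u n \<in> F" "w \<in> F" "(\<lambda>n. E1_dist_sq \<mu> E (u n) w) \<longlonglongrightarrow> 0"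
  shows "(\<lambda>n. E (\<lambda>x. u n x - w x) (\<lambda>x. u n x - w x)) \<longlonglongrightarrow> 0"
    and "(\<lambda>n. L2_dist_sq \<mu> (u n) w) \<longlonglongrightarrow> 0"
    and "v \<in> F \<Longrightarrow> (\<lambda>n. E (u n) v) \<longlonglongrightarrow> E w v"
    and "v \<in> F \<Longrightarrow> (\<lambda>n. L2_inner \<mu> (u n) v) \<longlonglongrightarrow> L2_inner \<mu> w v"
proof -
  show E: "(\<lambda>n. E (\<lambda>x. u n x - w x) (\<lambda>x. u n x - w x)) \<longlonglongrightarrow> 0"
    by (rule tendsto_sandwich[OF _ _ tendsto_const assms(3)])
      (auto intro!: always_eventually E_diff_le_E1_dist_sq assms(1,2))
  show L: "(\<lambda>n. L2_dist_sq \<mu> (u n) w) \<longlonglongrightarrow> 0"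
    by (rule tendsto_sandwich[OF _ _ tendsto_const assms(3)])
      (auto intro!: always_eventually E_diff_le_E1_dist_sq assms(1,2))
  show "v \<in> F \<Longrightarrow> (\<lambda>n. E (u n) v) \<longlonglongrightarrow> E w v"
    by (rule form_tendsto[OF form_E assms(1,2) _ E])
  show "v \<in> F \<Longrightarrow> (\<lambda>n. L2_inner \<mu> (u n) v) \<longlonglongrightarrow> L2_inner \<mu> w v"
    using form_tendsto[OF form_inner assms(1,2)] L by (simp add: L2_dist_sq_eq)
qed

subsection \<open>The part of the form on an open set\<close>

lemma D_subset: "u \<in> D \<Omega> \<Longrightarrow> u \<in> F"
  by (simp add: form_domain_on_def)

lemma C0_in_D: "\<phi> \<in> F \<Longrightarrow> \<phi> \<in> C0 \<Omega> \<Longrightarrow> \<phi> \<in> D \<Omega>"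
  using form_zero[OF form_E] form_lincomb_left[OF form_shifted[of 1], of "\<lambda>x. 0" "\<lambda>x. 0" "\<lambda>x. 0" 0 0]
  by (auto simp: form_domain_on_def E1_dist_sq_eq intro!: bexI[of _ \<phi>])

lemma D_mono: "\<Omega> \<subseteq> \<Omega>' \<Longrightarrow> D \<Omega> \<subseteq> D \<Omega>'"
  unfolding form_domain_on_def C0_def by blast

lemma D_approx:
  assumes "u \<in> D \<Omega>"
  obtains \<phi> where "\<And>n. \<phi> n \<in> F \<inter> C0 \<Omega>" "(\<lambda>n. E1_dist_sq \<mu> E (\<phi> n) u) \<longlonglongrightarrow> 0"
proof -
  have "\<forall>n. \<exists>\<phi>\<in>F \<inter> C0 \<Omega>. E1_dist_sq \<mu> E u \<phi> < 1 / real (Suc n)"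
    using assms by (auto simp: form_domain_on_def)
  then obtain \<phi> where \<phi>: "\<And>n. \<phi> n \<in> F \<inter> C0 \<Omega>" "\<And>n. E1_dist_sq \<mu> E u (\<phi> n) < 1 / real (Suc n)"
    by metis
  have u: "u \<in> F" by (rule D_subset[OF assms])
  have "(\<lambda>n. E1_dist_sq \<mu> E (\<phi> n) u) \<longlonglongrightarrow> 0"
  proof (rule tendsto_sandwich[OF always_eventually always_eventually tendsto_const LIMSEQ_Suc[OF lim_1_over_n]]; intro allI)
    show "0 \<le> E1_dist_sq \<mu> E (\<phi> n) u" for n
      unfolding E1_dist_sq_eq using \<phi>(1) u by (intro form_nonneg[OF form_shifted] form_diff[OF form_E]) auto
    show "E1_dist_sq \<mu> E (\<phi> n) u \<le> 1 / of_nat (Suc n)" for n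
      using \<phi>(2)[of n] E1_dist_sq_commute[OF u, of "\<phi> n"] \<phi>(1)[of n] by simp
  qed
  with \<phi>(1) show ?thesis by (rule that)
qed

lemma D_closed:
  assumes "\<And>n. u n \<in> D \<Omega>" "w \<in> F" "(\<lambda>n. E1_dist_sq \<mu> E (u n) w) \<longlonglongrightarrow> 0"
  shows "w \<in> D \<Omega>"
proof -
  have "\<exists>\<phi>\<in>F \<inter> C0 \<Omega>. E1_dist_sq \<mu> E w \<phi> < \<epsilon>" if "\<epsilon> > 0" for \<epsilon>
  proof -
    have "eventually (\<lambda>n. E1_dist_sq \<mu> E (u n) w < \<epsilon> / 4) sequentially"
      using order_tendstoD(2)[OF assms(3), of "\<epsilon> / 4"] that by simp
    then obtain n where n: "E1_dist_sq \<mu> E (u n) w < \<epsilon> / 4"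
      using eventually_happens'[OF sequentially_bot] by blast
    from assms(1)[of n] that obtain \<phi> where \<phi>: "\<phi> \<in> F \<inter> C0 \<Omega>" "E1_dist_sq \<mu> E (u n) \<phi> < \<epsilon> / 4"
      unfolding form_domain_on_def by (auto dest: spec[of _ "\<epsilon> / 4"])
    have "E1_dist_sq \<mu> E w \<phi> \<le> 2 * E1_dist_sq \<mu> E w (u n) + 2 * E1_dist_sq \<mu> E (u n) \<phi>"
      using \<phi>(1) by (intro E1_dist_sq_triangle assms(2) D_subset[OF assms(1)]) auto
    also have "\<dots> < \<epsilon>" using n \<phi>(2) E1_dist_sq_commute[OF assms(2) D_subset[OF assms(1)]] by simp
    finally show ?thesis using \<phi>(1) by blast
  qed
  then show ?thesis using assms(2) by (simp add: form_domain_on_def)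
qed

lemma D_lincomb:
  assumes "u \<in> D \<Omega>" "v \<in> D \<Omega>"
  shows "(\<lambda>x. a * u x + b * v x) \<in> D \<Omega>"
proof -
  from D_approx[OF assms(1)] obtain \<phi> where
    \<phi>: "\<And>n. \<phi> n \<in> F \<inter> C0 \<Omega>" "(\<lambda>n. E1_dist_sq \<mu> E (\<phi> n) u) \<longlonglongrightarrow> 0" by blast
  from D_approx[OF assms(2)] obtain \<psi> where
    \<psi>: "\<And>n. \<psi> n \<in> F \<inter> C0 \<Omega>" "(\<lambda>n. E1_dist_sq \<mu> E (\<psi> n) v) \<longlonglongrightarrow> 0" by blast
  note uv = assms[THEN D_subset]
  let ?w = "\<lambda>x. a * u x + b * v x" and ?\<chi> = "\<lambda>n x. a * \<phi> n x + b * \<psi> n x"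
  have bound: "E1_dist_sq \<mu> E (?\<chi> n) ?w \<le> 2 * a\<^sup>2 * E1_dist_sq \<mu> E (\<phi> n) u + 2 * b\<^sup>2 * E1_dist_sq \<mu> E (\<psi> n) v" for n
  proof -
    have "(\<lambda>x. ?\<chi> n x - ?w x) = (\<lambda>x. a * (\<phi> n x - u x) + b * (\<psi> n x - v x))"
      by (simp add: algebra_simps)
    then show ?thesis
      using form_add_le[OF form_shifted[of 1] form_diff[OF form_E _ uv(1)] form_diff[OF form_E _ uv(2)], of "\<phi> n" "\<psi> n" a b]
        \<phi>(1)[of n] \<psi>(1)[of n] by (simp add: E1_dist_sq_eq)
  qed
  show ?thesis
  proof (rule D_closed)
    show "?\<chi> n \<in> D \<Omega>" for n
      using \<phi>(1)[of n] \<psi>(1)[of n] by (intro C0_in_D C0_lincomb form_lincomb[OF form_E]) auto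
    show w: "?w \<in> F" by (rule form_lincomb[OF form_E uv])
    have "(\<lambda>n. 2 * a\<^sup>2 * E1_dist_sq \<mu> E (\<phi> n) u + 2 * b\<^sup>2 * E1_dist_sq \<mu> E (\<psi> n) v) \<longlonglongrightarrow> 2 * a\<^sup>2 * 0 + 2 * b\<^sup>2 * 0"
      by (intro tendsto_intros \<phi>(2) \<psi>(2))
    then have lim: "(\<lambda>n. 2 * a\<^sup>2 * E1_dist_sq \<mu> E (\<phi> n) u + 2 * b\<^sup>2 * E1_dist_sq \<mu> E (\<psi> n) v) \<longlonglongrightarrow> 0" by simp
    have "0 \<le> E1_dist_sq \<mu> E (?\<chi> n) ?w" for n
      unfolding E1_dist_sq_eq using \<phi>(1)[of n] \<psi>(1)[of n] w
      by (intro form_nonneg[OF form_shifted] form_diff[OF form_E] form_lincomb[OF form_E] uv) auto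
    then show "(\<lambda>n. E1_dist_sq \<mu> E (?\<chi> n) ?w) \<longlonglongrightarrow> 0"
      by (intro tendsto_sandwich[OF _ _ tendsto_const lim] always_eventually allI bound)
  qed
qed

lemma D_diff: "u \<in> D \<Omega> \<Longrightarrow> v \<in> D \<Omega> \<Longrightarrow> (\<lambda>x. u x - v x) \<in> D \<Omega>"
  using D_lincomb[of u \<Omega> v 1 "-1"] by simp

lemma D_AE:
  assumes "u \<in> D \<Omega>" "u' \<in> borel_measurable \<mu>" "AE x in \<mu>. u x = u' x"
  shows "u' \<in> D \<Omega>"
proof -
  note u = D_subset[OF assms(1)]
  have u': "u' \<in> F" by (rule form_AE[OF form_E u assms(2,3)])
  have "E1_dist_sq \<mu> E u u' = E1_dist_sq \<mu> E u u"
    unfolding E1_dist_sq_eq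
    by (rule form_cong_AE(2)[OF form_shifted form_diff[OF form_E u u]])
      (use assms F_measurable[OF u] in auto)
  also have "\<dots> = 0" unfolding E1_dist_sq_eq using form_diff_sq[OF form_shifted[of 1] u u] by simp
  finally show ?thesis using assms(1) u' by (simp add: D_closed[of "\<lambda>n. u"])
qed

lemma D_L2:
  assumes u: "u \<in> D \<Omega>" and [measurable]: "\<Omega> \<in> sets borel"
  shows "u \<in> L2 \<mu> \<Omega>"
proof -
  from D_approx[OF u] obtain \<phi> where
    \<phi>: "\<And>n. \<phi> n \<in> F \<inter> C0 \<Omega>" "(\<lambda>n. E1_dist_sq \<mu> E (\<phi> n) u) \<longlonglongrightarrow> 0" by blast
  note uF = D_subset[OF u]
  have \<phi>0: "\<phi> n x = 0" if "x \<notin> \<Omega>" for n x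
    using \<phi>(1)[of n] that closure_subset[of "{x. \<phi> n x \<noteq> 0}"] by (auto simp: C0_def)
  note [measurable] = F_measurable[OF uF]
  define m where "m = (\<lambda>x. u x * indicator (- \<Omega>) x)"
  have [measurable]: "m \<in> borel_measurable \<mu>" unfolding m_def by measurable
  have uL: "u \<in> L2 \<mu> UNIV" by (rule form_L2[OF form_E uF])
  have m: "m \<in> L2 \<mu> UNIV"
  proof -
    have "integrable \<mu> (\<lambda>x. (u x)\<^sup>2)" using uL by (simp add: L2_def)
    then have "integrable \<mu> (\<lambda>x. (m x)\<^sup>2)"
      by (rule Bochner_Integration.integrable_bound) (auto simp: m_def indicator_def)
    then show ?thesis unfolding L2_def by simp
  qed
  have "L2_inner \<mu> m m \<le> L2_dist_sq \<mu> (\<phi> n) u" for n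
    unfolding L2_inner_def L2_dist_sq_eq
  proof (rule integral_mono)
    show "integrable \<mu> (\<lambda>x. m x * m x)" by (rule L2_mult_integrable[OF m m])
    have "\<phi> n \<in> L2 \<mu> UNIV" using \<phi>(1)[of n] form_L2[OF form_E] by blast
    from form_diff[OF nonneg_symmetric_form_L2_inner this uL]
    show "integrable \<mu> (\<lambda>x. (\<phi> n x - u x) * (\<phi> n x - u x))" by (intro L2_mult_integrable)
    show "m x * m x \<le> (\<phi> n x - u x) * (\<phi> n x - u x)" for x
      using \<phi>0[of x n] by (cases "x \<in> \<Omega>") (auto simp: m_def)
  qed
  then have "L2_inner \<mu> m m \<le> 0"
    using \<phi>(1) by (intro LIMSEQ_le_const[OF E1_limits(2)[OF _ uF \<phi>(2)]]) auto
  from L2_inner_self_eq_0[OF m this] have "AE x in \<mu>. x \<notin> \<Omega> \<longrightarrow> u x = 0"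
    by eventually_elim (auto simp: m_def indicator_def)
  then show ?thesis using uL by (simp add: L2_def)
qed

text \<open>The unit contraction suffices for the positive part of a function of compact support: such a
  function has an upper bound \<open>c\<close>, and \<open>max \<phi> 0\<close> is \<open>c\<close> times the unit contraction of \<open>\<phi> / c\<close>.\<close>

lemma pos_part_C0:
  assumes "\<phi> \<in> F" "\<phi> \<in> C0 \<Omega>"
  shows "(\<lambda>x. max (\<phi> x) 0) \<in> F" "(\<lambda>x. max (\<phi> x) 0) \<in> C0 \<Omega>"
    and "E (\<lambda>x. max (\<phi> x) 0) (\<lambda>x. max (\<phi> x) 0) \<le> E \<phi> \<phi>"
proof -
  obtain c where c: "c > 0" "\<And>x. \<phi> x \<le> c" using C0_bounded[OF assms(2)] by blast
  let ?u = "\<lambda>x. inverse c * \<phi> x + 0 * \<phi> x"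
  let ?v = "\<lambda>x. min (max (?u x) 0) 1"
  have u: "?u \<in> F" by (rule form_lincomb[OF form_E assms(1,1)])
  then have v: "?v \<in> F" "E ?v ?v \<le> E ?u ?u" using dirichlet by (auto simp: dirichlet_form_def)
  have eq: "(\<lambda>x. max (\<phi> x) 0) = (\<lambda>x. c * ?v x + 0 * ?v x)"
    using c by (auto simp: max_def min_def field_simps fun_eq_iff)
  show "(\<lambda>x. max (\<phi> x) 0) \<in> F" unfolding eq by (rule form_lincomb[OF form_E v(1,1)])
  show "(\<lambda>x. max (\<phi> x) 0) \<in> C0 \<Omega>"
    by (rule C0_comp[OF assms(2), of "\<lambda>t. max t 0"]) (auto intro!: continuous_intros)
  have "c\<^sup>2 * E ?v ?v \<le> c\<^sup>2 * E ?u ?u" using v(2) by (intro mult_left_mono) auto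
  also have "\<dots> = E \<phi> \<phi>"
    using form_expand[OF form_E assms(1,1), of "inverse c" 0] c(1) by (simp add: power2_eq_square field_simps)
  finally show "E (\<lambda>x. max (\<phi> x) 0) (\<lambda>x. max (\<phi> x) 0) \<le> E \<phi> \<phi>"
    unfolding eq using form_expand[OF form_E v(1,1), of c 0] by simp
qed

subsection \<open>The resolvent\<close>

text \<open>\<open>g = G\<^sub>\<alpha>\<^sup>\<Omega> h\<close>, in weak form.\<close>

definition resolvent :: "'a set \<Rightarrow> real \<Rightarrow> ('a \<Rightarrow> real) \<Rightarrow> ('a \<Rightarrow> real) \<Rightarrow> bool" where
  "resolvent \<Omega> \<alpha> h g \<longleftrightarrow> g \<in> D \<Omega> \<and> (\<forall>v\<in>D \<Omega>. E g v + \<alpha> * L2_inner \<mu> g v = L2_inner \<mu> h v)"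

text \<open>The solution minimises \<open>Q v = \<E>\<^sub>\<alpha>(v,v) - 2(h,v)\<close> over \<open>\<F> \<inter> C\<^sub>0(\<Omega>)\<close>, and by the parallelogram law
  every minimising sequence converges to it. When \<open>h \<ge> 0\<close>, replacing a competitor by its positive part
  does not increase \<open>Q\<close>, so the minimising sequence, and with it the limit, can be taken nonnegative.
  In this way existence and the maximum principle come out of the same argument.\<close>

lemma resolvent_exists:
  assumes \<alpha>: "0 < \<alpha>" "\<alpha> \<le> 1" and h: "h \<in> L2 \<mu> UNIV"
  obtains g where "resolvent \<Omega> \<alpha> h g" "(AE x in \<mu>. 0 \<le> h x) \<Longrightarrow> AE x in \<mu>. 0 \<le> g x"
proof -
  define A where "A = shifted_form \<mu> E \<alpha>"
  define Q where "Q v = A v v - 2 * L2_inner \<mu> h v" for v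
  define pos where "pos \<longleftrightarrow> (AE x in \<mu>. 0 \<le> h x)"
  define S where "S = {\<phi> \<in> F \<inter> C0 \<Omega>. pos \<longrightarrow> (\<forall>x. 0 \<le> \<phi> x)}"
  have A: "nonneg_symmetric_form \<mu> F A" unfolding A_def using \<alpha> by (intro form_shifted) simp
  note I = nonneg_symmetric_form_L2_inner[of \<mu> UNIV]
  have L: "u \<in> L2 \<mu> UNIV" if "u \<in> F" for u by (rule form_L2[OF form_E that])
  have lower: "- L2_inner \<mu> h h / \<alpha> \<le> Q v" if "v \<in> F" for v
  proof -
    have "0 \<le> L2_inner \<mu> (\<lambda>x. \<alpha> * v x + (-1) * h x) (\<lambda>x. \<alpha> * v x + (-1) * h x)"
      by (rule form_nonneg[OF I form_lincomb[OF I L[OF that] h]])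
    also have "\<dots> = \<alpha> * (\<alpha> * L2_inner \<mu> v v - 2 * L2_inner \<mu> h v) + L2_inner \<mu> h h"
      using form_expand[OF I L[OF that] h, of \<alpha> "-1"] form_sym[OF I L[OF that] h]
      by (simp add: power2_eq_square algebra_simps)
    finally have "- L2_inner \<mu> h h / \<alpha> \<le> \<alpha> * L2_inner \<mu> v v - 2 * L2_inner \<mu> h v"
      using \<alpha> by (simp add: field_simps)
    also have "\<dots> \<le> Q v" using form_nonneg[OF form_E that] by (simp add: Q_def A_def shifted_form_def)
    finally show ?thesis .
  qed
  define m where "m = Inf (Q ` S)"
  have S0: "(\<lambda>x. 0) \<in> S" using form_zero[OF form_E] by (simp add: S_def C0_def)
  have bdd: "bdd_below (Q ` S)" using lower by (auto simp: S_def intro!: bdd_belowI)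
  have m_le_S: "m \<le> Q \<phi>" if "\<phi> \<in> S" for \<phi>
    unfolding m_def using that bdd by (intro cInf_lower) auto
  have m_le: "m \<le> Q \<phi>" if \<phi>: "\<phi> \<in> F" "\<phi> \<in> C0 \<Omega>" for \<phi>
  proof (cases pos)
    case True
    let ?p = "\<lambda>x. max (\<phi> x) 0"
    note p = pos_part_C0[OF \<phi>]
    have "L2_inner \<mu> ?p ?p \<le> L2_inner \<mu> \<phi> \<phi>"
      unfolding L2_inner_def using L2_mult_integrable[OF L L] p(1) \<phi>(1)
      by (intro integral_mono) (auto simp: max_def)
    moreover have "L2_inner \<mu> h \<phi> \<le> L2_inner \<mu> h ?p"
      unfolding L2_inner_def
      by (rule integral_mono_AE[OF L2_mult_integrable[OF h L[OF \<phi>(1)]] L2_mult_integrable[OF h L[OF p(1)]]])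
        (use True in \<open>auto simp: pos_def elim!: eventually_mono intro: mult_left_mono\<close>)
    ultimately have "Q ?p \<le> Q \<phi>" using p(3) mult_left_mono[of _ _ \<alpha>] \<alpha>
      unfolding Q_def A_def shifted_form_def by (smt (verit))
    moreover have "?p \<in> S" using p by (simp add: S_def)
    ultimately show ?thesis using m_le_S by fastforce
  next
    case False
    then show ?thesis using \<phi> by (intro m_le_S) (simp add: S_def)
  qed
  have "\<exists>\<phi>\<in>S. Q \<phi> < m + 1 / real (Suc n)" for n
    using cInf_lessD[of "Q ` S" "m + 1 / real (Suc n)"] S0 unfolding m_def by auto
  then obtain \<phi> where \<phi>S: "\<And>n. \<phi> n \<in> S" and \<phi>Q: "\<And>n. Q (\<phi> n) < m + 1 / real (Suc n)" by metis
  have \<phi>: "\<phi> n \<in> F" "\<phi> n \<in> C0 \<Omega>" for n using \<phi>S[of n] by (auto simp: S_def)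
  have parallelogram: "A (\<lambda>x. \<phi> k x - \<phi> n x) (\<lambda>x. \<phi> k x - \<phi> n x) \<le> 2 / real (Suc k) + 2 / real (Suc n)" for k n
  proof -
    let ?w = "\<lambda>x. (1/2) * \<phi> k x + (1/2) * \<phi> n x"
    have "?w \<in> F \<inter> C0 \<Omega>" using \<phi> by (intro IntI form_lincomb[OF form_E] C0_lincomb)
    moreover have "pos \<longrightarrow> (\<forall>x. 0 \<le> ?w x)" using \<phi>S[of k] \<phi>S[of n] by (simp add: S_def)
    ultimately have w: "?w \<in> S" unfolding S_def by blast
    have "A (\<lambda>x. \<phi> k x - \<phi> n x) (\<lambda>x. \<phi> k x - \<phi> n x) = 2 * Q (\<phi> k) + 2 * Q (\<phi> n) - 4 * Q ?w"
      unfolding Q_def form_diff_sq[OF A \<phi>(1) \<phi>(1)] form_expand[OF A \<phi>(1) \<phi>(1)]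
        form_lincomb_right[OF I L[OF \<phi>(1)] L[OF \<phi>(1)] h]
      by (simp add: power2_eq_square)
    then show ?thesis using m_le_S[OF w] \<phi>Q[of k] \<phi>Q[of n] by simp
  qed
  have E1A: "\<alpha> * E1_dist_sq \<mu> E u v \<le> A (\<lambda>x. u x - v x) (\<lambda>x. u x - v x)" if "u \<in> F" "v \<in> F" for u v
    using form_nonneg[OF form_E form_diff[OF form_E that]] mult_right_mono[OF \<alpha>(2)]
    unfolding E1_dist_sq_eq A_def shifted_form_def by (simp add: distrib_left)
  have "\<exists>N. \<forall>k\<ge>N. \<forall>n\<ge>N. E1_dist_sq \<mu> E (\<phi> k) (\<phi> n) < \<epsilon>" if "\<epsilon> > 0" for \<epsilon>
  proof -
    obtain N where N: "inverse (real (Suc N)) < \<alpha> * \<epsilon> / 4"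
      using reals_Archimedean[of "\<alpha> * \<epsilon> / 4"] mult_pos_pos[OF \<alpha>(1) \<open>\<epsilon> > 0\<close>] by auto
    have "E1_dist_sq \<mu> E (\<phi> k) (\<phi> n) < \<epsilon>" if "k \<ge> N" "n \<ge> N" for k n
    proof -
      have "2 / real (Suc k) \<le> 2 * inverse (real (Suc N))" "2 / real (Suc n) \<le> 2 * inverse (real (Suc N))"
        using that by (auto simp: field_simps)
      then have "\<alpha> * E1_dist_sq \<mu> E (\<phi> k) (\<phi> n) < \<alpha> * \<epsilon>"
        using E1A[OF \<phi>(1) \<phi>(1), of k n] parallelogram[of k n] N by linarith
      then show ?thesis using \<alpha> by simp
    qed
    then show ?thesis by blast
  qed
  then obtain g where g: "g \<in> F" "(\<lambda>n. E1_dist_sq \<mu> E (\<phi> n) g) \<longlonglongrightarrow> 0"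
    using complete[of \<phi>] \<phi>(1) by blast
  note lim = E1_limits[OF \<phi>(1) g]
  have limA: "(\<lambda>n. A (\<phi> n) v) \<longlonglongrightarrow> A g v" if "v \<in> F" for v
    unfolding A_def shifted_form_def by (intro tendsto_intros lim that)
  have "A g v = L2_inner \<mu> h v" if v: "v \<in> F" "v \<in> C0 \<Omega>" for v
  proof -
    have "0 \<le> 2 * t * (A g v - L2_inner \<mu> h v) + t\<^sup>2 * A v v" for t
    proof (rule tendsto_lowerbound)
      have "(\<lambda>n. 1 / real (Suc n)) \<longlonglongrightarrow> 0" using LIMSEQ_Suc[OF lim_1_over_n] by simp
      then have "(\<lambda>n. 1 / real (Suc n) + (2 * t * (A (\<phi> n) v - L2_inner \<mu> h v) + t\<^sup>2 * A v v))
          \<longlonglongrightarrow> 0 + (2 * t * (A g v - L2_inner \<mu> h v) + t\<^sup>2 * A v v)"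
        by (intro tendsto_intros limA v(1))
      then show "(\<lambda>n. 1 / real (Suc n) + (2 * t * (A (\<phi> n) v - L2_inner \<mu> h v) + t\<^sup>2 * A v v))
          \<longlonglongrightarrow> 2 * t * (A g v - L2_inner \<mu> h v) + t\<^sup>2 * A v v" by simp
      have "0 \<le> 1 / real (Suc n) + (2 * t * (A (\<phi> n) v - L2_inner \<mu> h v) + t\<^sup>2 * A v v)" for n
      proof -
        have "m \<le> Q (\<lambda>x. 1 * \<phi> n x + t * v x)"
          using \<phi>[of n] v by (intro m_le form_lincomb[OF form_E] C0_lincomb)
        also have "\<dots> = Q (\<phi> n) + (2 * t * (A (\<phi> n) v - L2_inner \<mu> h v) + t\<^sup>2 * A v v)"
          unfolding Q_def form_expand[OF A \<phi>(1) v(1)] form_lincomb_right[OF I L[OF \<phi>(1)] L[OF v(1)] h]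
          by (simp add: algebra_simps)
        finally show ?thesis using \<phi>Q[of n] by linarith
      qed
      then show "\<forall>\<^sub>F n in sequentially. 0 \<le> 1 / real (Suc n) + (2 * t * (A (\<phi> n) v - L2_inner \<mu> h v) + t\<^sup>2 * A v v)"
        by simp
    qed simp
    from linear_coeff_eq_0[OF this] show ?thesis by simp
  qed
  note test = this
  have "A g v = L2_inner \<mu> h v" if v: "v \<in> D \<Omega>" for v
  proof -
    from D_approx[OF v] obtain \<psi> where
      \<psi>: "\<And>n. \<psi> n \<in> F \<inter> C0 \<Omega>" "(\<lambda>n. E1_dist_sq \<mu> E (\<psi> n) v) \<longlonglongrightarrow> 0" by blast
    have \<psi>F: "\<psi> n \<in> F" for n using \<psi>(1) by blast
    note vF = D_subset[OF v]
    note lim = E1_limits[OF \<psi>F vF \<psi>(2)]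
    have "(\<lambda>n. A (\<psi> n) g) \<longlonglongrightarrow> A v g"
      unfolding A_def shifted_form_def by (intro tendsto_intros lim g(1))
    moreover have "(\<lambda>n. L2_inner \<mu> (\<psi> n) h) \<longlonglongrightarrow> L2_inner \<mu> v h"
      using form_tendsto[OF I L[OF \<psi>F] L[OF vF] h] lim(2) by (simp add: L2_dist_sq_eq)
    moreover have "A (\<psi> n) g = L2_inner \<mu> (\<psi> n) h" for n
      using test[of "\<psi> n"] \<psi>(1)[of n] form_sym[OF A \<psi>F g(1)] form_sym[OF I L[OF \<psi>F] h] by simp
    ultimately have "A v g = L2_inner \<mu> v h" using LIMSEQ_unique by auto
    then show ?thesis using form_sym[OF A vF g(1)] form_sym[OF I L[OF vF] h] by simp
  qed
  moreover have "g \<in> D \<Omega>" by (rule D_closed[OF C0_in_D[OF \<phi>] g])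
  ultimately have "resolvent \<Omega> \<alpha> h g" by (simp add: resolvent_def A_def shifted_form_def)
  moreover have "AE x in \<mu>. 0 \<le> g x" if "AE x in \<mu>. 0 \<le> h x"
  proof (rule AE_nonneg_L2_limit[OF L[OF \<phi>(1)] _ L[OF g(1)] lim(2)])
    have pos using that by (simp add: pos_def)
    then show "AE x in \<mu>. 0 \<le> \<phi> n x" for n using \<phi>S[of n] by (simp add: S_def)
  qed
  ultimately show ?thesis by (rule that)
qed

lemma resolvent_lincomb:
  assumes "resolvent \<Omega> \<alpha> h g" "resolvent \<Omega> \<alpha> h' g'" and h: "h \<in> L2 \<mu> UNIV" "h' \<in> L2 \<mu> UNIV"
  shows "resolvent \<Omega> \<alpha> (\<lambda>x. a * h x + b * h' x) (\<lambda>x. a * g x + b * g' x)"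
  unfolding resolvent_def
proof (intro conjI ballI)
  have g: "g \<in> D \<Omega>" "g' \<in> D \<Omega>" using assms by (auto simp: resolvent_def)
  then show "(\<lambda>x. a * g x + b * g' x) \<in> D \<Omega>" by (rule D_lincomb)
  fix v assume v: "v \<in> D \<Omega>"
  have "E (\<lambda>x. a * g x + b * g' x) v + \<alpha> * L2_inner \<mu> (\<lambda>x. a * g x + b * g' x) v
      = a * (E g v + \<alpha> * L2_inner \<mu> g v) + b * (E g' v + \<alpha> * L2_inner \<mu> g' v)"
    unfolding form_lincomb_left[OF form_E g[THEN D_subset] D_subset[OF v]]
      form_lincomb_left[OF form_inner g[THEN D_subset] D_subset[OF v]] by (simp add: algebra_simps)
  also have "\<dots> = a * L2_inner \<mu> h v + b * L2_inner \<mu> h' v"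
    using assms v by (simp add: resolvent_def)
  also have "\<dots> = L2_inner \<mu> (\<lambda>x. a * h x + b * h' x) v"
    by (rule form_lincomb_left[OF nonneg_symmetric_form_L2_inner h form_L2[OF form_E D_subset[OF v]], symmetric])
  finally show "E (\<lambda>x. a * g x + b * g' x) v + \<alpha> * L2_inner \<mu> (\<lambda>x. a * g x + b * g' x) v
      = L2_inner \<mu> (\<lambda>x. a * h x + b * h' x) v" .
qed

lemma resolvent_nonneg:
  assumes \<alpha>: "0 < \<alpha>" "\<alpha> \<le> 1" and h: "h \<in> L2 \<mu> UNIV" "AE x in \<mu>. 0 \<le> h x" and g: "resolvent \<Omega> \<alpha> h g"
  shows "AE x in \<mu>. 0 \<le> g x"
proof -
  from resolvent_exists[OF \<alpha> h(1), of \<Omega>] h(2) obtain g' where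
    g': "resolvent \<Omega> \<alpha> h g'" "AE x in \<mu>. 0 \<le> g' x" by blast
  let ?d = "\<lambda>x. 1 * g x + (-1) * g' x"
  have d: "resolvent \<Omega> \<alpha> (\<lambda>x. 1 * h x + (-1) * h x) ?d"
    by (rule resolvent_lincomb[OF g g'(1) h(1,1)])
  then have "?d \<in> D \<Omega>" by (simp add: resolvent_def)
  then have dF: "?d \<in> F" by (rule D_subset)
  have "E ?d ?d + \<alpha> * L2_inner \<mu> ?d ?d = L2_inner \<mu> (\<lambda>x. 1 * h x + (-1) * h x) ?d"
    using d unfolding resolvent_def by blast
  also have "\<dots> = 0" by (simp add: L2_inner_def)
  finally have "\<alpha> * L2_inner \<mu> ?d ?d \<le> 0" using form_nonneg[OF form_E dF] by linarith
  then have "L2_inner \<mu> ?d ?d \<le> 0" using \<alpha> by (simp add: mult_le_0_iff)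
  from L2_inner_self_eq_0[OF form_L2[OF form_E dF] this] g'(2)
  show ?thesis by eventually_elim simp
qed

end

section \<open>From the mean exit time to the resolvent\<close>

lemma indicator_L2:
  assumes "A \<in> sets \<mu>" "emeasure \<mu> A < \<infinity>" "A \<subseteq> \<Omega>"
  shows "indicator A \<in> L2 \<mu> \<Omega>"
proof -
  have "(\<lambda>x. (indicator A x)\<^sup>2 :: real) = indicator A" by (auto simp: fun_eq_iff indicator_def)
  then show ?thesis using assms by (auto simp: L2_def indicator_def)
qed

lemma abs_at_right_0: "filterlim (\<lambda>h :: real. \<bar>h\<bar>) (at_right 0) (at 0)"
  unfolding filterlim_at by (auto intro!: tendsto_eq_intros simp: eventually_at_filter)

lemma eventually_abs_less_at_0: "0 < t \<Longrightarrow> \<forall>\<^sub>F h in at 0. h \<noteq> 0 \<and> \<bar>h\<bar> < (t :: real)"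
  unfolding eventually_at by (rule exI[of _ t]) (auto simp: dist_real_def)

text \<open>The facts on heat semigroups are stated in terms of the functions \<open>t \<mapsto> (P t u, f)\<close>, which do not
  see the null sets up to which \<open>P t u\<close> is determined.\<close>

locale heat_semigroup_on =
  fixes \<mu> :: "'a measure" and E :: "'a form" and D \<Omega> and P :: "real \<Rightarrow> ('a \<Rightarrow> real) \<Rightarrow> 'a \<Rightarrow> real"
  assumes semigroup: "heat_semigroup \<mu> E D \<Omega> P"
begin

lemmas inner_form = nonneg_symmetric_form_L2_inner[of \<mu> \<Omega>]

lemma P_L2: "0 < t \<Longrightarrow> u \<in> L2 \<mu> \<Omega> \<Longrightarrow> P t u \<in> L2 \<mu> \<Omega>"
  using semigroup by (simp add: heat_semigroup_def)

lemma P_contraction: "0 < t \<Longrightarrow> u \<in> L2 \<mu> \<Omega> \<Longrightarrow> L2_inner \<mu> (P t u) (P t u) \<le> L2_inner \<mu> u u"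
  using semigroup by (simp add: heat_semigroup_def)

lemma inner_P_le:
  assumes "0 < t" "u \<in> L2 \<mu> \<Omega>" "f \<in> L2 \<mu> \<Omega>"
  shows "\<bar>L2_inner \<mu> (P t u) f\<bar> \<le> sqrt (L2_inner \<mu> u u) * sqrt (L2_inner \<mu> f f)"
proof -
  have "\<bar>L2_inner \<mu> (P t u) f\<bar> \<le> sqrt (L2_inner \<mu> (P t u) (P t u)) * sqrt (L2_inner \<mu> f f)"
    by (rule form_abs_le[OF inner_form P_L2[OF assms(1,2)] assms(3)])
  also have "\<dots> \<le> sqrt (L2_inner \<mu> u u) * sqrt (L2_inner \<mu> f f)"
    using P_contraction[OF assms(1,2)] form_nonneg[OF inner_form assms(3)] by (intro mult_right_mono) auto
  finally show ?thesis .
qed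

lemma inner_P_lincomb:
  assumes "0 < t" "u \<in> L2 \<mu> \<Omega>" "v \<in> L2 \<mu> \<Omega>" "f \<in> L2 \<mu> \<Omega>"
  shows "L2_inner \<mu> (P t (\<lambda>x. a * u x + b * v x)) f = a * L2_inner \<mu> (P t u) f + b * L2_inner \<mu> (P t v) f"
proof -
  note Pu = P_L2[OF assms(1,2)] and Pv = P_L2[OF assms(1,3)]
  have "AE x in \<mu>. P t (\<lambda>x. a * u x + b * v x) x = a * P t u x + b * P t v x"
    using semigroup assms unfolding heat_semigroup_def by blast
  then have "L2_inner \<mu> (P t (\<lambda>x. a * u x + b * v x)) f = L2_inner \<mu> (\<lambda>x. a * P t u x + b * P t v x) f"
    by (intro L2_inner_cong_AE L2_measurable[OF P_L2[OF assms(1) L2_lincomb[OF assms(2,3)]]]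
        L2_measurable[OF L2_lincomb[OF Pu Pv]] L2_measurable[OF assms(4)])
  also have "\<dots> = a * L2_inner \<mu> (P t u) f + b * L2_inner \<mu> (P t v) f"
    by (rule form_lincomb_left[OF inner_form Pu Pv assms(4)])
  finally show ?thesis .
qed

lemma inner_P_add:
  assumes "0 < t" "0 < s" "u \<in> L2 \<mu> \<Omega>" "f \<in> L2 \<mu> \<Omega>"
  shows "L2_inner \<mu> (P (t + s) u) f = L2_inner \<mu> (P t (P s u)) f"
proof (rule L2_inner_cong_AE)
  show "AE x in \<mu>. P (t + s) u x = P t (P s u) x"
    using semigroup assms by (simp add: heat_semigroup_def)
qed (use assms in \<open>auto intro!: L2_measurable P_L2\<close>)

definition increment :: "('a \<Rightarrow> real) \<Rightarrow> real \<Rightarrow> real" where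
  "increment u s = sqrt (L2_dist_sq \<mu> (P s u) u)"

lemma increment_tendsto: "u \<in> L2 \<mu> \<Omega> \<Longrightarrow> (increment u \<longlongrightarrow> 0) (at_right 0)"
  using tendsto_real_sqrt[of "\<lambda>s. L2_dist_sq \<mu> (P s u) u" 0 "at_right 0"] semigroup
  by (simp add: heat_semigroup_def increment_def[abs_def])

lemma inner_P_increment:
  assumes "0 < t" "0 < s" "u \<in> L2 \<mu> \<Omega>" "f \<in> L2 \<mu> \<Omega>"
  shows "\<bar>L2_inner \<mu> (P (t + s) u) f - L2_inner \<mu> (P t u) f\<bar> \<le> increment u s * sqrt (L2_inner \<mu> f f)"
proof -
  note Ps = P_L2[OF assms(2,3)]
  have "L2_inner \<mu> (P (t + s) u) f - L2_inner \<mu> (P t u) f = L2_inner \<mu> (P t (\<lambda>x. 1 * P s u x + (-1) * u x)) f"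
    unfolding inner_P_add[OF assms] inner_P_lincomb[OF assms(1) Ps assms(3,4)] by simp
  then show ?thesis
    using inner_P_le[OF assms(1) L2_lincomb[OF Ps assms(3), of 1 "-1"] assms(4)]
    by (simp add: increment_def L2_dist_sq_eq)
qed

lemma inner_P_tendsto_0:
  assumes u: "u \<in> L2 \<mu> \<Omega>" and f: "f \<in> L2 \<mu> \<Omega>"
  shows "((\<lambda>t. L2_inner \<mu> (P t u) f) \<longlongrightarrow> L2_inner \<mu> u f) (at_right 0)"
proof -
  have "((\<lambda>t. increment u t * sqrt (L2_inner \<mu> f f)) \<longlongrightarrow> 0 * sqrt (L2_inner \<mu> f f)) (at_right 0)"
    by (intro tendsto_intros increment_tendsto u)
  then have lim: "((\<lambda>t. increment u t * sqrt (L2_inner \<mu> f f)) \<longlongrightarrow> 0) (at_right 0)" by simp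
  have "norm (L2_inner \<mu> (P t u) f - L2_inner \<mu> u f) \<le> increment u t * sqrt (L2_inner \<mu> f f)" if "0 < t" for t
    using form_abs_le[OF inner_form form_diff[OF inner_form P_L2[OF that u] u] f]
      form_diff_left[OF inner_form P_L2[OF that u] u f] by (simp add: increment_def L2_dist_sq_eq)
  then have "\<forall>\<^sub>F t in at_right 0. norm (L2_inner \<mu> (P t u) f - L2_inner \<mu> u f) \<le> increment u t * sqrt (L2_inner \<mu> f f)"
    by (auto simp: eventually_at_filter)
  from Lim_null_comparison[OF this lim] show ?thesis by (rule LIM_zero_cancel)
qed

lemma inner_P_continuous:
  assumes t: "0 < t" and u: "u \<in> L2 \<mu> \<Omega>" and f: "f \<in> L2 \<mu> \<Omega>"
  shows "isCont (\<lambda>t. L2_inner \<mu> (P t u) f) t"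
proof -
  have "((\<lambda>h. increment u \<bar>h\<bar> * sqrt (L2_inner \<mu> f f)) \<longlongrightarrow> 0 * sqrt (L2_inner \<mu> f f)) (at 0)"
    by (intro tendsto_intros filterlim_compose[OF increment_tendsto[OF u] abs_at_right_0])
  then have lim: "((\<lambda>h. increment u \<bar>h\<bar> * sqrt (L2_inner \<mu> f f)) \<longlongrightarrow> 0) (at 0)" by simp
  have "norm (L2_inner \<mu> (P (t + h) u) f - L2_inner \<mu> (P t u) f) \<le> increment u \<bar>h\<bar> * sqrt (L2_inner \<mu> f f)"
    if "h \<noteq> 0" "\<bar>h\<bar> < t" for h
  proof (cases "h > 0")
    case True
    then show ?thesis using inner_P_increment[OF t True u f] by simp
  next
    case False
    then show ?thesis using inner_P_increment[of "t + h" "- h", OF _ _ u f] that by (simp add: abs_minus_commute)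
  qed
  then have "\<forall>\<^sub>F h in at 0. norm (L2_inner \<mu> (P (t + h) u) f - L2_inner \<mu> (P t u) f) \<le> increment u \<bar>h\<bar> * sqrt (L2_inner \<mu> f f)"
    using eventually_abs_less_at_0[OF t] by (auto elim: eventually_mono)
  from Lim_null_comparison[OF this lim] show ?thesis
    unfolding isCont_iff by (rule LIM_zero_cancel)
qed

text \<open>If \<open>u\<close> is in the domain of the generator, with image \<open>g\<close>, then \<open>d/dt (P t u, f) = (P t g, f)\<close>. The
  definition of the generator only speaks about difference quotients to the right; a difference quotient
  to the left at \<open>t\<close> is one to the right at \<open>t - s\<close>, and \<open>(P (t - s) g, f)\<close> is close to \<open>(P t g, f)\<close>.\<close>

lemma inner_P_derivative:
  assumes t: "0 < t" and u: "u \<in> D" "u \<in> L2 \<mu> \<Omega>" and g: "g \<in> L2 \<mu> \<Omega>" and f: "f \<in> L2 \<mu> \<Omega>"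
    and gen: "\<And>v. v \<in> D \<Longrightarrow> E u v = - L2_inner \<mu> g v"
  shows "((\<lambda>t. L2_inner \<mu> (P t u) f) has_real_derivative L2_inner \<mu> (P t g) f) (at t)"
proof -
  define N where "N = sqrt (L2_inner \<mu> f f)"
  define c where "c t = L2_inner \<mu> (P t u) f" for t
  define c' where "c' t = L2_inner \<mu> (P t g) f" for t
  define e where "e s = sqrt (L2_dist_sq \<mu> (\<lambda>x. (P s u x - u x) / s) g)" for s
  have "((\<lambda>s. L2_dist_sq \<mu> (\<lambda>x. (P s u x - u x) / s) g) \<longlongrightarrow> 0) (at_right 0)"
    using semigroup u g gen unfolding heat_semigroup_def by blast
  from tendsto_real_sqrt[OF this] have e0: "(e \<longlongrightarrow> 0) (at_right 0)" by (simp add: e_def[abs_def])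
  have quotient: "\<bar>(c (r + s) - c r) / s - c' r\<bar> \<le> e s * N" if r: "0 < r" and s: "0 < s" for r s
  proof -
    note Ps = P_L2[OF s u(2)]
    let ?d = "\<lambda>x. 1 * P s u x + (-1) * u x"
    let ?w = "\<lambda>x. (1 / s) * ?d x + (-1) * g x"
    have d: "?d \<in> L2 \<mu> \<Omega>" by (rule L2_lincomb[OF Ps u(2)])
    have "(c (r + s) - c r) / s - c' r = L2_inner \<mu> (P r ?w) f"
      unfolding inner_P_lincomb[OF r d g f] inner_P_lincomb[OF r Ps u(2) f] c_def c'_def
        inner_P_add[OF r s u(2) f] by simp
    then show ?thesis using inner_P_le[OF r L2_lincomb[OF d g] f, of "1 / s" "-1"]
      by (simp add: e_def N_def L2_dist_sq_eq)
  qed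
  have "((\<lambda>h. (e \<bar>h\<bar> + increment g \<bar>h\<bar>) * N) \<longlongrightarrow> (0 + 0) * N) (at 0)"
    by (intro tendsto_intros filterlim_compose[OF increment_tendsto[OF g] abs_at_right_0]
        filterlim_compose[OF e0 abs_at_right_0])
  then have lim: "((\<lambda>h. (e \<bar>h\<bar> + increment g \<bar>h\<bar>) * N) \<longlongrightarrow> 0) (at 0)" by simp
  have "norm ((c (t + h) - c t) / h - c' t) \<le> (e \<bar>h\<bar> + increment g \<bar>h\<bar>) * N" if h: "h \<noteq> 0" "\<bar>h\<bar> < t" for h
  proof (cases "h > 0")
    case True
    have "0 \<le> increment g h * N"
      using inner_P_increment[OF t True g f] unfolding N_def by linarith
    then show ?thesis using quotient[OF t True] True by (simp add: distrib_right)
  next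
    case False
    then have pos: "0 < t + h" "0 < - h" using h by auto
    have "(c (t + h) - c t) / h = (c (t + h + - h) - c (t + h)) / - h" using h by (simp add: field_simps)
    moreover have "\<bar>c' t - c' (t + h)\<bar> \<le> increment g \<bar>h\<bar> * N"
      using inner_P_increment[OF pos g f] pos by (simp add: c'_def N_def)
    ultimately show ?thesis using quotient[OF pos] pos by (simp add: distrib_right)
  qed
  then have "\<forall>\<^sub>F h in at 0. norm ((c (t + h) - c t) / h - c' t) \<le> (e \<bar>h\<bar> + increment g \<bar>h\<bar>) * N"
    using eventually_abs_less_at_0[OF t] by (auto elim: eventually_mono)
  from LIM_zero_cancel[OF Lim_null_comparison[OF this lim]] show ?thesis
    by (simp add: DERIV_def c_def c'_def)
qed

text \<open>For \<open>f \<ge> 0\<close> the time integral of \<open>(P t 1, f)\<close> is at most \<open>K \<integral> f\<close>, by Tonelli, and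
  \<open>d/dt (e\<^sup>-\<^sup>\<alpha>\<^sup>t (P t r, f)) = - e\<^sup>-\<^sup>\<alpha>\<^sup>t (P t 1, f)\<close>. Integrating over \<open>(0, \<infinity>)\<close> gives \<open>(r, f) \<le> K \<integral> f\<close>. With
  \<open>f\<close> the indicator function of \<open>{r > K}\<close> this forces that set to be null.\<close>

lemma resolvent_of_1_le:
  assumes sf: "sigma_finite_measure \<mu>" and \<Omega>: "\<Omega> \<in> sets \<mu>" "emeasure \<mu> \<Omega> < \<infinity>"
    and \<alpha>: "0 < \<alpha>" and r: "r \<in> D" "r \<in> L2 \<mu> \<Omega>"
    and D: "D \<subseteq> L2 \<mu> \<Omega>"
    and res: "\<And>v. v \<in> D \<Longrightarrow> E r v + \<alpha> * L2_inner \<mu> r v = L2_inner \<mu> (indicator \<Omega>) v"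
    and G: "is_green_potential \<mu> P (indicator \<Omega>) G" and K: "0 \<le> K" "AE x in \<mu>. x \<in> \<Omega> \<longrightarrow> G x \<le> ennreal K"
  shows "AE x in \<mu>. r x \<le> K"
proof -
  interpret sigma_finite_measure \<mu> by (rule sf)
  interpret pair_sigma_finite lborel \<mu> ..
  note [measurable] = \<Omega>(1)
  have one: "indicator \<Omega> \<in> L2 \<mu> \<Omega>"
    using \<Omega> by (intro indicator_L2) auto
  define A where "A = {x \<in> space \<mu>. x \<in> \<Omega> \<and> K < r x}"
  note [measurable] = L2_measurable[OF r(2)]
  have [measurable]: "A \<in> sets \<mu>" unfolding A_def by measurable
  have A_fin: "emeasure \<mu> A < \<infinity>"
    by (rule le_less_trans[OF emeasure_mono \<Omega>(2)]) (auto simp: A_def)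
  define f where "f = (indicator A :: 'a \<Rightarrow> real)"
  have f: "f \<in> L2 \<mu> \<Omega>" unfolding f_def using A_fin by (intro indicator_L2) (auto simp: A_def)
  have [measurable]: "f \<in> borel_measurable \<mu>" by (rule L2_measurable[OF f])
  define M where "M = K * measure \<mu> A"
  have M: "0 \<le> M" using K(1) by (simp add: M_def)
  define c1 where "c1 t = L2_inner \<mu> (P t (indicator \<Omega>)) f" for t
  from G obtain p where p_meas: "(\<lambda>(t, x). p t x) \<in> borel_measurable (lborel \<Otimes>\<^sub>M \<mu>)"
    and p: "\<And>t. 0 < t \<Longrightarrow> AE x in \<mu>. p t x = P t (indicator \<Omega>) x"
    and G_eq: "AE x in \<mu>. G x = (\<integral>\<^sup>+t\<in>{0<..}. ennreal (p t x) \<partial>lborel)"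
    unfolding is_green_potential_def by blast
  have c1_le: "ennreal (c1 t) \<le> (\<integral>\<^sup>+x. ennreal (p t x) * indicator A x \<partial>\<mu>)" if t: "0 < t" for t
  proof -
    let ?u = "P t (indicator \<Omega>)"
    note Pt = P_L2[OF t one]
    note [measurable] = L2_measurable[OF Pt]
    have int: "integrable \<mu> (\<lambda>x. ?u x * f x)" by (rule L2_mult_integrable[OF Pt f])
    have "ennreal (c1 t) \<le> ennreal (\<integral>x. max 0 (?u x * f x) \<partial>\<mu>)"
      unfolding c1_def L2_inner_def by (intro ennreal_leI integral_mono integrable_max int) auto
    also have "\<dots> = (\<integral>\<^sup>+x. ennreal (max 0 (?u x * f x)) \<partial>\<mu>)"
      by (intro nn_integral_eq_integral[symmetric] integrable_max int) auto
    also have "\<dots> = (\<integral>\<^sup>+x. ennreal (p t x) * indicator A x \<partial>\<mu>)"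
      by (rule nn_integral_cong_AE, rule AE_mp[OF p[OF t]])
        (auto simp: f_def indicator_def max_def ennreal_neg intro!: AE_I2)
    finally show ?thesis .
  qed
  have "(\<integral>\<^sup>+t\<in>{0<..}. ennreal (c1 t) \<partial>lborel)
      \<le> (\<integral>\<^sup>+t. (\<integral>\<^sup>+x. ennreal (p t x) * indicator {0<..} t * indicator A x \<partial>\<mu>) \<partial>lborel)"
    using c1_le by (intro nn_integral_mono) (auto simp: indicator_def)
  also have "\<dots> = (\<integral>\<^sup>+x. (\<integral>\<^sup>+t. ennreal (p t x) * indicator {0<..} t * indicator A x \<partial>lborel) \<partial>\<mu>)"
    by (rule Fubini'[symmetric]) (use p_meas in measurable)
  also have "\<dots> \<le> (\<integral>\<^sup>+x. ennreal K * indicator A x \<partial>\<mu>)"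
  proof (rule nn_integral_mono_AE)
    show "AE x in \<mu>. (\<integral>\<^sup>+t. ennreal (p t x) * indicator {0<..} t * indicator A x \<partial>lborel) \<le> ennreal K * indicator A x"
      using G_eq K(2) by eventually_elim (auto simp: indicator_def A_def)
  qed
  also have "\<dots> = ennreal M"
    using A_fin K(1) by (simp add: nn_integral_cmult_indicator M_def ennreal_mult emeasure_eq_ennreal_measure less_top)
  finally have c1_int: "(\<integral>\<^sup>+t\<in>{0<..}. ennreal (c1 t) \<partial>lborel) \<le> ennreal M" .
  define g where "g = (\<lambda>x. \<alpha> * r x + (-1) * indicator \<Omega> x)"
  have g: "g \<in> L2 \<mu> \<Omega>" unfolding g_def by (rule L2_lincomb[OF r(2) one])
  have gen: "E r v = - L2_inner \<mu> g v" if v: "v \<in> D" for v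
    using res[OF v] form_lincomb_left[OF inner_form r(2) one, of v \<alpha> "-1"] D v by (auto simp: g_def)
  define \<psi> where "\<psi> t = exp (- \<alpha> * t) * L2_inner \<mu> (P t r) f" for t
  have deriv: "DERIV (\<lambda>t. - \<psi> t) t :> exp (- \<alpha> * t) * c1 t" if t: "0 < t" for t
  proof -
    have "L2_inner \<mu> (P t g) f = \<alpha> * L2_inner \<mu> (P t r) f + (-1) * c1 t"
      unfolding g_def c1_def by (rule inner_P_lincomb[OF t r(2) one f])
    then have c1_eq: "c1 t = \<alpha> * L2_inner \<mu> (P t r) f - L2_inner \<mu> (P t g) f" by simp
    have eq: "exp (- \<alpha> * t) * c1 t = - (exp (- \<alpha> * t) * (- \<alpha>) * L2_inner \<mu> (P t r) f
        + L2_inner \<mu> (P t g) f * exp (- \<alpha> * t))" unfolding c1_eq by (simp add: algebra_simps)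
    show ?thesis unfolding \<psi>_def eq
      by (intro DERIV_minus DERIV_mult inner_P_derivative[OF t r g f gen])
        (auto intro!: derivative_eq_intros)
  qed
  have le_M: "\<psi> a - \<psi> b \<le> M" if ab: "0 < a" "a \<le> b" for a b
  proof -
    let ?h = "\<lambda>t. (exp (- \<alpha> * t) * c1 t) * indicator {a..b} t"
    have "isCont (\<lambda>t. exp (- \<alpha> * t) * c1 t) t" if "a \<le> t" for t
      unfolding c1_def using that ab by (intro continuous_intros inner_P_continuous one f) auto
    then have h: "has_bochner_integral lborel ?h (- \<psi> b - (- \<psi> a))"
      using ab by (intro has_bochner_integral_FTC_Icc_real deriv) auto
    then have int: "integrable lborel ?h" and "integral\<^sup>L lborel ?h = \<psi> a - \<psi> b"
      by (auto simp: has_bochner_integral_iff)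
    then have "ennreal (\<psi> a - \<psi> b) \<le> ennreal (\<integral>t. max 0 (?h t) \<partial>lborel)"
      by (subst (asm) eq_commute) (auto intro!: ennreal_leI integral_mono integrable_max)
    also have "\<dots> = (\<integral>\<^sup>+t. ennreal (max 0 (?h t)) \<partial>lborel)"
      by (intro nn_integral_eq_integral[symmetric] integrable_max int) auto
    also have "\<dots> \<le> (\<integral>\<^sup>+t\<in>{0<..}. ennreal (c1 t) \<partial>lborel)"
    proof (rule nn_integral_mono)
      fix t :: real
      have "exp (- \<alpha> * t) * c1 t \<le> max 0 (c1 t)" if "0 < t"
        using mult_right_mono[of "exp (- \<alpha> * t)" 1 "c1 t"] \<alpha> that
        by (cases "0 \<le> c1 t") (auto simp: mult_nonneg_nonpos)
      then show "ennreal (max 0 (?h t)) \<le> ennreal (c1 t) * indicator {0<..} t"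
        using ab by (auto simp: indicator_def intro: ennreal_leI order_trans[OF ennreal_leI[of _ "max 0 (c1 t)"]]
          simp: ennreal_neg max_def split: if_splits)
    qed
    also note c1_int
    finally show ?thesis using M by simp
  qed
  have \<psi>_le: "\<psi> a \<le> M" if a: "0 < a" for a
  proof -
    define B where "B = sqrt (L2_inner \<mu> r r) * sqrt (L2_inner \<mu> f f)"
    have "filterlim (\<lambda>b. (- \<alpha>) * b) at_bot at_top"
      by (rule filterlim_tendsto_neg_mult_at_bot[OF tendsto_const _ filterlim_ident]) (use \<alpha> in simp)
    note e = filterlim_compose[OF exp_at_bot this]
    have "((\<lambda>b. exp (- \<alpha> * b) * B) \<longlongrightarrow> 0 * B) at_top"
      by (intro tendsto_intros e)
    then have lim: "((\<lambda>b. exp (- \<alpha> * b) * B) \<longlongrightarrow> 0) at_top" by simp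
    have n: "norm (\<psi> b) \<le> exp (- \<alpha> * b) * B" if "b > 0" for b
      using inner_P_le[OF that r(2) f] by (simp add: \<psi>_def B_def abs_mult)
    have "\<forall>\<^sub>F b in at_top. norm (\<psi> b) \<le> exp (- \<alpha> * b) * B"
      using eventually_gt_at_top[of 0] by eventually_elim (rule n)
    from Lim_null_comparison[OF this lim] have "((\<lambda>b. \<psi> a - \<psi> b) \<longlongrightarrow> \<psi> a - 0) at_top"
      by (intro tendsto_intros)
    moreover have "\<forall>\<^sub>F b in at_top. \<psi> a - \<psi> b \<le> M"
      using eventually_ge_at_top[of a] by eventually_elim (rule le_M[OF a])
    ultimately have "\<psi> a - 0 \<le> M" by (rule tendsto_upperbound) simp
    then show ?thesis by simp
  qed
  have "(\<psi> \<longlongrightarrow> exp (- \<alpha> * 0) * L2_inner \<mu> r f) (at_right 0)"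
    unfolding \<psi>_def by (intro tendsto_intros inner_P_tendsto_0 r f)
  moreover have "\<forall>\<^sub>F a in at_right 0. \<psi> a \<le> M"
    using \<psi>_le by (auto simp: eventually_at_filter)
  ultimately have "exp (- \<alpha> * 0) * L2_inner \<mu> r f \<le> M" by (rule tendsto_upperbound) simp
  then have rf: "L2_inner \<mu> r f \<le> M" by simp
  have int: "integrable \<mu> (\<lambda>x. r x * f x)" by (rule L2_mult_integrable[OF r(2) f])
  have intf: "integrable \<mu> (\<lambda>x. K * f x)" using A_fin by (simp add: f_def)
  have "integral\<^sup>L \<mu> (\<lambda>x. r x * f x - K * f x) \<le> 0"
    using rf int intf A_fin by (simp add: L2_inner_def M_def f_def)
  moreover have nn: "AE x in \<mu>. 0 \<le> r x * f x - K * f x"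
    by (auto simp: f_def A_def indicator_def intro!: AE_I2)
  moreover have "integrable \<mu> (\<lambda>x. r x * f x - K * f x)" using int intf by simp
  ultimately have "AE x in \<mu>. r x * f x - K * f x = 0"
    using integral_nonneg_AE[OF nn] integral_nonneg_eq_0_iff_AE[of \<mu> "\<lambda>x. r x * f x - K * f x"] by linarith
  moreover have "AE x in \<mu>. x \<notin> \<Omega> \<longrightarrow> r x = 0" using r(2) by (simp add: L2_def)
  moreover have "AE x in \<mu>. x \<in> space \<mu>" by simp
  ultimately show ?thesis
  proof eventually_elim
    case (elim x)
    then show ?case using K(1) by (cases "x \<in> \<Omega>") (auto simp: f_def A_def indicator_def split: if_splits)
  qed
qed

end

section \<open>The Green operator\<close>

context dirichlet_space
begin

text \<open>\<open>G\<^sup>\<Omega> h\<close> is obtained as the increasing limit of \<open>G\<^sub>\<alpha>\<^sup>\<Omega> h\<close> for \<open>\<alpha> \<down> 0\<close>. By the maximum principle these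
  functions lie between \<open>0\<close> and \<open>T K\<close>, where \<open>T\<close> bounds \<open>h\<close> and \<open>K\<close> bounds every \<open>G\<^sub>\<alpha>\<^sup>\<Omega> 1\<close>. Monotonicity then
  turns the convergence of their integrals into convergence in \<open>\<E>\<^sub>1\<close>.\<close>

lemma green_function_exists:
  assumes \<Omega>: "\<Omega> \<in> sets \<mu>" "emeasure \<mu> \<Omega> < \<infinity>"
    and K: "\<And>\<alpha> r. 0 < \<alpha> \<Longrightarrow> \<alpha> \<le> 1 \<Longrightarrow> resolvent \<Omega> \<alpha> (indicator \<Omega>) r \<Longrightarrow> AE x in \<mu>. r x \<le> K" "0 \<le> K"
    and h: "h \<in> L2 \<mu> \<Omega>" "AE x in \<mu>. 0 \<le> h x" "AE x in \<mu>. h x \<le> T" "0 \<le> T"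
  obtains g where "g \<in> D \<Omega>" "\<And>x. 0 \<le> g x" "\<And>x. g x \<le> T * K"
    "\<And>v. v \<in> D \<Omega> \<Longrightarrow> E g v = L2_inner \<mu> h v"
proof -
  have [measurable]: "\<Omega> \<in> sets borel" using \<Omega>(1) sets_mu by simp
  define one where "one = (indicator \<Omega> :: 'a \<Rightarrow> real)"
  note I = nonneg_symmetric_form_L2_inner[of \<mu> UNIV]
  have one\<Omega>: "one \<in> L2 \<mu> \<Omega>" unfolding one_def by (rule indicator_L2[OF \<Omega> order_refl])
  note one = L2_mono[OF one\<Omega> subset_UNIV] and hU = L2_mono[OF h(1) subset_UNIV]
  define B where "B = T * K"
  have B: "0 \<le> B" using K(2) h(4) by (simp add: B_def)
  define \<alpha> where "\<alpha> n = 1 / real (Suc n)" for n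
  have \<alpha>: "0 < \<alpha> n" "\<alpha> n \<le> 1" and \<alpha>_mono: "n \<le> m \<Longrightarrow> \<alpha> m \<le> \<alpha> n" for n m
    by (auto simp: \<alpha>_def field_simps)
  have "\<exists>g. resolvent \<Omega> (\<alpha> n) h g \<and> (AE x in \<mu>. 0 \<le> g x)" for n
    using resolvent_exists[OF \<alpha> hU, of \<Omega> n] h(2) by blast
  then obtain g where res: "\<And>n. resolvent \<Omega> (\<alpha> n) h (g n)" and g_nonneg: "\<And>n. AE x in \<mu>. 0 \<le> g n x"
    by metis
  have gD: "g n \<in> D \<Omega>" for n using res[of n] by (simp add: resolvent_def)
  note gF = D_subset[OF gD]
  have gL: "g n \<in> L2 \<mu> \<Omega>" for n by (rule D_L2[OF gD]) simp
  note gU = L2_mono[OF gL subset_UNIV]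
  have off: "AE x in \<mu>. x \<notin> \<Omega> \<longrightarrow> u x = 0" if "u \<in> L2 \<mu> \<Omega>" for u using that by (simp add: L2_def)
  have g_le: "AE x in \<mu>. g n x \<le> B * one x" for n
  proof -
    obtain r where r: "resolvent \<Omega> (\<alpha> n) one r" using resolvent_exists[OF \<alpha> one] by blast
    from K(1)[OF \<alpha>] r have rK: "AE x in \<mu>. r x \<le> K" by (simp add: one_def)
    have "AE x in \<mu>. 0 \<le> T * r x + (-1) * g n x"
    proof (rule resolvent_nonneg[OF \<alpha> L2_lincomb[OF one hU] _ resolvent_lincomb[OF r res one hU]])
      show "AE x in \<mu>. 0 \<le> T * one x + (-1) * h x"
        using h(3) off[OF h(1)] by eventually_elim (auto simp: one_def indicator_def)
    qed
    then show ?thesis using rK off[OF gL[of n]]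
    proof eventually_elim
      case (elim x)
      then have "g n x \<le> T * r x" "T * r x \<le> T * K" using h(4) by (auto intro: mult_left_mono)
      then show ?case using elim(3) by (auto simp: one_def indicator_def B_def)
    qed
  qed
  have g_mono: "AE x in \<mu>. g n x \<le> g m x" if nm: "n \<le> m" for n m
  proof -
    let ?k = "\<lambda>x. (\<alpha> n - \<alpha> m) * g n x + 0 * g n x"
    have res': "resolvent \<Omega> (\<alpha> m) ?k (\<lambda>x. g m x - g n x)"
      unfolding resolvent_def
    proof (intro conjI ballI)
      show "(\<lambda>x. g m x - g n x) \<in> D \<Omega>" by (rule D_diff[OF gD gD])
      fix v assume v: "v \<in> D \<Omega>"
      note vF = D_subset[OF v]
      have "E (g k) v + \<alpha> k * L2_inner \<mu> (g k) v = L2_inner \<mu> h v" for k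
        using res[of k] v by (simp add: resolvent_def)
      from this[of m] this[of n]
      show "E (\<lambda>x. g m x - g n x) v + \<alpha> m * L2_inner \<mu> (\<lambda>x. g m x - g n x) v = L2_inner \<mu> ?k v"
        unfolding form_diff_left[OF form_E gF gF vF] form_diff_left[OF form_inner gF gF vF]
          form_lincomb_left[OF form_inner gF gF vF] by (simp add: algebra_simps)
    qed
    have "AE x in \<mu>. 0 \<le> g m x - g n x"
    proof (rule resolvent_nonneg[OF \<alpha> L2_lincomb[OF gU gU] _ res'])
      show "AE x in \<mu>. 0 \<le> ?k x"
        using g_nonneg[of n] by eventually_elim (use \<alpha>_mono[OF nm] in simp)
    qed
    then show ?thesis by eventually_elim simp
  qed
  define i where "i n = L2_inner \<mu> one (g n)" for n
  have i_diff: "L2_inner \<mu> one (\<lambda>x. g m x - g n x) = i m - i n" for m n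
    unfolding i_def by (rule form_diff_right[OF I gU gU one])
  \<comment> \<open>Both parts of \<open>\<E>\<^sub>1\<close> are controlled by the increments of \<open>i\<close>: with \<open>w = g m - g n \<ge> 0\<close>, subtracting the two
    resolvent equations gives \<open>\<E>(w,w) \<le> \<alpha> n (g n, w)\<close>, and \<open>(v, w) \<le> B (1, w)\<close> for \<open>v \<le> B\<close>.\<close>
  have key: "E1_dist_sq \<mu> E (g m) (g n) \<le> 2 * B * (i m - i n)" if nm: "n \<le> m" for n m
  proof -
    define w where "w = (\<lambda>x. g m x - g n x)"
    have w: "w \<in> D \<Omega>" unfolding w_def by (rule D_diff[OF gD gD])
    note wF = D_subset[OF w] and wU = form_L2[OF form_E D_subset[OF w]]
    have w_bounds: "AE x in \<mu>. 0 \<le> w x \<and> w x \<le> B * one x"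
      using g_mono[OF nm] g_le[of m] g_nonneg[of n] by eventually_elim (auto simp: w_def)
    have inner_le: "L2_inner \<mu> u w \<le> B * L2_inner \<mu> one w"
      if u: "u \<in> L2 \<mu> UNIV" "AE x in \<mu>. u x \<le> B * one x" for u
    proof -
      have "L2_inner \<mu> u w \<le> L2_inner \<mu> (\<lambda>x. B * one x + 0 * one x) w"
        unfolding L2_inner_def
      proof (rule integral_mono_AE[OF L2_mult_integrable[OF u(1) wU] L2_mult_integrable[OF L2_lincomb[OF one one] wU]])
        show "AE x in \<mu>. u x * w x \<le> (B * one x + 0 * one x) * w x"
          using u(2) w_bounds by eventually_elim (auto intro: mult_right_mono)
      qed
      then show ?thesis unfolding form_lincomb_left[OF I one one wU] by simp
    qed
    have "E (g k) w + \<alpha> k * L2_inner \<mu> (g k) w = L2_inner \<mu> h w" for k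
      using res[of k] w by (simp add: resolvent_def)
    from this[of m] this[of n] have "E w w = \<alpha> n * L2_inner \<mu> (g n) w - \<alpha> m * L2_inner \<mu> (g m) w"
      using form_diff_left[OF form_E gF gF wF, of m n] by (simp add: w_def)
    also have "\<dots> \<le> \<alpha> n * L2_inner \<mu> (g n) w"
    proof -
      have "0 \<le> L2_inner \<mu> (g m) w" unfolding L2_inner_def
        by (rule integral_nonneg_AE) (use g_nonneg[of m] w_bounds in \<open>eventually_elim, simp\<close>)
      then show ?thesis using \<alpha>(1)[of m] by simp
    qed
    also have "\<dots> \<le> 1 * (B * L2_inner \<mu> one w)"
    proof (rule mult_mono[OF \<alpha>(2) inner_le[OF gU g_le]])
      show "0 \<le> L2_inner \<mu> (g n) w" unfolding L2_inner_def
        by (rule integral_nonneg_AE) (use g_nonneg[of n] w_bounds in \<open>eventually_elim, simp\<close>)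
    qed simp
    finally have "E w w \<le> B * (i m - i n)" using i_diff by (simp add: w_def)
    moreover have "L2_inner \<mu> w w \<le> B * (i m - i n)"
      using inner_le[OF wU] w_bounds i_diff by (auto simp: w_def)
    ultimately show ?thesis by (simp add: E1_dist_sq_def L2_dist_sq_eq w_def)
  qed
  have "convergent i"
  proof (rule Bseq_monoseq_convergent)
    have one_mono: "L2_inner \<mu> one u \<le> L2_inner \<mu> one v"
      if "u \<in> L2 \<mu> UNIV" "v \<in> L2 \<mu> UNIV" "AE x in \<mu>. u x \<le> v x" for u v
      unfolding L2_inner_def
      by (rule integral_mono_AE[OF L2_mult_integrable[OF one that(1)] L2_mult_integrable[OF one that(2)]])
        (use that(3) in \<open>eventually_elim, simp add: one_def indicator_def\<close>)
    show "monoseq i"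
      unfolding monoseq_def i_def using one_mono[OF gU gU g_mono] by blast
    have "0 \<le> i n" for n
      unfolding i_def L2_inner_def
      by (rule integral_nonneg_AE) (use g_nonneg[of n] in \<open>eventually_elim, simp add: one_def\<close>)
    moreover have "i n \<le> L2_inner \<mu> one (\<lambda>x. B * one x + 0 * one x)" for n
      unfolding i_def by (rule one_mono[OF gU L2_lincomb[OF one one]]) (use g_le in simp)
    ultimately show "Bseq i"
      by (intro BseqI'[of _ "L2_inner \<mu> one (\<lambda>x. B * one x + 0 * one x)"]) simp
  qed
  then have Cauchy: "Cauchy i" by (rule convergent_Cauchy)
  have "\<exists>N. \<forall>m\<ge>N. \<forall>n\<ge>N. E1_dist_sq \<mu> E (g m) (g n) < \<epsilon>" if \<epsilon>: "\<epsilon> > 0" for \<epsilon>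
  proof -
    from \<epsilon> B have pos: "\<epsilon> / (2 * B + 1) > 0" by simp
    from metric_CauchyD[OF Cauchy this] obtain N where
      N: "\<And>m n. m \<ge> N \<Longrightarrow> n \<ge> N \<Longrightarrow> \<bar>i m - i n\<bar> < \<epsilon> / (2 * B + 1)" by (auto simp: dist_real_def)
    have le: "E1_dist_sq \<mu> E (g m) (g n) \<le> 2 * B * \<bar>i m - i n\<bar>" for m n
    proof (cases "n \<le> m")
      case True
      have "2 * B * (i m - i n) \<le> 2 * B * \<bar>i m - i n\<bar>" using B by (intro mult_left_mono) auto
      with key[OF True] show ?thesis by linarith
    next
      case False
      then have "E1_dist_sq \<mu> E (g n) (g m) \<le> 2 * B * (i n - i m)" by (intro key) simp
      also have "\<dots> \<le> 2 * B * \<bar>i m - i n\<bar>" using B by (intro mult_left_mono) auto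
      finally show ?thesis using E1_dist_sq_commute[OF gF gF, of n m] by simp
    qed
    have "2 * B * \<bar>i m - i n\<bar> < \<epsilon>" if "m \<ge> N" "n \<ge> N" for m n
    proof -
      have "2 * B * \<bar>i m - i n\<bar> \<le> 2 * B * (\<epsilon> / (2 * B + 1))"
        using B N[OF that] by (intro mult_left_mono) auto
      also have "\<dots> < \<epsilon>" using B \<epsilon> by (simp add: field_simps)
      finally show ?thesis .
    qed
    with le show ?thesis by (meson le_less_trans)
  qed
  then obtain G where G: "G \<in> F" "(\<lambda>n. E1_dist_sq \<mu> E (g n) G) \<longlonglongrightarrow> 0"
    using complete[of g] gF by blast
  note lim = E1_limits[OF gF G]
  note GU = form_L2[OF form_E G(1)]
  have GD: "G \<in> D \<Omega>" by (rule D_closed[OF gD G])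
  have EG: "E G v = L2_inner \<mu> h v" if v: "v \<in> D \<Omega>" for v
  proof -
    note vF = D_subset[OF v]
    have "\<alpha> \<longlonglongrightarrow> 0" using LIMSEQ_Suc[OF lim_1_over_n] by (simp add: \<alpha>_def[abs_def])
    then have "(\<lambda>n. E (g n) v + \<alpha> n * L2_inner \<mu> (g n) v) \<longlonglongrightarrow> E G v + 0 * L2_inner \<mu> G v"
      by (intro tendsto_intros lim(3,4) vF)
    moreover have "E (g n) v + \<alpha> n * L2_inner \<mu> (g n) v = L2_inner \<mu> h v" for n
      using res[of n] v by (simp add: resolvent_def)
    ultimately show ?thesis using LIMSEQ_unique[OF _ tendsto_const] by simp
  qed
  have nonneg: "AE x in \<mu>. 0 \<le> G x"
    by (rule AE_nonneg_L2_limit[OF gU g_nonneg GU lim(2)])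
  have upper: "AE x in \<mu>. 0 \<le> B * one x + (-1) * G x"
  proof (rule AE_nonneg_L2_limit[OF L2_lincomb[OF one gU] _ L2_lincomb[OF one GU]])
    show "AE x in \<mu>. 0 \<le> B * one x + (-1) * g n x" for n using g_le[of n] by eventually_elim simp
    show "(\<lambda>n. L2_dist_sq \<mu> (\<lambda>x. B * one x + (-1) * g n x) (\<lambda>x. B * one x + (-1) * G x)) \<longlonglongrightarrow> 0"
      using lim(2) by (simp add: L2_dist_sq_def power2_commute)
  qed
  \<comment> \<open>The bounds are made to hold everywhere, so that the functions built from \<open>G'\<close> are nonnegative everywhere.\<close>
  define G' where "G' = (\<lambda>x. min (max (G x) 0) B)"
  have [measurable]: "G \<in> borel_measurable \<mu>" by (rule F_measurable[OF G(1)])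
  have G'_meas: "G' \<in> borel_measurable \<mu>" unfolding G'_def by measurable
  have G'_eq: "AE x in \<mu>. G x = G' x"
    using nonneg upper
  proof eventually_elim
    case (elim x)
    then have "G x \<le> B" using B by (cases "x \<in> \<Omega>") (auto simp: one_def)
    then show ?case using elim(1) by (simp add: G'_def)
  qed
  show ?thesis
  proof (rule that)
    show "G' \<in> D \<Omega>" by (rule D_AE[OF GD G'_meas G'_eq])
    show "0 \<le> G' x" "G' x \<le> T * K" for x using B by (auto simp: G'_def B_def)
    show "E G' v = L2_inner \<mu> h v" if "v \<in> D \<Omega>" for v
      using form_cong_AE(1)[OF form_E G(1) G'_meas G'_eq D_subset[OF that]] EG[OF that] by simp
  qed
qed

end

section \<open>Integration against the jump measure\<close>

text \<open>No finiteness is known of the kernel \<open>J\<close> near the diagonal, so \<open>x \<mapsto> \<integral> G(x,y) J(x,dy)\<close> need not be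
  measurable for a general Borel function \<open>G\<close>. It is measurable for \<open>G(x,y) = \<phi>(x) v(y)\<close>, and for the functions
  \<open>(v(x) - v(y))\<^sup>2\<close>, which are increasing limits of countable sums of such products.\<close>

locale jump_dirichlet_space = dirichlet_space \<mu> F E
  for \<mu> :: "'a::polish_space measure" and F E +
  fixes EL :: "'a form" and j :: "('a \<times> 'a) measure" and J :: "'a \<Rightarrow> 'a measure"
  assumes beurling_deny: "beurling_deny_no_killing \<mu> F E EL j J"
begin

lemma form_EL: "nonneg_symmetric_form \<mu> F EL"
  using beurling_deny by (simp add: beurling_deny_no_killing_def)

lemma E_split: "u \<in> F \<Longrightarrow> v \<in> F \<Longrightarrow> E u v = EL u v + jump_form j u v"
  using beurling_deny by (simp add: beurling_deny_no_killing_def)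

lemma jump_energy_integrable: "u \<in> F \<Longrightarrow> integrable j (\<lambda>p. (u (fst p) - u (snd p))\<^sup>2)"
  using beurling_deny by (simp add: beurling_deny_no_killing_def)

lemma jump: "jump_measure \<mu> j J"
  using beurling_deny by (simp add: beurling_deny_no_killing_def)

lemma sets_J [measurable_cong]: "sets (J x) = sets borel"
  using jump by (simp add: jump_measure_def transition_kernel_def)

lemma sets_borel_prod: "sets (borel \<Otimes>\<^sub>M borel) = sets (borel :: ('a \<times> 'a) measure)"
  by (subst borel_prod) (rule refl)

lemma sets_j [measurable_cong]: "sets j = sets (borel \<Otimes>\<^sub>M borel)"
  unfolding sets_borel_prod using jump by (simp add: jump_measure_def radon_on_def)

lemma emeasure_J_measurable: "A \<in> sets borel \<Longrightarrow> (\<lambda>x. emeasure (J x) A) \<in> borel_measurable borel"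
  using jump by (simp add: jump_measure_def transition_kernel_def)

lemma emeasure_j: "A \<in> sets borel \<Longrightarrow> emeasure j A = (\<integral>\<^sup>+x. emeasure (J x) {y. (x, y) \<in> A} \<partial>\<mu>)"
  using jump by (simp add: jump_measure_def)

lemma emeasure_j_swap: "A \<in> sets borel \<Longrightarrow> emeasure j {(x, y). (y, x) \<in> A} = emeasure j A"
  using jump by (simp add: jump_measure_def)

lemma space_mu: "space \<mu> = UNIV"
  using sets_eq_imp_space_eq[OF sets_mu] by simp

lemma space_j: "space j = UNIV"
  using sets_eq_imp_space_eq[OF sets_j] by (simp add: space_pair_measure)

lemma kernel_measurable [measurable]:
  fixes v :: "'a \<Rightarrow> ennreal"
  assumes v: "v \<in> borel_measurable borel"
  shows "(\<lambda>x. \<integral>\<^sup>+y. v y \<partial>J x) \<in> borel_measurable borel"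
  using v
proof (induction rule: borel_measurable_induct)
  case (cong f g)
  then have "f = g" by auto
  with cong show ?case by simp
next
  case (set A)
  then show ?case using emeasure_J_measurable by simp
next
  case (mult u c)
  then show ?case by (simp add: nn_integral_cmult)
next
  case (add u v)
  then show ?case by (simp add: nn_integral_add)
next
  case (seq U)
  note [measurable] = seq(1)
  have "(\<integral>\<^sup>+y. (SUP i. U i) y \<partial>J x) = (SUP i. \<integral>\<^sup>+y. U i y \<partial>J x)" for x
    unfolding SUP_apply using seq(3) by (intro nn_integral_monotone_convergence_SUP) auto
  then have eq: "(\<lambda>x. \<integral>\<^sup>+y. (SUP i. U i) y \<partial>J x) = (\<lambda>x. SUP i. \<integral>\<^sup>+y. U i y \<partial>J x)" by blast
  note [measurable] = seq(5)
  show ?case unfolding eq by measurable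
qed

lemma nn_integral_j_rectangle:
  fixes v :: "'a \<Rightarrow> ennreal"
  assumes v: "v \<in> borel_measurable borel" and [measurable]: "A \<in> sets borel"
  shows "(\<integral>\<^sup>+p. indicator A (fst p) * v (snd p) \<partial>j) = (\<integral>\<^sup>+x. indicator A x * (\<integral>\<^sup>+y. v y \<partial>J x) \<partial>\<mu>)"
  using v
proof (induction rule: borel_measurable_induct)
  case (cong f g)
  then have "f = g" by auto
  with cong show ?case by simp
next
  case (set B)
  note [measurable] = set
  have "(\<integral>\<^sup>+p. indicator A (fst p) * indicator B (snd p) \<partial>j) = (\<integral>\<^sup>+p. indicator (A \<times> B) p \<partial>j)"
    by (intro nn_integral_cong) (auto simp: indicator_def)
  also have "\<dots> = emeasure j (A \<times> B)" by (rule nn_integral_indicator) measurable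
  also have "\<dots> = (\<integral>\<^sup>+x. emeasure (J x) {y. (x, y) \<in> A \<times> B} \<partial>\<mu>)"
    by (rule emeasure_j) (simp flip: sets_borel_prod)
  also have "\<dots> = (\<integral>\<^sup>+x. indicator A x * (\<integral>\<^sup>+y. indicator B y \<partial>J x) \<partial>\<mu>)"
    by (intro nn_integral_cong) (auto simp: indicator_def[of A])
  finally show ?case .
next
  case (mult u c)
  note [measurable] = mult(2)
  show ?case using mult(4) by (simp add: nn_integral_cmult mult.left_commute[of _ c])
next
  case (add u v)
  note [measurable] = add(1,3)
  show ?case using add(6,7) by (simp add: nn_integral_add distrib_left)
next
  case (seq U)
  note [measurable] = seq(1)
  have inc: "U i y \<le> U (Suc i) y" for i y using seq(3) by (simp add: incseq_Suc_iff le_fun_def)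
  have "(\<integral>\<^sup>+p. indicator A (fst p) * (SUP i. U i) (snd p) \<partial>j)
      = (\<integral>\<^sup>+p. (SUP i. indicator A (fst p) * U i (snd p)) \<partial>j)"
    by (simp add: SUP_apply SUP_mult_left_ennreal image_image)
  also have "\<dots> = (SUP i. \<integral>\<^sup>+p. indicator A (fst p) * U i (snd p) \<partial>j)"
    by (intro nn_integral_monotone_convergence_SUP incseq_SucI le_funI mult_left_mono inc) auto
  also have "\<dots> = (SUP i. \<integral>\<^sup>+x. indicator A x * (\<integral>\<^sup>+y. U i y \<partial>J x) \<partial>\<mu>)" using seq by simp
  also have "\<dots> = (\<integral>\<^sup>+x. (SUP i. indicator A x * (\<integral>\<^sup>+y. U i y \<partial>J x)) \<partial>\<mu>)"
    by (intro nn_integral_monotone_convergence_SUP[symmetric] incseq_SucI le_funI mult_left_mono nn_integral_mono inc) auto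
  also have "\<dots> = (\<integral>\<^sup>+x. indicator A x * (\<integral>\<^sup>+y. (SUP i. U i) y \<partial>J x) \<partial>\<mu>)"
  proof (rule nn_integral_cong)
    fix x
    have "(\<integral>\<^sup>+y. (SUP i. U i) y \<partial>J x) = (SUP i. \<integral>\<^sup>+y. U i y \<partial>J x)"
      unfolding SUP_apply by (intro nn_integral_monotone_convergence_SUP incseq_SucI le_funI inc) auto
    then show "(SUP i. indicator A x * (\<integral>\<^sup>+y. U i y \<partial>J x)) = indicator A x * (\<integral>\<^sup>+y. (SUP i. U i) y \<partial>J x)"
      by (simp add: SUP_mult_left_ennreal)
  qed
  finally show ?case .
qed

lemma nn_integral_j_product:
  fixes \<phi> v :: "'a \<Rightarrow> ennreal"
  assumes \<phi>: "\<phi> \<in> borel_measurable borel" and [measurable]: "v \<in> borel_measurable borel"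
  shows "(\<integral>\<^sup>+p. \<phi> (fst p) * v (snd p) \<partial>j) = (\<integral>\<^sup>+x. \<phi> x * (\<integral>\<^sup>+y. v y \<partial>J x) \<partial>\<mu>)"
  using \<phi>
proof (induction rule: borel_measurable_induct)
  case (cong f g)
  then have "f = g" by auto
  with cong show ?case by simp
next
  case (set A)
  then show ?case by (simp add: nn_integral_j_rectangle)
next
  case (mult u c)
  note [measurable] = mult(2)
  show ?case using mult(4) by (simp add: nn_integral_cmult mult.assoc)
next
  case (add u v)
  note [measurable] = add(1,3)
  show ?case using add(6,7) by (simp add: nn_integral_add distrib_right)
next
  case (seq U)
  note [measurable] = seq(1)
  have inc: "U i y \<le> U (Suc i) y" for i y using seq(3) by (simp add: incseq_Suc_iff le_fun_def)
  have "(\<integral>\<^sup>+p. (SUP i. U i) (fst p) * v (snd p) \<partial>j) = (\<integral>\<^sup>+p. (SUP i. U i (fst p) * v (snd p)) \<partial>j)"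
    by (simp add: SUP_apply SUP_mult_right_ennreal image_image)
  also have "\<dots> = (SUP i. \<integral>\<^sup>+p. U i (fst p) * v (snd p) \<partial>j)"
    by (intro nn_integral_monotone_convergence_SUP incseq_SucI le_funI mult_right_mono inc) auto
  also have "\<dots> = (SUP i. \<integral>\<^sup>+x. U i x * (\<integral>\<^sup>+y. v y \<partial>J x) \<partial>\<mu>)" using seq by simp
  also have "\<dots> = (\<integral>\<^sup>+x. (SUP i. U i x * (\<integral>\<^sup>+y. v y \<partial>J x)) \<partial>\<mu>)"
    by (intro nn_integral_monotone_convergence_SUP[symmetric] incseq_SucI le_funI mult_right_mono inc) auto
  also have "\<dots> = (\<integral>\<^sup>+x. (SUP i. U i) x * (\<integral>\<^sup>+y. v y \<partial>J x) \<partial>\<mu>)"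
    by (simp add: SUP_apply SUP_mult_right_ennreal image_image)
  finally show ?case .
qed

lemma nn_integral_j_swap:
  fixes G :: "'a \<times> 'a \<Rightarrow> ennreal"
  assumes [measurable]: "G \<in> borel_measurable (borel \<Otimes>\<^sub>M borel)"
  shows "(\<integral>\<^sup>+p. G (snd p, fst p) \<partial>j) = (\<integral>\<^sup>+p. G p \<partial>j)"
proof -
  let ?s = "\<lambda>p. (snd p, fst p)"
  have "distr j j ?s = j"
  proof (rule measure_eqI)
    fix A assume A: "A \<in> sets (distr j j ?s)"
    then have A': "A \<in> sets borel" using sets_j sets_borel_prod by simp
    have "emeasure (distr j j ?s) A = emeasure j (?s -` A \<inter> space j)"
      using A by (intro emeasure_distr) auto
    also have "?s -` A \<inter> space j = {(x, y). (y, x) \<in> A}" by (auto simp: space_j)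
    finally show "emeasure (distr j j ?s) A = emeasure j A" using emeasure_j_swap[OF A'] by simp
  qed simp
  then have "(\<integral>\<^sup>+p. G p \<partial>j) = (\<integral>\<^sup>+p. G p \<partial>distr j j ?s)" by simp
  also have "\<dots> = (\<integral>\<^sup>+p. G (?s p) \<partial>j)" by (intro nn_integral_distr) auto
  finally show ?thesis by simp
qed

text \<open>Both marginals of \<open>j\<close> are absolutely continuous with respect to \<open>\<mu>\<close>.\<close>

lemma AE_j:
  assumes "AE x in \<mu>. Q x"
  shows "AE p in j. Q (fst p) \<and> Q (snd p)"
proof -
  from AE_E[OF assms] obtain N where N: "{x \<in> space \<mu>. \<not> Q x} \<subseteq> N" "emeasure \<mu> N = 0" "N \<in> sets \<mu>" by blast
  have [measurable]: "N \<in> sets borel" using N(3) sets_mu by simp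
  have "AE x in \<mu>. x \<notin> N" using N(2,3) by (intro AE_not_in null_setsI)
  then have "(\<integral>\<^sup>+x. indicator N x * (\<integral>\<^sup>+y. 1 \<partial>J x) \<partial>\<mu>) = (\<integral>\<^sup>+x. 0 \<partial>\<mu>)"
    by (intro nn_integral_cong_AE) (auto elim!: eventually_mono simp: indicator_def)
  then have fst0: "(\<integral>\<^sup>+p. indicator N (fst p) \<partial>j) = 0"
    using nn_integral_j_rectangle[of "\<lambda>y. 1" N] by simp
  then have snd0: "(\<integral>\<^sup>+p. indicator N (snd p) \<partial>j) = 0"
    using nn_integral_j_swap[of "\<lambda>p. indicator N (fst p)"] by simp
  have "AE p in j. indicator N (fst p) = (0 :: ennreal)" "AE p in j. indicator N (snd p) = (0 :: ennreal)"
    using fst0 snd0 by (simp_all add: nn_integral_0_iff_AE)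
  then show ?thesis
    by eventually_elim (use N(1) in \<open>auto simp: indicator_def space_mu split: if_splits\<close>)
qed

definition energy_density :: "('a \<Rightarrow> real) \<Rightarrow> 'a \<Rightarrow> ennreal" where
  "energy_density v x = (\<integral>\<^sup>+y. ennreal ((v x - v y)\<^sup>2) \<partial>J x)"

end

text \<open>A lower bound for \<open>\<bar>a - b\<bar>\<close> in terms of the dyadic cells of size \<open>2\<^sup>-\<^sup>n\<close> that contain \<open>a\<close> and \<open>b\<close>; it
  increases to \<open>\<bar>a - b\<bar>\<close> as \<open>n \<rightarrow> \<infinity>\<close>. The \<open>-1\<close> makes it a lower bound.\<close>

definition cell :: "nat \<Rightarrow> real \<Rightarrow> int" where
  "cell n a = \<lfloor>2 ^ n * a\<rfloor>"

definition cell_dist :: "nat \<Rightarrow> int \<Rightarrow> int \<Rightarrow> real" where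
  "cell_dist n k l = real_of_int (max (\<bar>k - l\<bar> - 1) 0) / 2 ^ n"

lemma cell_dist_nonneg: "0 \<le> cell_dist n k l"
  by (simp add: cell_dist_def)

lemma cell_dist_le: "cell_dist n (cell n a) (cell n b) \<le> \<bar>a - b\<bar>"
proof -
  have "real_of_int (\<bar>cell n a - cell n b\<bar> - 1) \<le> \<bar>2 ^ n * a - 2 ^ n * b\<bar>"
    unfolding cell_def by linarith
  also have "\<dots> = 2 ^ n * \<bar>a - b\<bar>" by (simp add: abs_mult flip: right_diff_distrib)
  finally have "real_of_int (max (\<bar>cell n a - cell n b\<bar> - 1) 0) \<le> 2 ^ n * \<bar>a - b\<bar>"
    by (cases "\<bar>cell n a - cell n b\<bar> \<le> 1") (simp_all add: max_def)
  then show ?thesis by (simp add: cell_dist_def field_simps)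
qed

lemma cell_dist_ge: "\<bar>a - b\<bar> - 2 / 2 ^ n \<le> cell_dist n (cell n a) (cell n b)"
proof -
  have "2 ^ n * \<bar>a - b\<bar> = \<bar>2 ^ n * a - 2 ^ n * b\<bar>" by (simp add: abs_mult flip: right_diff_distrib)
  also have "\<dots> - 2 \<le> real_of_int (\<bar>cell n a - cell n b\<bar> - 1)"
    unfolding cell_def by linarith
  finally have "2 ^ n * \<bar>a - b\<bar> - 2 \<le> real_of_int (max (\<bar>cell n a - cell n b\<bar> - 1) 0)" by linarith
  then have "(2 ^ n * \<bar>a - b\<bar> - 2) / 2 ^ n \<le> real_of_int (max (\<bar>cell n a - cell n b\<bar> - 1) 0) / 2 ^ n"
    by (intro divide_right_mono) auto
  then show ?thesis by (simp add: cell_dist_def diff_divide_distrib)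
qed

lemma cell_Suc: "cell (Suc n) a = 2 * cell n a \<or> cell (Suc n) a = 2 * cell n a + 1"
  unfolding cell_def by (simp add: mult.assoc) linarith

lemma cell_dist_mono: "cell_dist n (cell n a) (cell n b) \<le> cell_dist (Suc n) (cell (Suc n) a) (cell (Suc n) b)"
proof -
  have "2 * max (\<bar>cell n a - cell n b\<bar> - 1) 0 \<le> max (\<bar>cell (Suc n) a - cell (Suc n) b\<bar> - 1) 0"
    using cell_Suc[of n a] cell_Suc[of n b] by (elim disjE; arith)
  then have "2 * real_of_int (max (\<bar>cell n a - cell n b\<bar> - 1) 0) \<le> real_of_int (max (\<bar>cell (Suc n) a - cell (Suc n) b\<bar> - 1) 0)"
    by linarith
  then show ?thesis by (simp add: cell_dist_def field_simps)
qed

lemma SUP_cell_dist: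
  "(SUP n. ennreal ((cell_dist n (cell n a) (cell n b))\<^sup>2)) = ennreal ((a - b)\<^sup>2)"
proof (rule LIMSEQ_unique[OF LIMSEQ_SUP])
  show "incseq (\<lambda>n. ennreal ((cell_dist n (cell n a) (cell n b))\<^sup>2))"
    by (intro incseq_SucI ennreal_leI power_mono cell_dist_mono cell_dist_nonneg)
  have "(\<lambda>n. 2 / (2::real) ^ n) \<longlonglongrightarrow> 0"
    using tendsto_mult[OF tendsto_const[of 2] LIMSEQ_inverse_realpow_zero[of 2]] by (simp add: divide_inverse)
  then have "(\<lambda>n. \<bar>a - b\<bar> - 2 / 2 ^ n) \<longlonglongrightarrow> \<bar>a - b\<bar> - 0" by (intro tendsto_diff tendsto_const)
  then have lim: "(\<lambda>n. \<bar>a - b\<bar> - 2 / 2 ^ n) \<longlonglongrightarrow> \<bar>a - b\<bar>" by simp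
  have "(\<lambda>n. cell_dist n (cell n a) (cell n b)) \<longlonglongrightarrow> \<bar>a - b\<bar>"
    by (rule tendsto_sandwich[OF always_eventually[OF allI] always_eventually[OF allI] lim tendsto_const])
      (rule cell_dist_ge cell_dist_le)+
  then have "(\<lambda>n. ennreal ((cell_dist n (cell n a) (cell n b))\<^sup>2)) \<longlonglongrightarrow> ennreal (\<bar>a - b\<bar>\<^sup>2)"
    by (intro tendsto_ennrealI tendsto_power)
  then show "(\<lambda>n. ennreal ((cell_dist n (cell n a) (cell n b))\<^sup>2)) \<longlonglongrightarrow> ennreal ((a - b)\<^sup>2)" by simp
qed

lemma measurable_cell [measurable]: "cell n \<in> measurable borel (count_space UNIV)"
  unfolding cell_def[abs_def] by measurable

context jump_dirichlet_space
begin

lemma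
  fixes v :: "'a \<Rightarrow> real"
  assumes v [measurable]: "v \<in> borel_measurable borel"
  shows energy_density_measurable: "energy_density v \<in> borel_measurable borel"
    and nn_integral_energy_density: "A \<in> sets borel \<Longrightarrow>
      (\<integral>\<^sup>+p. indicator A (fst p) * ennreal ((v (fst p) - v (snd p))\<^sup>2) \<partial>j) = (\<integral>\<^sup>+x. indicator A x * energy_density v x \<partial>\<mu>)"
proof -
  define e where "e n k y = ennreal ((cell_dist n k (cell n (v y)))\<^sup>2)" for n k y
  have e_meas [measurable]: "e n k \<in> borel_measurable borel" for n k
    unfolding e_def[abs_def] by measurable
  define S where "S n x = (\<integral>\<^sup>+y. e n (cell n (v x)) y \<partial>J x)" for n x
  have S_meas [measurable]: "S n \<in> borel_measurable borel" for n
    unfolding S_def by (rule measurable_compose_countable[where f="\<lambda>k x. \<integral>\<^sup>+y. e n k y \<partial>J x"]) measurable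
  have inc: "e n (cell n (v x)) y \<le> e (Suc n) (cell (Suc n) (v x)) y" for n x y
    unfolding e_def by (intro ennreal_leI power_mono cell_dist_mono cell_dist_nonneg)
  have SUP_e: "(SUP n. e n (cell n (v x)) y) = ennreal ((v x - v y)\<^sup>2)" for x y
    unfolding e_def by (rule SUP_cell_dist)
  have density: "energy_density v x = (SUP n. S n x)" for x
    unfolding energy_density_def S_def SUP_e[symmetric]
    by (intro nn_integral_monotone_convergence_SUP incseq_SucI le_funI inc) measurable
  then have "energy_density v = (\<lambda>x. SUP n. S n x)" by (simp add: fun_eq_iff)
  then show "energy_density v \<in> borel_measurable borel" by simp
  assume A [measurable]: "A \<in> sets borel"
  have step: "(\<integral>\<^sup>+p. indicator A (fst p) * e n (cell n (v (fst p))) (snd p) \<partial>j) = (\<integral>\<^sup>+x. indicator A x * S n x \<partial>\<mu>)" for n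
  proof -
    \<comment> \<open>For a fixed cell \<open>k\<close> of \<open>v(x)\<close> the integrand is a product; the cells are enumerated by \<open>from_nat\<close>.\<close>
    define Ak where "Ak i = {x \<in> A. to_nat (cell n (v x)) = i}" for i
    have [measurable]: "Ak i \<in> sets borel" for i unfolding Ak_def by measurable
    define ei where "ei i = e n (from_nat i)" for i
    have [measurable]: "ei i \<in> borel_measurable borel" for i unfolding ei_def by measurable
    have split: "indicator A x * c (to_nat (cell n (v x))) = (\<Sum>i. indicator (Ak i) x * (c i :: ennreal))" for x c
    proof -
      have "(\<Sum>i. indicator (Ak i) x * c i) = (\<Sum>i\<in>{to_nat (cell n (v x))}. indicator (Ak i) x * c i)"
        by (rule suminf_finite) (auto simp: Ak_def)
      then show ?thesis by (auto simp: Ak_def indicator_def)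
    qed
    have "(\<integral>\<^sup>+p. indicator A (fst p) * e n (cell n (v (fst p))) (snd p) \<partial>j)
        = (\<integral>\<^sup>+p. (\<Sum>i. indicator (Ak i) (fst p) * ei i (snd p)) \<partial>j)"
    proof (rule nn_integral_cong)
      fix p
      show "indicator A (fst p) * e n (cell n (v (fst p))) (snd p) = (\<Sum>i. indicator (Ak i) (fst p) * ei i (snd p))"
        using split[of "fst p" "\<lambda>i. ei i (snd p)"] by (simp add: ei_def)
    qed
    also have "\<dots> = (\<Sum>i. \<integral>\<^sup>+p. indicator (Ak i) (fst p) * ei i (snd p) \<partial>j)"
      by (rule nn_integral_suminf) measurable
    also have "\<dots> = (\<Sum>i. \<integral>\<^sup>+x. indicator (Ak i) x * (\<integral>\<^sup>+y. ei i y \<partial>J x) \<partial>\<mu>)"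
      by (simp add: nn_integral_j_rectangle)
    also have "\<dots> = (\<integral>\<^sup>+x. (\<Sum>i. indicator (Ak i) x * (\<integral>\<^sup>+y. ei i y \<partial>J x)) \<partial>\<mu>)"
      by (rule nn_integral_suminf[symmetric]) measurable
    also have "\<dots> = (\<integral>\<^sup>+x. indicator A x * S n x \<partial>\<mu>)"
      unfolding split[symmetric] by (simp add: ei_def S_def)
    finally show ?thesis .
  qed
  have "(\<integral>\<^sup>+p. indicator A (fst p) * ennreal ((v (fst p) - v (snd p))\<^sup>2) \<partial>j)
      = (\<integral>\<^sup>+p. (SUP n. indicator A (fst p) * e n (cell n (v (fst p))) (snd p)) \<partial>j)"
    by (simp add: SUP_mult_left_ennreal[symmetric] SUP_e)
  also have "\<dots> = (SUP n. \<integral>\<^sup>+p. indicator A (fst p) * e n (cell n (v (fst p))) (snd p) \<partial>j)"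
  proof (intro nn_integral_monotone_convergence_SUP incseq_SucI le_funI mult_left_mono inc)
    have "(\<lambda>p. e n (cell n (v (fst p))) (snd p)) \<in> borel_measurable j" for n
      by (rule measurable_compose_countable[where f="\<lambda>k p. e n k (snd p)"]) measurable
    then show "(\<lambda>p. indicator A (fst p) * e n (cell n (v (fst p))) (snd p)) \<in> borel_measurable j" for n
      by measurable
  qed simp
  also have "\<dots> = (SUP n. \<integral>\<^sup>+x. indicator A x * S n x \<partial>\<mu>)" by (simp add: step)
  also have "\<dots> = (\<integral>\<^sup>+x. (SUP n. indicator A x * S n x) \<partial>\<mu>)"
    unfolding S_def[abs_def]
    by (intro nn_integral_monotone_convergence_SUP[symmetric] incseq_SucI le_funI mult_left_mono nn_integral_mono inc)
      (use S_meas in \<open>auto simp: S_def[abs_def]\<close>)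
  also have "\<dots> = (\<integral>\<^sup>+x. indicator A x * energy_density v x \<partial>\<mu>)"
    by (simp add: SUP_mult_left_ennreal[symmetric] density)
  finally show "(\<integral>\<^sup>+p. indicator A (fst p) * ennreal ((v (fst p) - v (snd p))\<^sup>2) \<partial>j)
      = (\<integral>\<^sup>+x. indicator A x * energy_density v x \<partial>\<mu>)" .
qed

lemma energy_density_lincomb:
  assumes [measurable]: "v \<in> borel_measurable borel" "g \<in> borel_measurable borel"
    and "\<And>x y. (u x - u y)\<^sup>2 \<le> a * (v x - v y)\<^sup>2 + b * (g x - g y)\<^sup>2" "0 \<le> a" "0 \<le> b"
  shows "energy_density u x \<le> ennreal a * energy_density v x + ennreal b * energy_density g x"
proof -
  have "energy_density u x \<le> (\<integral>\<^sup>+y. ennreal a * ennreal ((v x - v y)\<^sup>2) + ennreal b * ennreal ((g x - g y)\<^sup>2) \<partial>J x)"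
    unfolding energy_density_def using assms(3-5)
    by (intro nn_integral_mono) (simp flip: ennreal_mult ennreal_plus)
  also have "\<dots> = ennreal a * energy_density v x + ennreal b * energy_density g x"
    unfolding energy_density_def by (simp add: nn_integral_add nn_integral_cmult)
  finally show ?thesis .
qed

lemma cross_integrable:
  assumes [measurable]: "v \<in> borel_measurable borel" "A \<in> sets borel"
    and fin: "(\<integral>\<^sup>+x. indicator A x * energy_density v x \<partial>\<mu>) < \<infinity>"
    and \<phi>: "\<phi> \<in> F" "AE x in \<mu>. x \<notin> A \<longrightarrow> \<phi> x = 0"
  shows "integrable j (\<lambda>p. (\<phi> (fst p) - \<phi> (snd p)) * (v (fst p) - v (snd p)))"
proof (rule Bochner_Integration.integrable_bound)
  have [measurable]: "\<phi> \<in> borel_measurable borel"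
    using F_measurable[OF \<phi>(1)] measurable_cong_sets[OF sets_mu refl] by blast
  let ?G = "\<lambda>p. indicator A (fst p) * (v (fst p) - v (snd p))\<^sup>2 :: real"
  have fst_int: "(\<integral>\<^sup>+p. ennreal (?G p) \<partial>j) < \<infinity>"
    using fin nn_integral_energy_density[of v A] by (simp add: ennreal_mult'' ennreal_indicator)
  have "(\<integral>\<^sup>+p. ennreal (?G (snd p, fst p)) \<partial>j) = (\<integral>\<^sup>+p. ennreal (?G p) \<partial>j)"
    by (rule nn_integral_j_swap[of "\<lambda>p. ennreal (?G p)"]) measurable
  with fst_int have "(\<integral>\<^sup>+p. ennreal (?G (snd p, fst p)) \<partial>j) < \<infinity>" by simp
  with fst_int have "integrable j ?G" "integrable j (\<lambda>p. ?G (snd p, fst p))"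
    by (auto intro!: integrableI_nonneg)
  then show "integrable j (\<lambda>p. (\<phi> (fst p) - \<phi> (snd p))\<^sup>2 + ?G p + ?G (snd p, fst p))"
    using jump_energy_integrable[OF \<phi>(1)] by simp
  show "(\<lambda>p. (\<phi> (fst p) - \<phi> (snd p)) * (v (fst p) - v (snd p))) \<in> borel_measurable j" by measurable
  show "AE p in j. norm ((\<phi> (fst p) - \<phi> (snd p)) * (v (fst p) - v (snd p)))
      \<le> norm ((\<phi> (fst p) - \<phi> (snd p))\<^sup>2 + ?G p + ?G (snd p, fst p))"
    using AE_j[OF \<phi>(2)]
  proof eventually_elim
    case (elim p)
    let ?a = "\<phi> (fst p) - \<phi> (snd p)" and ?b = "v (fst p) - v (snd p)"
    have ab: "\<bar>?a * ?b\<bar> \<le> ?a\<^sup>2 + ?b\<^sup>2"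
    proof -
      have "2 * \<bar>?a * ?b\<bar> \<le> ?a\<^sup>2 + ?b\<^sup>2"
        using sum_squares_bound[of "\<bar>?a\<bar>" "\<bar>?b\<bar>"] by (simp add: abs_mult)
      then show ?thesis by linarith
    qed
    have "\<bar>?a * ?b\<bar> \<le> ?a\<^sup>2 + ?G p + ?G (snd p, fst p)"
    proof (cases "fst p \<in> A \<or> snd p \<in> A")
      case True
      then have "?b\<^sup>2 \<le> ?G p + ?G (snd p, fst p)" by (auto simp: power2_commute indicator_def)
      with ab show ?thesis by linarith
    next
      case False
      then show ?thesis using elim by simp
    qed
    then show ?case by simp
  qed
qed

text \<open>A test function inside \<open>A\<close> and a function outside \<open>A\<close> interact only through jumps: expanding
  \<open>(\<phi>(x) - \<phi>(y))(v(x) - v(y))\<close>, the products \<open>\<phi>(x)v(x)\<close> and \<open>\<phi>(y)v(y)\<close> vanish, and the two mixed products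
  contribute the same amount by the symmetry of \<open>j\<close>.\<close>

lemma jump_form_disjoint:
  assumes v [measurable]: "v \<in> borel_measurable borel" and v0: "\<And>x. 0 \<le> v x" "\<And>x. x \<in> A \<Longrightarrow> v x = 0"
    and H: "AE x in \<mu>. x \<in> A \<longrightarrow> (\<integral>\<^sup>+y. ennreal (v y) \<partial>J x) = ennreal (h x)" "\<And>x. 0 \<le> h x"
    and h: "h \<in> L2 \<mu> UNIV" and \<phi>: "\<phi> \<in> L2 \<mu> UNIV" "AE x in \<mu>. x \<notin> A \<longrightarrow> \<phi> x = 0"
  shows "jump_form j \<phi> v = - 2 * L2_inner \<mu> h \<phi>"
proof -
  have [measurable]: "\<phi> \<in> borel_measurable borel"
    using L2_measurable[OF \<phi>(1)] measurable_cong_sets[OF sets_mu refl] by blast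
  have nn: "(\<integral>\<^sup>+p. ennreal (\<psi> (fst p) * v (snd p)) \<partial>j) = (\<integral>\<^sup>+x. ennreal (\<psi> x * h x) \<partial>\<mu>)"
    if \<psi> [measurable]: "\<psi> \<in> borel_measurable borel" and \<psi>0: "\<And>x. 0 \<le> \<psi> x" "AE x in \<mu>. x \<notin> A \<longrightarrow> \<psi> x = 0" for \<psi>
  proof -
    have "(\<integral>\<^sup>+p. ennreal (\<psi> (fst p) * v (snd p)) \<partial>j) = (\<integral>\<^sup>+p. ennreal (\<psi> (fst p)) * ennreal (v (snd p)) \<partial>j)"
      using \<psi>0(1) v0(1) by (simp add: ennreal_mult)
    also have "\<dots> = (\<integral>\<^sup>+x. ennreal (\<psi> x) * (\<integral>\<^sup>+y. ennreal (v y) \<partial>J x) \<partial>\<mu>)"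
      by (rule nn_integral_j_product[of "\<lambda>x. ennreal (\<psi> x)" "\<lambda>y. ennreal (v y)"]) measurable
    also have "\<dots> = (\<integral>\<^sup>+x. ennreal (\<psi> x * h x) \<partial>\<mu>)"
    proof (rule nn_integral_cong_AE)
      show "AE x in \<mu>. ennreal (\<psi> x) * (\<integral>\<^sup>+y. ennreal (v y) \<partial>J x) = ennreal (\<psi> x * h x)"
        using H(1) \<psi>0(2) by eventually_elim (use \<psi>0(1) H(2) in \<open>auto simp: ennreal_mult\<close>)
    qed
    finally show ?thesis .
  qed
  have [measurable]: "h \<in> borel_measurable \<mu>" by (rule L2_measurable[OF h])
  let ?a = "\<lambda>p. \<phi> (fst p) * v (snd p)"
  let ?P = "\<lambda>x. max (\<phi> x) 0" and ?N = "\<lambda>x. max (- \<phi> x) 0"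
  have int_h: "integrable \<mu> (\<lambda>x. \<phi> x * h x)" by (rule L2_mult_integrable[OF \<phi>(1) h])
  have part: "integrable j (\<lambda>p. \<psi> (fst p) * v (snd p)) \<and>
      (LINT p|j. \<psi> (fst p) * v (snd p)) = (LINT x|\<mu>. \<psi> x * h x) \<and> integrable \<mu> (\<lambda>x. \<psi> x * h x)"
    if \<psi> [measurable]: "\<psi> \<in> borel_measurable borel" and \<psi>0: "\<And>x. 0 \<le> \<psi> x" "\<And>x. \<psi> x \<le> \<bar>\<phi> x\<bar>" for \<psi>
  proof -
    have "AE x in \<mu>. x \<notin> A \<longrightarrow> \<psi> x = 0"
      using \<phi>(2) by eventually_elim (use \<psi>0 in \<open>metis abs_0 order_antisym\<close>)
    note nn = nn[OF \<psi> \<psi>0(1) this]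
    have int: "integrable \<mu> (\<lambda>x. \<psi> x * h x)"
      by (rule Bochner_Integration.integrable_bound[OF int_h])
        (use \<psi>0 H(2) in \<open>auto simp: abs_mult intro!: mult_right_mono AE_I2\<close>)
    have "integrable j (\<lambda>p. \<psi> (fst p) * v (snd p))"
    proof (rule integrableI_nonneg)
      show "(\<integral>\<^sup>+p. ennreal (\<psi> (fst p) * v (snd p)) \<partial>j) < \<infinity>"
        unfolding nn using int \<psi>0(1) H(2) by (subst nn_integral_eq_integral) auto
    qed (use \<psi>0(1) v0(1) in auto)
    moreover have "(LINT p|j. \<psi> (fst p) * v (snd p)) = (LINT x|\<mu>. \<psi> x * h x)"
      using nn \<psi>0(1) v0(1) H(2) by (subst (1 2) integral_eq_nn_integral) auto
    ultimately show ?thesis using int by simp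
  qed
  have P: "?P \<in> borel_measurable borel" "\<And>x. 0 \<le> ?P x" "\<And>x. ?P x \<le> \<bar>\<phi> x\<bar>"
    and N: "?N \<in> borel_measurable borel" "\<And>x. 0 \<le> ?N x" "\<And>x. ?N x \<le> \<bar>\<phi> x\<bar>" by auto
  note P = part[OF P] and N = part[OF N]
  have \<phi>_split: "\<phi> x = ?P x - ?N x" for x by (simp add: max_def)
  have a_eq: "?a p = ?P (fst p) * v (snd p) - ?N (fst p) * v (snd p)" for p
    by (subst \<phi>_split) (simp add: left_diff_distrib)
  have h_eq: "h x * \<phi> x = ?P x * h x - ?N x * h x" for x
    by (subst \<phi>_split) (simp add: algebra_simps)
  have a_int: "integrable j ?a" and a_val: "(LINT p|j. ?a p) = L2_inner \<mu> h \<phi>"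
    unfolding a_eq h_eq L2_inner_def using P N by simp_all
  let ?s = "\<lambda>p. (snd p, fst p)"
  have swap: "integrable j (\<lambda>p. ?a (?s p)) \<and> (LINT p|j. ?a (?s p)) = (LINT p|j. ?a p)"
  proof -
    have *: "(\<integral>\<^sup>+p. ennreal (k * ?a (?s p)) \<partial>j) = (\<integral>\<^sup>+p. ennreal (k * ?a p) \<partial>j)" for k
      by (rule nn_integral_j_swap[of "\<lambda>p. ennreal (k * ?a p)"]) measurable
    have **: "(\<integral>\<^sup>+p. ennreal \<bar>?a (?s p)\<bar> \<partial>j) = (\<integral>\<^sup>+p. ennreal \<bar>?a p\<bar> \<partial>j)"
      by (rule nn_integral_j_swap[of "\<lambda>p. ennreal \<bar>?a p\<bar>"]) measurable
    have "integrable j (\<lambda>p. ?a (?s p))"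
      using a_int ** by (auto simp: integrable_iff_bounded)
    then show ?thesis
      using a_int *[of 1] *[of "-1"] by (simp add: real_lebesgue_integral_def)
  qed
  have disjoint: "AE x in \<mu>. \<phi> x * v x = 0"
    using \<phi>(2) by eventually_elim (use v0(2) in auto)
  have "jump_form j \<phi> v = (LINT p|j. - ?a p - ?a (?s p))"
    unfolding jump_form_def
  proof (rule integral_cong_AE)
    show "AE p in j. (\<phi> (fst p) - \<phi> (snd p)) * (v (fst p) - v (snd p)) = - ?a p - ?a (?s p)"
      using AE_j[OF disjoint] by eventually_elim (auto simp: left_diff_distrib right_diff_distrib)
  qed measurable
  also have "\<dots> = - 2 * L2_inner \<mu> h \<phi>"
    using swap a_int a_val by simp
  finally show ?thesis .
qed

end

section \<open>Removing the negative part\<close>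

locale radon_jump_space = jump_dirichlet_space \<mu> F E EL j J
  for \<mu> :: "'a::polish_space measure" and F E EL j J +
  assumes radon: "radon_on UNIV \<mu>" and ball_compact: "\<And>(x :: 'a) r. compact (closure (ball x r))"
begin

lemma emeasure_compact: "compact K \<Longrightarrow> emeasure \<mu> K < \<infinity>"
  using radon by (simp add: radon_on_def)

lemma emeasure_ball: "emeasure \<mu> (ball x r) < \<infinity>"
  by (rule le_less_trans[OF emeasure_mono emeasure_compact[OF ball_compact]])
    (use closure_subset in \<open>auto simp: sets_mu\<close>)

lemma sigma_finite: "sigma_finite_measure \<mu>"
proof
  show "\<exists>A. countable A \<and> A \<subseteq> sets \<mu> \<and> \<Union> A = space \<mu> \<and> (\<forall>a\<in>A. emeasure \<mu> a \<noteq> \<infinity>)"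
  proof (intro exI conjI ballI)
    show "(\<Union>n. ball undefined (real n)) = space \<mu>"
      using reals_Archimedean2 by (auto simp: space_mu)
  qed (use emeasure_ball in \<open>auto simp: sets_mu less_top[symmetric]\<close>)
qed

lemma bounded_L1_loc:
  assumes g: "g \<in> borel_measurable \<mu>" "\<And>x. \<bar>g x\<bar> \<le> c"
  shows "g \<in> L1_loc \<mu>"
proof -
  have "set_integrable \<mu> K g" if K: "compact K" for K
    unfolding set_integrable_def
  proof (rule Bochner_Integration.integrable_bound)
    have [measurable]: "K \<in> sets \<mu>" using K by (simp add: sets_mu borel_compact)
    show "integrable \<mu> (\<lambda>x. c * indicator K x)" using emeasure_compact[OF K] by simp
    show "(\<lambda>x. indicator K x *\<^sub>R g x) \<in> borel_measurable \<mu>" using g(1) by measurable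
    show "AE x in \<mu>. norm (indicator K x *\<^sub>R g x) \<le> norm (c * indicator K x)"
      using g(2) by (auto simp: indicator_def intro!: AE_I2 order_trans[OF g(2)])
  qed
  then show ?thesis using g(1) by (simp add: L1_loc_def)
qed

text \<open>Adding the negative part \<open>f\<^sub>-\<close> to \<open>f\<close>, which vanishes on \<open>B = B(x\<^sub>0,R)\<close>, changes the value of the form on
  a test function \<open>\<phi>\<close> inside \<open>B' = B(x\<^sub>0,R')\<close> by \<open>- 2 (h,\<phi>)\<close>, where \<open>h(x) = \<integral> f\<^sub>-(y) J(x,dy)\<close> is at most the tail
  of \<open>f\<^sub>-\<close>. Adding \<open>2 g\<close> with \<open>g = G\<^sup>B\<^sup>' h\<close> restores that value exactly, so that \<open>f\<^sub>+ + 2 g\<close> is harmonic or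
  superharmonic on \<open>B'\<close> along with \<open>f\<close>; and \<open>g\<close> is bounded by the tail times the bound \<open>K\<close> for \<open>G\<^sup>B\<^sup>' 1\<close>.\<close>

lemma nonneg_replacement:
  fixes x0 :: 'a
  assumes R': "R' < R" "R' \<le> s * R"
    and f: "f \<in> F' \<mu> F J (ball x0 R)" "nonneg_on \<mu> (ball x0 R) f"
    and tail: "tail \<mu> J x0 R s (neg_part f) \<le> ennreal T" "0 \<le> T"
    and K: "\<And>\<alpha> r. 0 < \<alpha> \<Longrightarrow> \<alpha> \<le> 1 \<Longrightarrow> resolvent (ball x0 R') \<alpha> (indicator (ball x0 R')) r \<Longrightarrow> AE x in \<mu>. r x \<le> K" "0 \<le> K"
    and w: "local_extension \<mu> F (ball x0 R) f w"
  obtains u w' where "u \<in> F' \<mu> F J (ball x0 R')" "local_extension \<mu> F (ball x0 R') u w'"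
    "\<And>x. 0 \<le> u x" "\<And>x. f x \<le> u x" "AE x in \<mu>. x \<in> ball x0 R \<longrightarrow> u x \<le> f x + 2 * (T * K)"
    "\<And>\<phi>. \<phi> \<in> D (ball x0 R') \<Longrightarrow> ext_form EL j w' u \<phi> = ext_form EL j w f \<phi>"
proof -
  let ?B = "ball x0 R" and ?B' = "ball x0 R'"
  have B'B: "?B' \<subseteq> ?B" using R' by auto
  have [measurable]: "?B \<in> sets borel" "?B' \<in> sets borel" by simp_all
  have [measurable]: "f \<in> borel_measurable borel"
    using f(1) measurable_cong_sets[OF sets_mu refl] by (auto simp: F'_def L1_loc_def)
  have f_nn: "AE x in \<mu>. x \<in> ?B \<longrightarrow> 0 \<le> f x" using f(2) by (simp add: nonneg_on_def)
  define v where "v x = neg_part f x * indicator (- ?B) x" for x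
  have v_meas [measurable]: "v \<in> borel_measurable borel" unfolding v_def neg_part_def by measurable
  have v0: "0 \<le> v x" and v_in: "x \<in> ?B \<Longrightarrow> v x = 0" for x by (auto simp: v_def neg_part_def)
  have pos: "AE x in \<mu>. max (f x) 0 = f x + v x"
    using f_nn by eventually_elim (auto simp: v_def neg_part_def indicator_def)
  define H where "H x = (\<integral>\<^sup>+y. ennreal (v y) \<partial>J x)" for x
  have [measurable]: "H \<in> borel_measurable borel" unfolding H_def[abs_def] by measurable
  have "AE x in \<mu>. x \<in> ball x0 (s * R) \<longrightarrow> H x \<le> tail \<mu> J x0 R s (neg_part f)"
  proof -
    have H_eq: "H = (\<lambda>z. \<integral>\<^sup>+y\<in>- ?B. ennreal \<bar>neg_part f y\<bar> \<partial>J z)"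
      unfolding H_def by (intro ext nn_integral_cong) (auto simp: v_def neg_part_def indicator_def)
    have "AE x in restrict_space \<mu> (ball x0 (s * R)). H x \<le> esssup (restrict_space \<mu> (ball x0 (s * R))) H"
      by (rule esssup_AE)
    then show ?thesis
      by (subst (asm) AE_restrict_space_iff) (auto simp: tail_def H_eq sets_mu space_mu)
  qed
  then have H_le: "AE x in \<mu>. x \<in> ?B' \<longrightarrow> H x \<le> ennreal T"
    by eventually_elim (use R' tail(1) in \<open>force intro: order_trans\<close>)
  define h where "h x = enn2real (H x) * indicator ?B' x" for x
  have [measurable]: "h \<in> borel_measurable borel" unfolding h_def by measurable
  have h_nn: "0 \<le> h x" for x by (simp add: h_def)
  have h_le: "AE x in \<mu>. h x \<le> T * indicator ?B' x"
    using H_le by eventually_elim (auto simp: h_def indicator_def intro: enn2real_leI tail(2))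
  have h_L2: "h \<in> L2 \<mu> ?B'"
  proof -
    have "integrable \<mu> (\<lambda>x. T\<^sup>2 * indicator ?B' x)" using emeasure_ball by (simp add: sets_mu)
    then have "integrable \<mu> (\<lambda>x. (h x)\<^sup>2)"
    proof (rule Bochner_Integration.integrable_bound)
      show "AE x in \<mu>. norm ((h x)\<^sup>2) \<le> norm (T\<^sup>2 * indicator ?B' x)"
        using h_le by eventually_elim (use h_nn in \<open>auto simp: indicator_def h_def intro!: power_mono split: if_splits\<close>)
    qed measurable
    then show ?thesis by (simp add: L2_def h_def)
  qed
  have h_T: "AE x in \<mu>. h x \<le> T" using h_le by eventually_elim (use tail(2) in \<open>auto simp: indicator_def of_bool_def split: if_splits\<close>)
  have Hh: "AE x in \<mu>. x \<in> ?B' \<longrightarrow> (\<integral>\<^sup>+y. ennreal (v y) \<partial>J x) = ennreal (h x)"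
    using H_le
  proof eventually_elim
    case (elim x)
    show ?case
    proof
      assume x: "x \<in> ?B'"
      with elim have "H x \<le> ennreal T" by simp
      then have "H x < top" by (rule le_less_trans) (rule ennreal_less_top)
      then show "(\<integral>\<^sup>+y. ennreal (v y) \<partial>J x) = ennreal (h x)" using x by (simp add: h_def H_def)
    qed
  qed
  have B'_sets: "?B' \<in> sets \<mu>" by (simp add: sets_mu)
  obtain g where g: "g \<in> D ?B'" "\<And>x. 0 \<le> g x" "\<And>x. g x \<le> T * K" "\<And>v. v \<in> D ?B' \<Longrightarrow> E g v = L2_inner \<mu> h v"
    by (rule green_function_exists[OF B'_sets emeasure_ball _ K(2) h_L2 AE_I2[OF h_nn] h_T tail(2)])
      (use K(1) in blast, blast)
  have gF: "g \<in> F" by (rule D_subset[OF g(1)])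
  have [measurable]: "g \<in> borel_measurable borel"
    using F_measurable[OF gF] measurable_cong_sets[OF sets_mu refl] by blast
  define u where "u x = max (f x) 0 + 2 * g x" for x
  define w' where "w' = (\<lambda>x. 1 * w x + 2 * g x)"
  have [measurable]: "u \<in> borel_measurable borel" unfolding u_def by measurable
  have wF: "w \<in> F" using w by (simp add: local_extension_def)
  have w'F: "w' \<in> F" unfolding w'_def by (rule form_lincomb[OF form_E wF gF])
  have density_f: "(\<integral>\<^sup>+x. indicator ?B x * energy_density f x \<partial>\<mu>) < \<infinity>"
    using f(1) by (simp add: F'_def energy_density_def mult.commute)
  have density_g: "(\<integral>\<^sup>+x. indicator A x * energy_density g x \<partial>\<mu>) < \<infinity>" if [measurable]: "A \<in> sets borel" for A
  proof -
    have "(\<integral>\<^sup>+x. indicator A x * energy_density g x \<partial>\<mu>) \<le> (\<integral>\<^sup>+p. ennreal ((g (fst p) - g (snd p))\<^sup>2) \<partial>j)"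
      unfolding nn_integral_energy_density[OF \<open>g \<in> borel_measurable borel\<close> that, symmetric]
      by (intro nn_integral_mono) (auto simp: indicator_def)
    also have "\<dots> < \<infinity>" using jump_energy_integrable[OF gF] by (simp add: integrable_iff_bounded)
    finally show ?thesis .
  qed
  have ext: "local_extension \<mu> F ?B' u w'"
    unfolding local_extension_def
  proof (intro conjI exI)
    show "w' \<in> F" by (rule w'F)
    show "strict_nbhd ?B' ?B"
      unfolding strict_nbhd_def compactly_contained_def
    proof (intro conjI allI impI)
      fix C :: "'a set"
      have sub: "closure (C \<inter> ?B') \<subseteq> closure ?B'" by (rule closure_mono) auto
      show "compact (closure (C \<inter> ?B'))"
        using compact_Int_closed[OF ball_compact closed_closure[of "C \<inter> ?B'"], of x0 R'] sub by (simp add: inf.absorb2)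
      have "closure ?B' \<subseteq> cball x0 R'" by (rule closure_minimal) auto
      with sub show "closure (C \<inter> ?B') \<subseteq> ?B" using R' by fastforce
    qed simp
    from w obtain \<Omega>' where \<Omega>': "strict_nbhd ?B \<Omega>'" "AE x in \<mu>. x \<in> \<Omega>' \<longrightarrow> f x = w x"
      unfolding local_extension_def by blast
    have "closure (closure ?B \<inter> ?B) \<subseteq> \<Omega>'"
      using \<Omega>'(1) ball_compact unfolding strict_nbhd_def compactly_contained_def by blast
    then have sub: "?B \<subseteq> \<Omega>'" using closure_subset[of ?B] closure_subset[of "closure ?B \<inter> ?B"] by blast
    show "AE x in \<mu>. x \<in> ?B \<longrightarrow> u x = w' x"
      using \<Omega>'(2) f_nn by eventually_elim (use sub in \<open>auto simp: u_def w'_def\<close>)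
  qed
  have u_F': "u \<in> F' \<mu> F J ?B'"
  proof -
    have "set_integrable \<mu> C u" if C: "compact C" for C
    proof -
      have "g \<in> L1_loc \<mu>" using g(2,3) gF F_measurable by (intro bounded_L1_loc[of g "T * K"]) (auto simp: abs_le_iff intro: order_trans)
      then have "set_integrable \<mu> C (\<lambda>x. 2 * g x)" using C by (simp add: L1_loc_def)
      moreover have "set_integrable \<mu> C (\<lambda>x. max (f x) 0)"
        unfolding set_integrable_def
      proof (rule Bochner_Integration.integrable_bound)
        show "integrable \<mu> (\<lambda>x. indicator C x *\<^sub>R f x)"
          using f(1) C by (simp add: F'_def L1_loc_def set_integrable_def)
        have [measurable]: "C \<in> sets \<mu>" using C by (simp add: sets_mu borel_compact)
        show "(\<lambda>x. indicator C x *\<^sub>R max (f x) 0) \<in> borel_measurable \<mu>" by measurable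
      qed (auto simp: indicator_def)
      ultimately show ?thesis unfolding u_def by (rule set_integral_add(1)[rotated])
    qed
    moreover have "(\<integral>\<^sup>+x. indicator ?B' x * energy_density u x \<partial>\<mu>) < \<infinity>"
    proof -
      have sq: "(u x - u y)\<^sup>2 \<le> 2 * (f x - f y)\<^sup>2 + 8 * (g x - g y)\<^sup>2" for x y
      proof -
        have "(u x - u y)\<^sup>2 = ((max (f x) 0 - max (f y) 0) + 2 * (g x - g y))\<^sup>2"
          by (simp add: u_def algebra_simps)
        also have "\<dots> \<le> 2 * (max (f x) 0 - max (f y) 0)\<^sup>2 + 2 * (2 * (g x - g y))\<^sup>2" by (rule sq_add_le)
        also have "(max (f x) 0 - max (f y) 0)\<^sup>2 \<le> (f x - f y)\<^sup>2"
          by (intro abs_le_square_iff[THEN iffD1]) (auto simp: max_def)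
        also have "(2 * (g x - g y))\<^sup>2 = 4 * (g x - g y)\<^sup>2" by (simp only: power_mult_distrib) simp
        finally show ?thesis by linarith
      qed
      have [measurable]: "energy_density f \<in> borel_measurable borel" "energy_density g \<in> borel_measurable borel"
        by (rule energy_density_measurable, measurable)+
      have "(\<integral>\<^sup>+x. indicator ?B' x * energy_density u x \<partial>\<mu>)
          \<le> (\<integral>\<^sup>+x. ennreal 2 * (indicator ?B x * energy_density f x) + ennreal 8 * (indicator ?B' x * energy_density g x) \<partial>\<mu>)"
        using energy_density_lincomb[OF _ _ sq] B'B by (intro nn_integral_mono) (auto simp: indicator_def)
      also have "\<dots> = ennreal 2 * (\<integral>\<^sup>+x. indicator ?B x * energy_density f x \<partial>\<mu>)
          + ennreal 8 * (\<integral>\<^sup>+x. indicator ?B' x * energy_density g x \<partial>\<mu>)"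
        by (simp add: nn_integral_add nn_integral_cmult)
      also have "\<dots> < \<infinity>" using density_f density_g[of ?B'] by (simp add: ennreal_mult_less_top)
      finally show ?thesis .
    qed
    ultimately show ?thesis
      using ext by (auto simp: F'_def L1_loc_def energy_density_def mult.commute)
  qed
  have ext_eq: "ext_form EL j w' u \<phi> = ext_form EL j w f \<phi>" if \<phi>: "\<phi> \<in> D ?B'" for \<phi>
  proof -
    have \<phi>F: "\<phi> \<in> F" by (rule D_subset[OF \<phi>])
    have \<phi>0: "AE x in \<mu>. x \<notin> ?B' \<longrightarrow> \<phi> x = 0" using D_L2[OF \<phi>] by (simp add: L2_def)
    have \<phi>0B: "AE x in \<mu>. x \<notin> ?B \<longrightarrow> \<phi> x = 0" using \<phi>0 by eventually_elim (use B'B in blast)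
    have [measurable]: "\<phi> \<in> borel_measurable borel"
      using F_measurable[OF \<phi>F] measurable_cong_sets[OF sets_mu refl] by blast
    have density_v: "(\<integral>\<^sup>+x. indicator ?B x * energy_density (\<lambda>x. max (- f x) 0) x \<partial>\<mu>) < \<infinity>"
    proof -
      have "energy_density (\<lambda>x. max (- f x) 0) x \<le> energy_density f x" for x
        unfolding energy_density_def
        by (intro nn_integral_mono ennreal_leI abs_le_square_iff[THEN iffD1]) (auto simp: max_def)
      then have "(\<integral>\<^sup>+x. indicator ?B x * energy_density (\<lambda>x. max (- f x) 0) x \<partial>\<mu>)
          \<le> (\<integral>\<^sup>+x. indicator ?B x * energy_density f x \<partial>\<mu>)"
        by (intro nn_integral_mono mult_left_mono) auto
      with density_f show ?thesis by (rule le_less_trans[rotated])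
    qed
    let ?d = "\<lambda>v p. (\<phi> (fst p) - \<phi> (snd p)) * (v (fst p) - v (snd p))"
    have int_f: "integrable j (?d f)" by (rule cross_integrable[OF _ _ density_f \<phi>F \<phi>0B]) auto
    have int_g: "integrable j (?d g)" by (rule cross_integrable[OF _ _ density_g \<phi>F \<phi>0B]) auto
    have int_n: "integrable j (?d (\<lambda>x. max (- f x) 0))" by (rule cross_integrable[OF _ _ density_v \<phi>F \<phi>0B]) auto
    have neg: "AE x in \<mu>. max (- f x) 0 = v x"
      using f_nn by eventually_elim (auto simp: v_def neg_part_def indicator_def)
    have int_v: "integrable j (?d v)"
    proof (rule integrable_cong_AE_imp[OF int_n])
      show "AE p in j. ?d (\<lambda>x. max (- f x) 0) p = ?d v p"
        using AE_j[OF neg] by eventually_elim simp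
    qed measurable
    have "jump_form j \<phi> u = (LINT p|j. ?d f p + ?d v p + 2 * ?d g p)"
      unfolding jump_form_def
    proof (rule integral_cong_AE)
      show "AE p in j. ?d u p = ?d f p + ?d v p + 2 * ?d g p"
        using AE_j[OF pos] by eventually_elim (simp add: u_def algebra_simps)
    qed measurable
    also have "\<dots> = jump_form j \<phi> f + jump_form j \<phi> v + 2 * jump_form j \<phi> g"
      using int_f int_v int_g by (simp add: jump_form_def)
    also have "jump_form j \<phi> v = - 2 * L2_inner \<mu> h \<phi>"
      by (rule jump_form_disjoint[OF v_meas v0 _ Hh h_nn L2_mono[OF h_L2 subset_UNIV] form_L2[OF form_E \<phi>F] \<phi>0])
        (use B'B v_in in blast)
    finally have jump_u: "jump_form j \<phi> u = jump_form j \<phi> f - 2 * L2_inner \<mu> h \<phi> + 2 * jump_form j \<phi> g" by simp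
    have "EL w' \<phi> = EL w \<phi> + 2 * EL g \<phi>"
      unfolding w'_def using form_lincomb_left[OF form_EL wF gF \<phi>F, of 1 2] by simp
    moreover have "EL g \<phi> + jump_form j \<phi> g = L2_inner \<mu> h \<phi>"
      using E_split[OF gF \<phi>F] g(4)[OF \<phi>] by (simp add: jump_form_def mult.commute)
    ultimately show ?thesis unfolding ext_form_def jump_u by simp
  qed
  show ?thesis
  proof (rule that[OF u_F' ext _ _ _ ext_eq])
    show "0 \<le> u x" "f x \<le> u x" for x using g(2)[of x] by (auto simp: u_def)
    show "AE x in \<mu>. x \<in> ?B \<longrightarrow> u x \<le> f x + 2 * (T * K)"
      using f_nn by eventually_elim (use g(3) in \<open>auto simp: u_def\<close>)
  qed
qed

end

section \<open>Harnack inequalities\<close>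

lemma nonneg_on_mono: "nonneg_on \<mu> A f \<Longrightarrow> B \<subseteq> A \<Longrightarrow> nonneg_on \<mu> B f"
  unfolding nonneg_on_def by (auto elim: eventually_mono)

lemma esup_on_mono:
  assumes [measurable]: "A \<in> sets \<mu>" "f \<in> borel_measurable \<mu>" "u \<in> borel_measurable \<mu>"
    and le: "AE x in \<mu>. x \<in> A \<longrightarrow> f x \<le> u x"
  shows "esup_on \<mu> A f \<le> esup_on \<mu> A u"
  unfolding esup_on_def
proof (rule esssup_AE_mono)
  show "AE x in restrict_space \<mu> A. ereal (f x) \<le> ereal (u x)"
    using le by (subst AE_restrict_space_iff) auto
qed (intro measurable_restrict_space1, measurable)

lemma einf_on_le_add:
  assumes [measurable]: "A \<in> sets \<mu>" "f \<in> borel_measurable \<mu>" "u \<in> borel_measurable \<mu>"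
    and le: "AE x in \<mu>. x \<in> A \<longrightarrow> u x \<le> f x + k"
  shows "einf_on \<mu> A u \<le> einf_on \<mu> A f + ereal k"
proof -
  let ?M = "restrict_space \<mu> A"
  have "AE x in ?M. u x \<le> f x + k"
    using le by (subst AE_restrict_space_iff) auto
  moreover have "AE x in ?M. - ereal (u x) \<le> esssup ?M (\<lambda>x. - ereal (u x))"
    by (rule esssup_AE)
  ultimately have ae: "AE x in ?M. - ereal (f x) \<le> esssup ?M (\<lambda>x. - ereal (u x)) + ereal k"
  proof eventually_elim
    case (elim x)
    have "- ereal (f x) \<le> - ereal (u x) + ereal k" using elim(1) by simp
    also have "\<dots> \<le> esssup ?M (\<lambda>x. - ereal (u x)) + ereal k" using elim(2) by (intro add_right_mono)
    finally show ?case .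
  qed
  have "(\<lambda>x. - ereal (f x)) \<in> borel_measurable ?M" by (intro measurable_restrict_space1) measurable
  then have "esssup ?M (\<lambda>x. - ereal (f x)) \<le> esssup ?M (\<lambda>x. - ereal (u x)) + ereal k"
    using ae by (rule esssup_I)
  then show ?thesis
    unfolding einf_on_def
    by (cases "esssup ?M (\<lambda>x. - ereal (f x))"; cases "esssup ?M (\<lambda>x. - ereal (u x))") auto
qed

lemma einf_on_nonneg:
  assumes [measurable]: "A \<in> sets \<mu>" "f \<in> borel_measurable \<mu>" and nn: "nonneg_on \<mu> A f"
  shows "0 \<le> einf_on \<mu> A f"
proof -
  have "(\<lambda>x. - ereal (f x)) \<in> borel_measurable (restrict_space \<mu> A)"
    by (intro measurable_restrict_space1) measurable
  moreover have "AE x in restrict_space \<mu> A. - ereal (f x) \<le> 0"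
    using nn unfolding nonneg_on_def by (subst AE_restrict_space_iff) auto
  ultimately have "esssup (restrict_space \<mu> A) (\<lambda>x. - ereal (f x)) \<le> 0" by (rule esssup_I)
  then show ?thesis by (simp add: einf_on_def ereal_uminus_le_reorder)
qed

lemma tail_neg_part_0:
  assumes "\<And>x. 0 \<le> u x"
  shows "tail \<mu> J x0 R s (neg_part u) = 0"
proof -
  have "neg_part u = (\<lambda>x. 0)" using assms by (auto simp: neg_part_def fun_eq_iff max_def)
  moreover have "esssup M (\<lambda>z. 0 :: ennreal) \<le> 0" for M :: "'a measure" by (rule esssup_I) auto
  ultimately show ?thesis by (simp add: tail_def)
qed

lemma average_powr_mono:
  assumes [measurable]: "A \<in> sets \<mu>" "f \<in> borel_measurable \<mu>" "u \<in> borel_measurable \<mu>"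
    and A: "emeasure \<mu> A < \<infinity>" and le: "AE x in \<mu>. x \<in> A \<longrightarrow> 0 \<le> f x \<and> f x \<le> u x \<and> u x \<le> c" and q: "0 < q"
  shows "average \<mu> A (\<lambda>x. f x powr q) powr (1 / q) \<le> average \<mu> A (\<lambda>x. u x powr q) powr (1 / q)"
proof -
  have int: "set_integrable \<mu> A (\<lambda>x. g x powr q)"
    if [measurable]: "g \<in> borel_measurable \<mu>" and g: "AE x in \<mu>. x \<in> A \<longrightarrow> 0 \<le> g x \<and> g x \<le> c" for g
    unfolding set_integrable_def
  proof (rule Bochner_Integration.integrable_bound)
    show "integrable \<mu> (\<lambda>x. c powr q * indicator A x)" using A by simp
    show "AE x in \<mu>. norm (indicator A x *\<^sub>R g x powr q) \<le> norm (c powr q * indicator A x)"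
      using g by eventually_elim (use q in \<open>auto simp: indicator_def intro!: powr_mono2\<close>)
  qed measurable
  have f: "set_integrable \<mu> A (\<lambda>x. f x powr q)" by (rule int) (use le in \<open>auto elim: eventually_mono\<close>)
  have u: "set_integrable \<mu> A (\<lambda>x. u x powr q)" by (rule int) (use le in \<open>auto elim: eventually_mono\<close>)
  have "(LINT x:A|\<mu>. f x powr q) \<le> (LINT x:A|\<mu>. u x powr q)"
    unfolding set_lebesgue_integral_def
  proof (rule integral_mono_AE)
    show "AE x in \<mu>. indicator A x *\<^sub>R f x powr q \<le> indicator A x *\<^sub>R u x powr q"
      using le by eventually_elim (use q in \<open>auto simp: indicator_def intro!: powr_mono2\<close>)
  qed (use f u in \<open>auto simp: set_integrable_def\<close>)
  moreover have "0 \<le> (LINT x:A|\<mu>. f x powr q)"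
    unfolding set_lebesgue_integral_def by (rule integral_nonneg_AE) (auto simp: indicator_def)
  ultimately show ?thesis
    unfolding average_def using q by (intro powr_mono2 divide_right_mono divide_nonneg_nonneg) auto
qed

lemma ereal_harnack_arith:
  assumes X: "X \<le> ereal C * (eu + ereal w' * 0)" and eu: "eu \<le> e + ereal b" and b: "b \<le> a * (w * T)"
    and nonneg: "0 \<le> e" "0 \<le> a" "0 \<le> w" "0 \<le> T" "0 < C"
  shows "X \<le> ereal (C * (1 + a)) * (e + ereal w * ereal T)"
proof (cases e)
  case (real r)
  have "X \<le> ereal C * eu" using X by simp
  also have "\<dots> \<le> ereal C * (e + ereal b)" using eu nonneg by (intro ereal_mult_left_mono) auto
  also have "\<dots> = ereal (C * (r + b))" by (simp add: real)
  also have "\<dots> \<le> ereal (C * (1 + a) * (r + w * T))"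
  proof -
    have "r + b \<le> (1 + a) * (r + w * T)"
    proof -
      have "0 \<le> a * r" "0 \<le> w * T" using nonneg real by simp_all
      moreover have "(1 + a) * (r + w * T) = r + w * T + a * r + a * (w * T)" by (simp add: algebra_simps)
      ultimately show ?thesis using b by linarith
    qed
    then show ?thesis using nonneg by (simp add: mult.assoc)
  qed
  finally show ?thesis by (simp add: real)
next
  case PInf
  then show ?thesis using nonneg by (simp add: add_pos_nonneg)
qed (use nonneg in simp)

lemma ereal_infinite_tail:
  assumes "0 \<le> e" "0 < w" "0 < C"
  shows "X \<le> ereal C * (e + ereal w * enn2ereal top)"
  using assms by (cases e) (auto simp: top_ennreal.rep_eq top_ereal_def)

lemma scale_function_bound:
  assumes "scale_function W"
  obtains CW \<beta> where "CW \<ge> 1" "\<And>x r R. 0 < r \<Longrightarrow> r \<le> R \<Longrightarrow> W x R \<le> CW * (R / r) powr \<beta> * W x r"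
proof -
  from assms obtain CW \<beta>1 \<beta>2 where W: "CW \<ge> 1"
    "\<And>x y r R. 0 < r \<and> r \<le> R \<and> dist x y \<le> R \<Longrightarrow> W x R / W y r \<le> CW * (R / r) powr \<beta>2"
    and pos: "\<And>x r. r > 0 \<Longrightarrow> W x r > 0"
    unfolding scale_function_def by blast
  have "W x R \<le> CW * (R / r) powr \<beta>2 * W x r" if "0 < r" "r \<le> R" for x r R
    using W(2)[of r R x x] pos[of r x] that by (simp add: pos_divide_le_eq)
  with W(1) show ?thesis by (rule that)
qed

context radon_jump_space
begin

lemma F'_measurable: "f \<in> F' \<mu> F J \<Omega> \<Longrightarrow> f \<in> borel_measurable \<mu>"
  by (simp add: F'_def L1_loc_def)

text \<open>Here the bound on the resolvents is the one that comes from the exit time potential \<open>G\<close>.\<close>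

lemma nonneg_replacement_E_le:
  fixes x0 :: 'a
  assumes hs: "heat_semigroup \<mu> E (D (ball x0 R')) (ball x0 R') P"
    and G: "is_green_potential \<mu> P (indicator (ball x0 R')) G"
      "AE x in \<mu>. x \<in> ball x0 R' \<longrightarrow> G x \<le> ennreal K" "0 \<le> K"
    and R': "R' < R" "R' \<le> s * R"
    and f: "f \<in> F' \<mu> F J (ball x0 R)" "nonneg_on \<mu> (ball x0 R) f" "bounded_on \<mu> (ball x0 R) f"
    and tail: "tail \<mu> J x0 R s (neg_part f) = ennreal T" "0 \<le> T"
    and w: "local_extension \<mu> F (ball x0 R) f w"
  obtains u w' where "u \<in> F' \<mu> F J (ball x0 R')" "local_extension \<mu> F (ball x0 R') u w'"
    "\<And>x. 0 \<le> u x" "\<And>x. f x \<le> u x" "AE x in \<mu>. x \<in> ball x0 R \<longrightarrow> u x \<le> f x + 2 * (T * K)"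
    "nonneg_on \<mu> UNIV u" "bounded_on \<mu> (ball x0 R) u"
    "\<And>\<phi>. \<phi> \<in> D (ball x0 R') \<Longrightarrow> ext_form EL j w' u \<phi> = ext_form EL j w f \<phi>"
proof -
  interpret S: heat_semigroup_on \<mu> E "D (ball x0 R')" "ball x0 R'" P by unfold_locales (rule hs)
  have B': "ball x0 R' \<in> sets \<mu>" by (simp add: sets_mu)
  have sub: "D (ball x0 R') \<subseteq> L2 \<mu> (ball x0 R')" using D_L2 by auto
  have res: "AE x in \<mu>. r x \<le> K"
    if "0 < \<alpha>" "\<alpha> \<le> 1" "resolvent (ball x0 R') \<alpha> (indicator (ball x0 R')) r" for \<alpha> r
    using that sub unfolding resolvent_def
    by (intro S.resolvent_of_1_le[OF sigma_finite B' emeasure_ball that(1) _ _ sub _ G(1,3,2)]) auto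
  obtain u w' where u: "u \<in> F' \<mu> F J (ball x0 R')" "local_extension \<mu> F (ball x0 R') u w'"
    "\<And>x. 0 \<le> u x" "\<And>x. f x \<le> u x" "AE x in \<mu>. x \<in> ball x0 R \<longrightarrow> u x \<le> f x + 2 * (T * K)"
    "\<And>\<phi>. \<phi> \<in> D (ball x0 R') \<Longrightarrow> ext_form EL j w' u \<phi> = ext_form EL j w f \<phi>"
    by (rule nonneg_replacement[OF R' f(1,2) eq_refl[OF tail(1)] tail(2) _ G(3) w])
      (use res in blast, blast)
  from f(3) obtain k where k: "AE x in \<mu>. x \<in> ball x0 R \<longrightarrow> \<bar>f x\<bar> \<le> k" by (auto simp: bounded_on_def)
  have "AE x in \<mu>. x \<in> ball x0 R \<longrightarrow> \<bar>u x\<bar> \<le> k + 2 * (T * K)"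
    using k u(5) by eventually_elim (use u(3) in auto)
  then have bdd: "bounded_on \<mu> (ball x0 R) u" by (auto simp: bounded_on_def)
  have nn: "nonneg_on \<mu> UNIV u" using u(3) by (simp add: nonneg_on_def)
  show ?thesis by (rule that[OF u(1-5) nn bdd u(6)])
qed

end

lemma wEH_imp_wEH0:
  assumes "wEH \<mu> F E EL j J W q"
  shows "wEH0 \<mu> F E EL j J W q"
proof -
  from assms obtain C s0 where C: "C > 1" "0 < s0" "s0 < 1" and H: "\<And>x0 R s f. 0 < R \<and> ereal R < Rbar (UNIV :: 'a set) \<and> 0 < s \<and> s \<le> s0 \<and>
      nonneg_on \<mu> (ball x0 R) f \<and> bounded_on \<mu> (ball x0 R) f \<and> superharmonic \<mu> F E EL j J (ball x0 R) f \<Longrightarrow>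
      ereal (average \<mu> (ball x0 (s * R)) (\<lambda>x. f x powr q) powr (1 / q))
        \<le> ereal C * (einf_on \<mu> (ball x0 (s * R)) f +
             ereal (W x0 (s * R)) * enn2ereal (tail \<mu> J x0 R (2/3) (neg_part f)))"
    unfolding wEH_def by blast
  show ?thesis unfolding wEH0_def
    by (intro exI[of _ C] exI[of _ s0] conjI C allI impI H) (auto intro: nonneg_on_mono)
qed

lemma EHI_imp_EHI0:
  assumes "EHI \<mu> F E EL j J W"
  shows "EHI0 \<mu> F E EL j J W"
proof -
  from assms obtain C s0 where C: "C > 1" "0 < s0" "s0 < 1" and H: "\<And>x0 R f. 0 < R \<and> ereal R < Rbar (UNIV :: 'a set) \<and>
      nonneg_on \<mu> (ball x0 R) f \<and> bounded_on \<mu> (ball x0 R) f \<and> harmonic \<mu> F E EL j J (ball x0 R) f \<Longrightarrow>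
      esup_on \<mu> (ball x0 (s0 * R)) f
        \<le> ereal C * (einf_on \<mu> (ball x0 (s0 * R)) f +
             ereal (W x0 R) * enn2ereal (tail \<mu> J x0 R (3/4) (neg_part f)))"
    unfolding EHI_def by blast
  show ?thesis unfolding EHI0_def
    by (intro exI[of _ C] exI[of _ s0] conjI C allI impI H) (auto intro: nonneg_on_mono)
qed

locale harnack_setting = radon_jump_space \<mu> F E EL j J
  for \<mu> :: "'a::polish_space measure" and F E EL j J +
  fixes W :: "'a \<Rightarrow> real \<Rightarrow> real" and P :: "'a set \<Rightarrow> real \<Rightarrow> ('a \<Rightarrow> real) \<Rightarrow> 'a \<Rightarrow> real"
  assumes heat: "\<And>\<Omega>. open \<Omega> \<Longrightarrow> heat_semigroup \<mu> E (D \<Omega>) \<Omega> (P \<Omega>)"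
    and scale: "scale_function W" and E_le: "E_le \<mu> W P"
begin

lemma W_pos: "0 < r \<Longrightarrow> 0 < W x r"
  using scale by (simp add: scale_function_def)

lemma W_mono: "0 < r \<Longrightarrow> r \<le> R \<Longrightarrow> W x r \<le> W x R"
  using scale strict_mono_on_leD[of "{0<..}" "W x" r R] by (auto simp: scale_function_def)

text \<open>The factor \<open>1/2\<close> puts \<open>R'\<close> strictly below \<open>\<sigma> Rbar\<close>, also when \<open>Rbar = \<infinity>\<close>.\<close>

lemma exit_time:
  obtains C \<sigma> where "C > 0" "0 < \<sigma>" "\<sigma> < 1"
    "\<And>x0 R R'. 0 < R' \<Longrightarrow> R' \<le> \<sigma> / 2 * R \<Longrightarrow> ereal R < Rbar (UNIV :: 'a set) \<Longrightarrow>
       \<exists>G. is_green_potential \<mu> (P (ball x0 R')) (indicator (ball x0 R')) G \<and>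
         (AE x in \<mu>. x \<in> ball x0 R' \<longrightarrow> G x \<le> ennreal (C * W x0 R'))"
proof -
  from E_le obtain C \<sigma> where C: "C > 0" "0 < \<sigma>" "\<sigma> < 1" and G: "\<And>x0 R. 0 < R \<and> ereal R < ereal \<sigma> * Rbar (UNIV :: 'a set) \<Longrightarrow>
      \<exists>g. is_green_potential \<mu> (P (ball x0 R)) (indicator (ball x0 R)) g \<and>
        (AE x in \<mu>. x \<in> ball x0 R \<longrightarrow> g x \<le> ennreal (C * W x0 R))"
    unfolding E_le_def by blast
  have "ereal R' < ereal \<sigma> * Rbar (UNIV :: 'a set)"
    if "0 < R'" "R' \<le> \<sigma> / 2 * R" "ereal R < Rbar (UNIV :: 'a set)" for R R'
  proof -
    have "0 < \<sigma> / 2 * R" using that by linarith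
    then have "R' < \<sigma> * R" using that by simp
    then have "ereal R' < ereal \<sigma> * ereal R" by simp
    also have "\<dots> \<le> ereal \<sigma> * Rbar (UNIV :: 'a set)" using that(3) C by (intro ereal_mult_left_mono) auto
    finally show ?thesis .
  qed
  with C G show ?thesis by (intro that[of C \<sigma>]) auto
qed

text \<open>The inner radius \<open>s R\<close> may be much smaller than \<open>R\<close>, and the inequality wanted carries the factor
  \<open>W(x\<^sub>0, s R)\<close>. The replacement is therefore made on the ball of radius \<open>R' = s R / s\<^sub>0\<close>, which is comparable to
  \<open>s R\<close>; then \<open>W(x\<^sub>0, R')\<close> is bounded by a multiple of \<open>W(x\<^sub>0, s R)\<close> that does not depend on \<open>s\<close>.\<close>

lemma wEH0_imp_wEH:
  assumes q: "0 < q" and H0: "wEH0 \<mu> F E EL j J W q"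
  shows "wEH \<mu> F E EL j J W q"
proof -
  from H0 obtain C s0 where C: "C > 1" "0 < s0" "s0 < 1" and H: "\<And>x0 R s f. 0 < R \<and> ereal R < Rbar (UNIV :: 'a set) \<and> 0 < s \<and> s \<le> s0 \<and>
      nonneg_on \<mu> UNIV f \<and> bounded_on \<mu> (ball x0 R) f \<and> superharmonic \<mu> F E EL j J (ball x0 R) f \<Longrightarrow>
      ereal (average \<mu> (ball x0 (s * R)) (\<lambda>x. f x powr q) powr (1 / q))
        \<le> ereal C * (einf_on \<mu> (ball x0 (s * R)) f +
             ereal (W x0 (s * R)) * enn2ereal (tail \<mu> J x0 R (2/3) (neg_part f)))"
    unfolding wEH0_def by blast
  obtain CE \<sigma> where CE: "CE > 0" "0 < \<sigma>" "\<sigma> < 1" and exit: "\<And>x0 R R'. 0 < R' \<Longrightarrow> R' \<le> \<sigma> / 2 * R \<Longrightarrow> ereal R < Rbar (UNIV :: 'a set) \<Longrightarrow>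
       \<exists>G. is_green_potential \<mu> (P (ball x0 R')) (indicator (ball x0 R')) G \<and>
         (AE x in \<mu>. x \<in> ball x0 R' \<longrightarrow> G x \<le> ennreal (CE * W x0 R'))"
    using exit_time by blast
  obtain CW \<beta> where CW: "CW \<ge> 1" "\<And>x r R. 0 < r \<Longrightarrow> r \<le> R \<Longrightarrow> W x R \<le> CW * (R / r) powr \<beta> * W x r"
    using scale_function_bound[OF scale] by blast
  define a where "a = 2 * CE * (CW * (1 / s0) powr \<beta>)"
  have a: "0 \<le> a" using CE CW by (simp add: a_def)
  define s1 where "s1 = s0 * (\<sigma> / 2)"
  have s1: "0 < s1" "s1 < 1" using C CE mult_strict_mono[of s0 1 "\<sigma> / 2" 1] by (auto simp: s1_def)
  have main: "ereal (average \<mu> (ball x0 (s * R)) (\<lambda>x. f x powr q) powr (1 / q))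
        \<le> ereal (C * (1 + a)) * (einf_on \<mu> (ball x0 (s * R)) f +
             ereal (W x0 (s * R)) * enn2ereal (tail \<mu> J x0 R (2/3) (neg_part f)))"
    if R: "0 < R" "ereal R < Rbar (UNIV :: 'a set)" and s: "0 < s" "s \<le> s1"
      and f: "nonneg_on \<mu> (ball x0 R) f" "bounded_on \<mu> (ball x0 R) f" "superharmonic \<mu> F E EL j J (ball x0 R) f"
    for x0 R s f
  proof -
    define r where "r = s * R"
    define R' where "R' = r / s0"
    have r: "0 < r" using R s by (simp add: r_def)
    have R'0: "0 < R'" using r C by (simp add: R'_def)
    have rR': "r = s0 * R'" "r \<le> R'" using C r by (auto simp: R'_def field_simps)
    have R'_le: "R' \<le> \<sigma> / 2 * R"
    proof -
      have "r \<le> s1 * R" unfolding r_def using s R by (intro mult_right_mono) auto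
      then show ?thesis using C by (simp add: R'_def s1_def field_simps)
    qed
    have "\<sigma> / 2 * R < 1 / 2 * R" using CE R by simp
    then have R'_R: "R' < R" "R' \<le> 2/3 * R" using R'_le R by linarith+
    note sub = subset_ball[OF order_trans[OF rR'(2) less_imp_le[OF R'_R(1)]], of x0]
    from f(3) obtain w where w: "local_extension \<mu> F (ball x0 R) f w" and fF': "f \<in> F' \<mu> F J (ball x0 R)"
      and sup: "\<And>\<phi>. \<phi> \<in> D (ball x0 R) \<Longrightarrow> AE x in \<mu>. 0 \<le> \<phi> x \<Longrightarrow> ext_form EL j w f \<phi> \<ge> 0"
      unfolding superharmonic_def by blast
    have ball_sets: "ball x0 r \<in> sets \<mu>" by (simp add: sets_mu)
    note f_meas = F'_measurable[OF fF']
    have e0: "0 \<le> einf_on \<mu> (ball x0 r) f"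
      by (rule einf_on_nonneg[OF ball_sets f_meas nonneg_on_mono[OF f(1) sub]])
    show ?thesis
    proof (cases "tail \<mu> J x0 R (2/3) (neg_part f)")
      case (real T)
      from exit[OF R'0 R'_le R(2), of x0] obtain G where
        G: "is_green_potential \<mu> (P (ball x0 R')) (indicator (ball x0 R')) G"
          "AE x in \<mu>. x \<in> ball x0 R' \<longrightarrow> G x \<le> ennreal (CE * W x0 R')" by blast
      have K0: "0 \<le> CE * W x0 R'" using CE W_pos[OF R'0] by (simp add: less_imp_le)
      obtain u w' where u: "u \<in> F' \<mu> F J (ball x0 R')" "local_extension \<mu> F (ball x0 R') u w'"
        "\<And>x. 0 \<le> u x" "\<And>x. f x \<le> u x" "AE x in \<mu>. x \<in> ball x0 R \<longrightarrow> u x \<le> f x + 2 * (T * (CE * W x0 R'))"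
        "nonneg_on \<mu> UNIV u" "bounded_on \<mu> (ball x0 R) u"
        "\<And>\<phi>. \<phi> \<in> D (ball x0 R') \<Longrightarrow> ext_form EL j w' u \<phi> = ext_form EL j w f \<phi>"
        using nonneg_replacement_E_le[OF heat[OF open_ball] G K0 R'_R fF' f(1,2) real(2,1) w] by blast
      note u_meas = F'_measurable[OF u(1)]
      have D_sub: "D (ball x0 R') \<subseteq> D (ball x0 R)" by (rule D_mono) (use R'_R in auto)
      have "superharmonic \<mu> F E EL j J (ball x0 R') u"
        unfolding superharmonic_def
      proof (intro conjI exI[of _ w'] ballI impI u(1,2))
        fix \<phi> assume \<phi>: "\<phi> \<in> D (ball x0 R')" "AE x in \<mu>. 0 \<le> \<phi> x"
        then show "0 \<le> ext_form EL j w' u \<phi>" using sup D_sub u(8)[OF \<phi>(1)] by auto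
      qed
      moreover have "ereal R' < Rbar (UNIV :: 'a set)" using R'_R(1) R(2) by (meson ereal_less_eq(3) le_less_trans less_imp_le)
      moreover have "bounded_on \<mu> (ball x0 R') u"
        using u(7) R'_R(1) unfolding bounded_on_def by (force elim!: eventually_mono)
      ultimately have X: "ereal (average \<mu> (ball x0 r) (\<lambda>x. u x powr q) powr (1 / q))
          \<le> ereal C * (einf_on \<mu> (ball x0 r) u + ereal (W x0 r) * 0)"
        using H[of R' s0 u x0] R'0 C u(6) tail_neg_part_0[of u \<mu> J x0 R' "2/3", OF u(3)]
        by (simp add: rR'(1)[symmetric] zero_ennreal.rep_eq)
      have "AE x in \<mu>. x \<in> ball x0 r \<longrightarrow> u x \<le> f x + 2 * (T * (CE * W x0 R'))"
        using u(5) by eventually_elim (use sub in blast)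
      from einf_on_le_add[OF ball_sets f_meas u_meas this]
      have eu: "einf_on \<mu> (ball x0 r) u \<le> einf_on \<mu> (ball x0 r) f + ereal (2 * (T * (CE * W x0 R')))" .
      have b: "2 * (T * (CE * W x0 R')) \<le> a * (W x0 r * T)"
      proof -
        have "R' / r = 1 / s0" using r C by (simp add: R'_def)
        with CW(2)[OF r rR'(2), of x0] have "W x0 R' \<le> CW * (1 / s0) powr \<beta> * W x0 r" by simp
        then have "2 * T * CE * W x0 R' \<le> 2 * T * CE * (CW * (1 / s0) powr \<beta> * W x0 r)"
          using real(1) CE by (intro mult_left_mono) auto
        then show ?thesis by (simp add: a_def mult_ac)
      qed
      from u(7) obtain c where c: "AE x in \<mu>. x \<in> ball x0 R \<longrightarrow> \<bar>u x\<bar> \<le> c" by (auto simp: bounded_on_def)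
      have "AE x in \<mu>. x \<in> ball x0 r \<longrightarrow> 0 \<le> f x \<and> f x \<le> u x \<and> u x \<le> c"
        using c f(1)[unfolded nonneg_on_def] by eventually_elim (use sub u(4) in fastforce)
      from average_powr_mono[OF ball_sets f_meas u_meas emeasure_ball this q]
      have "ereal (average \<mu> (ball x0 r) (\<lambda>x. f x powr q) powr (1 / q))
          \<le> ereal (average \<mu> (ball x0 r) (\<lambda>x. u x powr q) powr (1 / q))" by simp
      also have "\<dots> \<le> ereal (C * (1 + a)) * (einf_on \<mu> (ball x0 r) f + ereal (W x0 r) * ereal T)"
        by (rule ereal_harnack_arith[OF X eu b e0 a less_imp_le[OF W_pos[OF r]] real(1)]) (use C in simp)
      finally show ?thesis using real by (simp add: r_def)
    next
      case top
      show ?thesis unfolding top r_def[symmetric]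
        by (rule ereal_infinite_tail[OF e0 W_pos[OF r]]) (use C a in simp)
    qed
  qed
  have C1: "1 < C * (1 + a)"
    by (rule less_le_trans[OF C(1)]) (use C(1) a in simp)
  show ?thesis
    unfolding wEH_def
    by (intro exI[of _ "C * (1 + a)"] exI[of _ s1] conjI C1 s1 allI impI main) (elim conjE, assumption)+
qed

text \<open>Here the factor is \<open>W(x\<^sub>0, R)\<close>, so that any \<open>R'\<close> proportional to \<open>R\<close> will do; \<open>R' = \<sigma> R / 2\<close> is small
  enough for the exit time estimate.\<close>

lemma EHI0_imp_EHI:
  assumes H0: "EHI0 \<mu> F E EL j J W"
  shows "EHI \<mu> F E EL j J W"
proof -
  from H0 obtain C s0 where C: "C > 1" "0 < s0" "s0 < 1" and H: "\<And>x0 R f. 0 < R \<and> ereal R < Rbar (UNIV :: 'a set) \<and>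
      nonneg_on \<mu> UNIV f \<and> bounded_on \<mu> (ball x0 R) f \<and> harmonic \<mu> F E EL j J (ball x0 R) f \<Longrightarrow>
      esup_on \<mu> (ball x0 (s0 * R)) f
        \<le> ereal C * (einf_on \<mu> (ball x0 (s0 * R)) f +
             ereal (W x0 R) * enn2ereal (tail \<mu> J x0 R (3/4) (neg_part f)))"
    unfolding EHI0_def by blast
  obtain CE \<sigma> where CE: "CE > 0" "0 < \<sigma>" "\<sigma> < 1" and exit: "\<And>x0 R R'. 0 < R' \<Longrightarrow> R' \<le> \<sigma> / 2 * R \<Longrightarrow> ereal R < Rbar (UNIV :: 'a set) \<Longrightarrow>
       \<exists>G. is_green_potential \<mu> (P (ball x0 R')) (indicator (ball x0 R')) G \<and>
         (AE x in \<mu>. x \<in> ball x0 R' \<longrightarrow> G x \<le> ennreal (CE * W x0 R'))"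
    using exit_time by blast
  define a where "a = 2 * CE"
  have a: "0 \<le> a" using CE by (simp add: a_def)
  define s1 where "s1 = s0 * (\<sigma> / 2)"
  have s1: "0 < s1" "s1 < 1" using C CE mult_strict_mono[of s0 1 "\<sigma> / 2" 1] by (auto simp: s1_def)
  have main: "esup_on \<mu> (ball x0 (s1 * R)) f
        \<le> ereal (C * (1 + a)) * (einf_on \<mu> (ball x0 (s1 * R)) f +
             ereal (W x0 R) * enn2ereal (tail \<mu> J x0 R (3/4) (neg_part f)))"
    if R: "0 < R" "ereal R < Rbar (UNIV :: 'a set)"
      and f: "nonneg_on \<mu> (ball x0 R) f" "bounded_on \<mu> (ball x0 R) f" "harmonic \<mu> F E EL j J (ball x0 R) f"
    for x0 R f
  proof -
    define R' where "R' = \<sigma> / 2 * R"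
    define r where "r = s1 * R"
    have R'0: "0 < R'" using R CE by (simp add: R'_def)
    have rR': "r = s0 * R'" "r \<le> R'" using C R'0 mult_right_mono[of s0 1 R'] by (auto simp: r_def s1_def R'_def)
    have "\<sigma> / 2 * R < 1 / 2 * R" using CE R by simp
    then have R'_R: "R' < R" "R' \<le> 3/4 * R" using R by (auto simp: R'_def)
    note sub = subset_ball[OF order_trans[OF rR'(2) less_imp_le[OF R'_R(1)]], of x0]
    from f(3) obtain w where w: "local_extension \<mu> F (ball x0 R) f w" and fF': "f \<in> F' \<mu> F J (ball x0 R)"
      and harm: "\<And>\<phi>. \<phi> \<in> D (ball x0 R) \<Longrightarrow> ext_form EL j w f \<phi> = 0"
      unfolding harmonic_def by blast
    have ball_sets: "ball x0 r \<in> sets \<mu>" by (simp add: sets_mu)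
    note f_meas = F'_measurable[OF fF']
    have e0: "0 \<le> einf_on \<mu> (ball x0 r) f"
      by (rule einf_on_nonneg[OF ball_sets f_meas nonneg_on_mono[OF f(1) sub]])
    show ?thesis
    proof (cases "tail \<mu> J x0 R (3/4) (neg_part f)")
      case (real T)
      from exit[OF R'0 _ R(2), of x0] obtain G where
        G: "is_green_potential \<mu> (P (ball x0 R')) (indicator (ball x0 R')) G"
          "AE x in \<mu>. x \<in> ball x0 R' \<longrightarrow> G x \<le> ennreal (CE * W x0 R')" by (auto simp: R'_def)
      have K0: "0 \<le> CE * W x0 R'" using CE W_pos[OF R'0] by (simp add: less_imp_le)
      obtain u w' where u: "u \<in> F' \<mu> F J (ball x0 R')" "local_extension \<mu> F (ball x0 R') u w'"
        "\<And>x. 0 \<le> u x" "\<And>x. f x \<le> u x" "AE x in \<mu>. x \<in> ball x0 R \<longrightarrow> u x \<le> f x + 2 * (T * (CE * W x0 R'))"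
        "nonneg_on \<mu> UNIV u" "bounded_on \<mu> (ball x0 R) u"
        "\<And>\<phi>. \<phi> \<in> D (ball x0 R') \<Longrightarrow> ext_form EL j w' u \<phi> = ext_form EL j w f \<phi>"
        using nonneg_replacement_E_le[OF heat[OF open_ball] G K0 R'_R fF' f(1,2) real(2,1) w] by blast
      note u_meas = F'_measurable[OF u(1)]
      have D_sub: "D (ball x0 R') \<subseteq> D (ball x0 R)" by (rule D_mono) (use R'_R in auto)
      have "harmonic \<mu> F E EL j J (ball x0 R') u"
        unfolding harmonic_def
      proof (intro conjI exI[of _ w'] ballI u(1,2))
        fix \<phi> assume \<phi>: "\<phi> \<in> D (ball x0 R')"
        then show "ext_form EL j w' u \<phi> = 0" using harm D_sub u(8)[OF \<phi>] by auto
      qed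
      moreover have "ereal R' < Rbar (UNIV :: 'a set)" using R'_R(1) R(2) by (meson ereal_less_eq(3) le_less_trans less_imp_le)
      moreover have "bounded_on \<mu> (ball x0 R') u"
        using u(7) R'_R(1) unfolding bounded_on_def by (force elim!: eventually_mono)
      ultimately have X: "esup_on \<mu> (ball x0 r) u
          \<le> ereal C * (einf_on \<mu> (ball x0 r) u + ereal (W x0 R') * 0)"
        using H[of R' u x0] R'0 u(6) tail_neg_part_0[of u \<mu> J x0 R' "3/4", OF u(3)]
        by (simp add: rR'(1)[symmetric] zero_ennreal.rep_eq)
      have "AE x in \<mu>. x \<in> ball x0 r \<longrightarrow> u x \<le> f x + 2 * (T * (CE * W x0 R'))"
        using u(5) by eventually_elim (use sub in blast)
      from einf_on_le_add[OF ball_sets f_meas u_meas this]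
      have eu: "einf_on \<mu> (ball x0 r) u \<le> einf_on \<mu> (ball x0 r) f + ereal (2 * (T * (CE * W x0 R')))" .
      have b: "2 * (T * (CE * W x0 R')) \<le> a * (W x0 R * T)"
      proof -
        have "2 * T * CE * W x0 R' \<le> 2 * T * CE * W x0 R"
          using real(1) CE R'_R(1) W_mono[OF R'0] by (intro mult_left_mono) auto
        then show ?thesis by (simp add: a_def mult_ac)
      qed
      have "esup_on \<mu> (ball x0 r) f \<le> esup_on \<mu> (ball x0 r) u"
        by (rule esup_on_mono[OF ball_sets f_meas u_meas]) (use u(4) in auto)
      also have "\<dots> \<le> ereal (C * (1 + a)) * (einf_on \<mu> (ball x0 r) f + ereal (W x0 R) * ereal T)"
        by (rule ereal_harnack_arith[OF X eu b e0 a less_imp_le[OF W_pos[OF R(1)]] real(1)]) (use C in simp)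
      finally show ?thesis using real by (simp add: r_def)
    next
      case top
      show ?thesis unfolding top r_def[symmetric]
        by (rule ereal_infinite_tail[OF e0 W_pos[OF R(1)]]) (use C a in simp)
    qed
  qed
  have C1: "1 < C * (1 + a)"
    by (rule less_le_trans[OF C(1)]) (use C(1) a in simp)
  show ?thesis
    unfolding EHI_def
    by (intro exI[of _ "C * (1 + a)"] exI[of _ s1] conjI C1 s1 allI impI main) (elim conjE, assumption)+
qed

end

theorem proposition5p4:
  fixes \<mu> :: "'a::polish_space measure"
    and F :: "('a \<Rightarrow> real) set"
    and E EL :: "('a \<Rightarrow> real) \<Rightarrow> ('a \<Rightarrow> real) \<Rightarrow> real"
    and j :: "('a \<times> 'a) measure"
    and J :: "'a \<Rightarrow> 'a measure"
    and W :: "'a \<Rightarrow> real \<Rightarrow> real"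
    and P :: "'a set \<Rightarrow> real \<Rightarrow> ('a \<Rightarrow> real) \<Rightarrow> 'a \<Rightarrow> real"
  assumes "locally compact (UNIV :: 'a set)"
    and "\<And>(x::'a) r. compact (closure (ball x r))"
    and "radon_on UNIV \<mu>"
    and "full_support \<mu>"
    and "VD \<mu>"
    and "RVD \<mu>"
    and "regular_dirichlet_form \<mu> F E"
    and "beurling_deny_no_killing \<mu> F E EL j J"
    and "\<And>\<Omega>. open \<Omega> \<Longrightarrow> heat_semigroup \<mu> E (form_domain_on \<mu> F E \<Omega>) \<Omega> (P \<Omega>)"
    and "scale_function W"
    and "E_le \<mu> W P"
  shows "(\<forall>q. 0 < q \<and> q \<le> 1 \<longrightarrow> (wEH0 \<mu> F E EL j J W q \<longleftrightarrow> wEH \<mu> F E EL j J W q)) \<and>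
         (EHI0 \<mu> F E EL j J W \<longleftrightarrow> EHI \<mu> F E EL j J W)"
proof -
  interpret harnack_setting \<mu> F E EL j J W P
  proof
    show "sets \<mu> = sets borel" using assms(3) by (simp add: radon_on_def)
    show "dirichlet_form \<mu> F E" using assms(7) by (simp add: regular_dirichlet_form_def)
  qed fact+
  show ?thesis using wEH_imp_wEH0 wEH0_imp_wEH EHI_imp_EHI0 EHI0_imp_EHI by blast
qed

end
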